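(* Let $\Phi=\{\phi_i : i\in\mathcal{I}\}\subset L^2(\mathbb{R})$ be a collection of windows such that, for some $s>1$ and a constant $C$, $\big(|\mathcal{V}_{\varphi_0}\phi_i|\ast|\mathcal{V}_{\varphi_0}\phi_i|\big)(z)\le C(1+|z|^2)^{-s}$ for all $z\in\mathbb{R}^2$ and all $i\in\mathcal{I}$. Suppose further that $|\mathcal{V}_{\varphi_0}\varphi_0(z)-\mathcal{V}_{\varphi_0}\phi_i(z)|<C_0\,|\mathcal{V}_{\varphi_0}\varphi_0(z)|$ for all $z\in\mathbb{R}^2$ and all $i\in\mathcal{I}$, where $C_0$ is a constant with $2\,C_0<\|\mathcal{V}_{\varphi_0}\varphi_0\|_1$. Let $\{\eta_\gamma\}_{\gamma\in\Gamma}$ be a well-spread family of symbols on $\mathbb{R}^2$ with $\sum_{\gamma\in\Gamma}\eta_\gamma(z)\approx1$, and for every $\gamma\in\Gamma$ let a window $\phi_{i(\gamma)}$ be chosen from $\Phi$. Then there exist positive constants $A,B$ such that for all $f\in L^2(\mathbb{R})$ $$A\|f\|_2^2\le\sum_{\gamma\in\Gamma}\|H_{\eta_\gamma,\phi_{i(\gamma)}}f\|_2^2\le B\|f\|_2^2.$$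
   Context: For $\gamma=(x,\omega)\in\mathbb{R}\times\mathbb{R}$, the time-frequency shift is $\pi(\gamma)\phi(t)=e^{2\pi i\omega t}\phi(t-x)$. For $\phi,f\in L^2(\mathbb{R})$ the short-time Fourier transform is $\mathcal{V}_\phi f(\gamma)=\langle f,\pi(\gamma)\phi\rangle$. For a symbol $m$ on $\mathbb{R}^2$ the time-frequency localization operator is $H_{m,\phi}f(t)=\int_{\mathbb{R}^2}\mathcal{V}_\phi f(\gamma)\,m(\gamma)\,\pi(\gamma)\phi(t)\,d\gamma$, formally $H_{m,\phi}f=\mathcal{V}_\phi^*(m\,\mathcal{V}_\phi f)$. The standard Gaussian of unit $L^2$-norm is $\varphi_0(t)=2^{1/4}e^{-\pi t^2}$. The symbol $\ast$ denotes convolution on $\mathbb{R}^2$, and $\|\cdot\|_1$ is the norm of $L^1(\mathbb{R}^2)$. A family of symbols $\{\eta_\gamma\colon\mathbb{R}^2\to\mathbb{R}\mid\gamma\in\Gamma\}$ with $\eta_\gamma\in L^1(\mathbb{R}^2)$ is called well-spread if $\Gamma\subset\mathbb{R}^2$ is a discrete set without accumulation points and there exists a continuous function $g\in L^2(\mathbb{R}^2)$ with polynomial decay such that $|\eta_\gamma(\xi)|\le g(\xi-\gamma)$ for all $\xi\in\mathbb{R}^2$, $\gamma\in\Gamma$. The notation $f\approx g$ means that there are constants $0<A\le B<\infty$ with $Ag\le f\le Bg$.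
   Formalization: "Discrete without accumulation points" is strengthened to: the number of points of Γ in unit discs is uniformly bounded; "polynomial decay" of g means |g(z)| ≤ C(1+|z|²)^(-s) for some s>1. Without either the lower bound can fail. *)

theory Defs
  imports "HOL-Analysis.Analysis"
begin

(* Elements of L^2(R) are represented by Borel functions. All operators below
   depend only on the almost-everywhere class of their function arguments
   (the localization operator up to a null set in its last argument). *)
definition L2 :: "(real \<Rightarrow> complex) set" where
  "L2 = {f. f \<in> borel_measurable borel \<and> integrable lborel (\<lambda>t. (norm (f t))\<^sup>2)}"

(* The squared L^2-norm, as an extended real: no convergence is presupposed. *)
definition L2_norm_sq :: "(real \<Rightarrow> complex) \<Rightarrow> ennreal" where
  "L2_norm_sq f = (\<integral>\<^sup>+ t. ennreal ((norm (f t))\<^sup>2) \<partial>lborel)"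

definition L2_inner :: "(real \<Rightarrow> complex) \<Rightarrow> (real \<Rightarrow> complex) \<Rightarrow> complex" where
  "L2_inner f g = (LINT t|lborel. f t * cnj (g t))"

definition tf_shift :: "real \<times> real \<Rightarrow> (real \<Rightarrow> complex) \<Rightarrow> real \<Rightarrow> complex" where
  "tf_shift \<gamma> \<phi> t = cis (2 * pi * snd \<gamma> * t) * \<phi> (t - fst \<gamma>)"

definition stft :: "(real \<Rightarrow> complex) \<Rightarrow> (real \<Rightarrow> complex) \<Rightarrow> real \<times> real \<Rightarrow> complex" where
  "stft \<phi> f \<gamma> = L2_inner f (tf_shift \<gamma> \<phi>)"

(* For an integrable symbol and a window and a function in L^2, the integral
   converges absolutely for almost every t (Minkowski's inequality), so this
   pointwise formula determines an element of L^2(R). *)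
definition loc_op ::
  "(real \<times> real \<Rightarrow> real) \<Rightarrow> (real \<Rightarrow> complex) \<Rightarrow> (real \<Rightarrow> complex) \<Rightarrow> real \<Rightarrow> complex" where
  "loc_op m \<phi> f t = (LINT \<gamma>|lborel. stft \<phi> f \<gamma> * of_real (m \<gamma>) * tf_shift \<gamma> \<phi> t)"

definition gauss0 :: "real \<Rightarrow> complex" where
  "gauss0 t = of_real (2 powr (1/4) * exp (- pi * t\<^sup>2))"

definition conv :: "(real \<times> real \<Rightarrow> real) \<Rightarrow> (real \<times> real \<Rightarrow> real) \<Rightarrow> real \<times> real \<Rightarrow> real" where
  "conv F G z = (LINT w|lborel. F w * G (z - w))"

(* "Discrete without accumulation points" is understood uniformly over the plane
   (points may not accumulate at infinity either), i.e. as relative separation,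
   the sense in which index sets of time-frequency systems are discrete.
   Local finiteness alone is too weak for norm equivalences: splitting the
   symbol near the k-th lattice point into N_k equal parts placed at N_k nearby
   points keeps the sum of the symbols but divides the sum of the squared norms
   by N_k locally.  The first conjunct follows from the second. *)
definition discrete_no_accumulation :: "(real \<times> real) set \<Rightarrow> bool" where
  "discrete_no_accumulation \<Gamma> \<longleftrightarrow>
     (\<forall>z. \<not> z islimpt \<Gamma>) \<and>
     (\<exists>N::nat. \<forall>z. finite (\<Gamma> \<inter> cball z 1) \<and> card (\<Gamma> \<inter> cball z 1) \<le> N)"

(* Polynomial decay is of some order 2 s > 2, where 2 is the dimension of the
   plane; decay of order exactly 2 would not suffice for a lower frame bound. *)
definition polynomial_decay :: "(real \<times> real \<Rightarrow> real) \<Rightarrow> bool" where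
  "polynomial_decay g \<longleftrightarrow> (\<exists>C. \<exists>s>1. \<forall>z. \<bar>g z\<bar> \<le> C * (1 + (norm z)\<^sup>2) powr (- s))"

definition well_spread ::
  "(real \<times> real) set \<Rightarrow> (real \<times> real \<Rightarrow> real \<times> real \<Rightarrow> real) \<Rightarrow> bool" where
  "well_spread \<Gamma> \<eta> \<longleftrightarrow>
     (\<forall>\<gamma>\<in>\<Gamma>. integrable lborel (\<eta> \<gamma>)) \<and>
     discrete_no_accumulation \<Gamma> \<and>
     (\<exists>g. continuous_on UNIV g \<and> integrable lborel (\<lambda>z. (g z)\<^sup>2) \<and> polynomial_decay g \<and>
          (\<forall>\<gamma>\<in>\<Gamma>. \<forall>\<xi>. \<bar>\<eta> \<gamma> \<xi>\<bar> \<le> g (\<xi> - \<gamma>)))"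

definition equivalent_on :: "'b set \<Rightarrow> ('b \<Rightarrow> real) \<Rightarrow> ('b \<Rightarrow> real) \<Rightarrow> bool" where
  "equivalent_on S f g \<longleftrightarrow>
     (\<exists>A B. 0 < A \<and> A \<le> B \<and> (\<forall>x\<in>S. A * g x \<le> f x \<and> f x \<le> B * g x))"

end

theory Submission
  imports Defs "HOL-Probability.Probability" "HOL-Complex_Analysis.Complex_Analysis"
begin

text \<open>
  The short-time Fourier transform \<open>V\<close> with Gaussian window is, up to a Gaussian factor, an entire function.
  Since the Gaussian has a zero-free transform and \<open>\<parallel>V \<phi>\<^sub>0\<parallel>\<^sub>1 = 2\<close>, the closeness hypothesis says that an entire
  function stays within \<open>C\<^sub>0 < 1\<close> of 1; by Liouville's theorem it is constant, so every window is a multiple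
  \<open>c \<phi>\<^sub>0\<close> with \<open>\<bar>1 - c\<bar> < C\<^sub>0\<close>, and only the window \<open>\<phi>\<^sub>0\<close> has to be treated.

  For that window put \<open>F = V f\<close>. As \<open>V\<close> is an isometry, the upper bound follows from
  \<open>\<parallel>H\<^sub>\<gamma> f\<parallel>\<^sup>2 \<le> \<integral> \<eta>\<^sub>\<gamma>\<^sup>2 \<bar>F\<bar>\<^sup>2\<close> and the boundedness of \<open>\<Sum> \<eta>\<^sub>\<gamma>\<^sup>2\<close>. For the lower bound,
  \<open>A \<parallel>f\<parallel>\<^sup>2 \<le> \<Sum> \<integral> \<eta>\<^sub>\<gamma> \<bar>F\<bar>\<^sup>2 = \<Sum> Re \<langle>V H\<^sub>\<gamma> f, F\<rangle>\<close>. The part of the \<open>\<gamma>\<close>-th inner product over a large disc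
  around \<open>\<gamma>\<close> is at most \<open>\<kappa> \<parallel>H\<^sub>\<gamma> f\<parallel>\<^sup>2\<close> plus a small multiple of \<open>\<bar>F\<bar>\<^sup>2\<close> integrated near \<open>\<gamma>\<close>; the part outside the
  disc is small after summation, by Peetre's inequality, the decay of the symbols and Schur's test.
\<close>

section \<open>Translation in L1 and the Plancherel theorem\<close>

text \<open>The claim is quadratic in the symbols, while the assumption on their sum is linear and
  the symbols may change sign. The quadratic form <H f, f> is linear in the symbol and so brings in
  the sum; a b \<le> \<kappa> a^2 + b^2 / (4 \<kappa>) then returns to squared norms. The obstacle
  is the error b^2 = |V f|^2, which does not decay away from \<gamma> and cannot be summed over
  infinitely many \<gamma>. This forces the disc: on it the constant 1 / (4 \<kappa>) is at most a
  multiple of \<open>decay s (z - \<gamma>)\<close>, whose sums over \<Gamma> are bounded. Off the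
  disc the smallness comes from the decay of V H f away from \<gamma>, paid for with a part d of the
  exponent s; since s > 1, d can be taken so small that s - d > 1 and the sums stay bounded. The
  windows may vary with \<gamma>, yet each factor c satisfies |1 - c| < C0 < 1, so |c| lies between
  1 - C0 and 1 + C0 uniformly. Plancherel is proved for functions in both L1 and L2, because f times
  a shifted Gaussian always is of this kind.\<close>

lemma mult_le_sum_power2: "(a::real) * b \<le> a\<^sup>2 + b\<^sup>2"
  using sum_squares_bound[of a b] zero_le_power2[of a] zero_le_power2[of b] by linarith

lemma integrable_mult_of_squares:
  fixes f g :: "'a \<Rightarrow> 'b::{real_normed_algebra,banach,second_countable_topology}"
  assumes [measurable]: "f \<in> borel_measurable M" "g \<in> borel_measurable M"
    and "integrable M (\<lambda>x. (norm (f x))\<^sup>2)" "integrable M (\<lambda>x. (norm (g x))\<^sup>2)"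
  shows "integrable M (\<lambda>x. f x * g x)"
proof (rule Bochner_Integration.integrable_bound)
  show "integrable M (\<lambda>x. (norm (f x))\<^sup>2 + (norm (g x))\<^sup>2)"
    using assms by auto
  have "norm (f x * g x) \<le> (norm (f x))\<^sup>2 + (norm (g x))\<^sup>2" for x
  proof -
    have "norm (f x * g x) \<le> norm (f x) * norm (g x)" by (rule norm_mult_ineq)
    also have "\<dots> \<le> (norm (f x))\<^sup>2 + (norm (g x))\<^sup>2" by (rule mult_le_sum_power2)
    finally show ?thesis .
  qed
  then show "AE x in M. norm (f x * g x) \<le> norm ((norm (f x))\<^sup>2 + (norm (g x))\<^sup>2)"
    by auto
qed measurable

lemma Cauchy_Schwarz_integral:
  fixes f g :: "'a \<Rightarrow> complex"
  assumes [measurable]: "f \<in> borel_measurable M" "g \<in> borel_measurable M"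
    and f: "integrable M (\<lambda>x. (norm (f x))\<^sup>2)" and g: "integrable M (\<lambda>x. (norm (g x))\<^sup>2)"
  shows "(LINT x|M. norm (f x) * norm (g x))\<^sup>2
           \<le> (LINT x|M. (norm (f x))\<^sup>2) * (LINT x|M. (norm (g x))\<^sup>2)"
proof -
  have fg: "integrable M (\<lambda>x. norm (f x) * norm (g x))"
    using integrable_norm[OF integrable_mult_of_squares[OF assms(1,2) f g]]
    by (simp add: norm_mult)
  have "ennreal ((LINT x|M. norm (f x) * norm (g x))\<^sup>2) = (\<integral>\<^sup>+x. ennreal (norm (f x)) * ennreal (norm (g x)) \<partial>M)\<^sup>2"
    using nn_integral_eq_integral[OF fg] by (simp add: ennreal_mult' flip: ennreal_power)
  also have "\<dots> \<le> (\<integral>\<^sup>+x. (ennreal (norm (f x)))\<^sup>2 \<partial>M) * (\<integral>\<^sup>+x. (ennreal (norm (g x)))\<^sup>2 \<partial>M)"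
    by (rule Cauchy_Schwarz_nn_integral) auto
  also have "\<dots> = ennreal ((LINT x|M. (norm (f x))\<^sup>2) * (LINT x|M. (norm (g x))\<^sup>2))"
    using nn_integral_eq_integral[OF f] nn_integral_eq_integral[OF g]
    by (simp add: ennreal_power ennreal_mult')
  finally show ?thesis
    by (subst (asm) ennreal_le_iff) (auto intro!: mult_nonneg_nonneg)
qed

text \<open>Openness puts t - v n eventually into U whenever t is in U; at boundary points outside U
  the translated indicator need not converge. Since U and its translates have equal measure, the L1
  distance is twice the mass of U lost by the shift, and this one-sided quantity is governed by the
  points of U alone.\<close>

lemma L1_translation_open:
  fixes U :: "real set"
  assumes "open U" and fin: "emeasure lborel U < \<infinity>" and v: "v \<longlonglongrightarrow> (0::real)"
  shows "(\<lambda>n. LINT t|lborel. \<bar>indicator U (t - v n) - indicator U t\<bar>) \<longlonglongrightarrow> (0::real)"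
proof -
  have [measurable]: "U \<in> sets borel" using \<open>open U\<close> by auto
  have iU: "integrable lborel (\<lambda>t. indicator U t :: real)"
    using fin by (intro integrable_real_indicator) auto
  have iUv: "integrable lborel (\<lambda>t. indicator U (t - v n) :: real)" for n
    using lborel_integrable_real_affine[OF iU, of 1 "- v n"] by (simp add: algebra_simps)
  have IUv: "(LINT t|lborel. indicator U (t - v n) :: real) = (LINT t|lborel. indicator U t)" for n
    using lborel_integral_real_affine[of 1 "\<lambda>t. indicator U t :: real" "- v n"]
    by (simp add: algebra_simps)
  have ip: "integrable lborel (\<lambda>t. indicator U t * (1 - indicator U (t - v n)) :: real)" for n
    by (rule Bochner_Integration.integrable_bound[OF iU]) (auto split: split_indicator)
  have "(\<lambda>n. LINT t|lborel. (indicator U t * (1 - indicator U (t - v n)) :: real)) \<longlonglongrightarrow> (LINT t|(lborel::real measure). 0)"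
  proof (rule integral_dominated_convergence[OF _ _ iU])
    show "AE t in lborel. (\<lambda>n. indicator U t * (1 - indicator U (t - v n)) :: real) \<longlonglongrightarrow> 0"
    proof (rule AE_I2)
      fix t
      show "(\<lambda>n. indicator U t * (1 - indicator U (t - v n)) :: real) \<longlonglongrightarrow> 0"
      proof (cases "t \<in> U")
        case True
        have "(\<lambda>n. t - v n) \<longlonglongrightarrow> t" using tendsto_diff[OF tendsto_const v, of t] by simp
        then have "\<forall>\<^sub>F n in sequentially. t - v n \<in> U"
          using \<open>open U\<close> True by (rule topological_tendstoD)
        then show ?thesis
          using True by (intro tendsto_eventually) (auto elim!: eventually_mono simp: indicator_def)
      qed simp
    qed
  qed (auto split: split_indicator)
  moreover have "(LINT t|lborel. \<bar>indicator U (t - v n) - indicator U t\<bar>)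
      = 2 * (LINT t|lborel. (indicator U t * (1 - indicator U (t - v n)) :: real))" for n
  proof -
    have "(LINT t|lborel. \<bar>indicator U (t - v n) - indicator U t\<bar>)
       = (LINT t|lborel. 2 * (indicator U t * (1 - indicator U (t - v n))) + indicator U (t - v n) - indicator U t :: real)"
      by (rule Bochner_Integration.integral_cong) (auto split: split_indicator)
    also have "\<dots> = 2 * (LINT t|lborel. (indicator U t * (1 - indicator U (t - v n)) :: real))"
      using iU iUv IUv ip by simp
    finally show ?thesis .
  qed
  ultimately show ?thesis
    using tendsto_mult_right_zero[of _ sequentially 2] by simp
qed

lemma integrable_lborel_shift:
  fixes h :: "real \<Rightarrow> 'b::{banach,second_countable_topology}"
  assumes "integrable lborel h"
  shows "integrable lborel (\<lambda>t. h (t - a))"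
  using lborel_integrable_real_affine[OF assms, of 1 "- a"] by (simp add: algebra_simps)

lemma integral_lborel_shift:
  fixes h :: "real \<Rightarrow> 'b::{banach,second_countable_topology}"
  shows "(LINT t|lborel. h (t - a)) = (LINT t|lborel. h t)"
  using lborel_integral_real_affine[of 1 h "- a"] by (simp add: algebra_simps)

text \<open>\<open>integrable_induct\<close> reduces the claim to indicators of Borel sets, sums and
  dominated pointwise limits; outer regularity replaces a Borel set by an open one.\<close>

lemma L1_translation:
  fixes f :: "real \<Rightarrow> 'a::{banach,second_countable_topology}"
  assumes "integrable lborel f" and v: "v \<longlonglongrightarrow> (0::real)"
  shows "(\<lambda>n. LINT t|lborel. norm (f (t - v n) - f t)) \<longlonglongrightarrow> 0"
proof -
  \<comment> \<open>The property is closed under L1 approximation because translation preserves the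
    L1 norm. Both the Borel-set case and the limit case are instances.\<close>
  have approx: "(\<lambda>n. LINT t|lborel. norm (f (t - v n) - f t)) \<longlonglongrightarrow> 0"
    if f: "integrable lborel f"
      and ex: "\<And>e. e > 0 \<Longrightarrow> \<exists>h. integrable lborel h \<and> (LINT t|lborel. norm (f t - h t)) \<le> e
               \<and> (\<lambda>n. LINT t|lborel. norm (h (t - v n) - h t)) \<longlonglongrightarrow> 0"
      for f :: "real \<Rightarrow> 'a"
  proof (rule LIMSEQ_I)
    fix r :: real assume "r > 0"
    then obtain h where h: "integrable lborel h" "(LINT t|lborel. norm (f t - h t)) \<le> r/4"
      and lim: "(\<lambda>n. LINT t|lborel. norm (h (t - v n) - h t)) \<longlonglongrightarrow> 0"
      using ex[of "r/4"] by auto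
    have fh: "integrable lborel (\<lambda>t. norm (f t - h t))" using f h by auto
    have bound: "(LINT t|lborel. norm (f (t - v n) - f t)) \<le> r/2 + (LINT t|lborel. norm (h (t - v n) - h t))" for n
    proof -
      have i1: "integrable lborel (\<lambda>t. norm (f (t - v n) - h (t - v n)))"
        by (rule integrable_lborel_shift[OF fh])
      have i2: "integrable lborel (\<lambda>t. norm (h (t - v n) - h t))"
        by (intro integrable_norm Bochner_Integration.integrable_diff integrable_lborel_shift[OF h(1)] h(1))
      have i3: "integrable lborel (\<lambda>t. norm (f (t - v n) - f t))"
        by (intro integrable_norm Bochner_Integration.integrable_diff integrable_lborel_shift[OF f] f)
      have "(LINT t|lborel. norm (f (t - v n) - f t))
        \<le> (LINT t|lborel. norm (f (t - v n) - h (t - v n)) + norm (f t - h t) + norm (h (t - v n) - h t))"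
      proof (rule integral_mono)
        show "norm (f (t - v n) - f t) \<le> norm (f (t - v n) - h (t - v n)) + norm (f t - h t) + norm (h (t - v n) - h t)" for t
          using norm_triangle_ineq[of "f (t - v n) - h (t - v n)" "h t - f t"]
            norm_triangle_ineq[of "f (t - v n) - h (t - v n) + (h t - f t)" "h (t - v n) - h t"]
          by (simp add: norm_minus_commute)
      qed (use i1 i2 i3 fh in auto)
      also have "\<dots> = (LINT t|lborel. norm (f (t - v n) - h (t - v n))) + (LINT t|lborel. norm (f t - h t))
          + (LINT t|lborel. norm (h (t - v n) - h t))"
        by (simp only: Bochner_Integration.integral_add[OF Bochner_Integration.integrable_add[OF i1 fh] i2]
            Bochner_Integration.integral_add[OF i1 fh])
      also have "(LINT t|lborel. norm (f (t - v n) - h (t - v n))) = (LINT t|lborel. norm (f t - h t))"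
        by (rule integral_lborel_shift)
      finally show ?thesis using h by simp
    qed
    obtain N where N: "\<forall>n\<ge>N. (LINT t|lborel. norm (h (t - v n) - h t)) < r/2"
      using order_tendstoD(2)[OF lim, of "r/2"] \<open>r > 0\<close> by (auto simp: eventually_sequentially)
    have "(LINT t|lborel. norm (f (t - v n) - f t)) < r" if "n \<ge> N" for n
      using bound[of n] N[rule_format, OF that] by linarith
    then show "\<exists>no. \<forall>n\<ge>no. norm ((LINT t|lborel. norm (f (t - v n) - f t)) - 0) < r"
      by (intro exI[of _ N]) (simp add: integral_nonneg)
  qed
  show ?thesis using assms(1)
  proof (induction rule: integrable_induct)
    case (base B c)
    have [measurable]: "B \<in> sets borel" using base by auto
    show ?case
    proof (rule approx)
      fix e :: real assume "e > 0"
      define d where "d = e / (norm c + 1)"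
      have d: "d > 0" "norm c * d \<le> e" using \<open>e > 0\<close> unfolding d_def
        by (auto simp: field_simps add_pos_nonneg add_nonneg_pos)
      obtain U where U: "open U" "B \<subseteq> U" "emeasure lborel (U - B) < d"
        using outer_regular_lborel[of B d] d by auto
      have [measurable]: "U \<in> sets borel" using U by auto
      have Ufin: "emeasure lborel U < \<infinity>"
      proof -
        have "emeasure lborel U = emeasure lborel (U - B) + emeasure lborel B"
          using U by (subst plus_emeasure) (auto intro!: arg_cong[of _ _ "emeasure lborel"])
        also have "\<dots> < \<infinity>" using base(2) order.strict_trans[OF U(3), of \<infinity>] by simp
        finally show ?thesis .
      qed
      have iU: "integrable lborel (\<lambda>t. indicator U t *\<^sub>R c)" using Ufin by simp
      show "\<exists>h. integrable lborel h \<and> (LINT t|lborel. norm (indicator B t *\<^sub>R c - h t)) \<le> e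
               \<and> (\<lambda>n. LINT t|lborel. norm (h (t - v n) - h t)) \<longlonglongrightarrow> 0"
      proof (intro exI conjI)
        show "integrable lborel (\<lambda>t. indicator U t *\<^sub>R c)" by fact
        have "(LINT t|lborel. norm (indicator B t *\<^sub>R c - indicator U t *\<^sub>R c)) = (LINT t|lborel. norm c * indicator (U - B) t)"
          using U(2) by (intro Bochner_Integration.integral_cong) (auto split: split_indicator)
        also have "\<dots> = norm c * measure lborel (U - B)" by simp
        also have "\<dots> \<le> norm c * d"
          using U(3) d by (intro mult_left_mono) (auto simp: measure_def enn2real_leI less_imp_le)
        finally show "(LINT t|lborel. norm (indicator B t *\<^sub>R c - indicator U t *\<^sub>R c)) \<le> e" using d by simp
        have "norm (indicator U (t - v n) *\<^sub>R c - indicator U t *\<^sub>R c) = \<bar>indicator U (t - v n) - indicator U t\<bar> * norm c" for t n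
          by (simp flip: scaleR_diff_left)
        then show "(\<lambda>n. LINT t|lborel. norm (indicator U (t - v n) *\<^sub>R c - indicator U t *\<^sub>R c)) \<longlonglongrightarrow> 0"
          using tendsto_mult[OF L1_translation_open[OF U(1) Ufin v] tendsto_const[of "norm c"]] by simp
      qed
    qed (use base in simp)
  next
    case (add f g)
    show ?case
    proof (rule tendsto_sandwich[OF _ _ tendsto_const])
      show "(\<lambda>n. (LINT t|lborel. norm (f (t - v n) - f t)) + (LINT t|lborel. norm (g (t - v n) - g t))) \<longlonglongrightarrow> 0"
        using tendsto_add[OF add.IH] by simp
      show "\<forall>\<^sub>F n in sequentially. (LINT t|lborel. norm (f (t - v n) + g (t - v n) - (f t + g t)))
         \<le> (LINT t|lborel. norm (f (t - v n) - f t)) + (LINT t|lborel. norm (g (t - v n) - g t))"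
      proof (intro always_eventually allI)
        fix n
        have sh: "integrable lborel (\<lambda>t. f (t - v n))" "integrable lborel (\<lambda>t. g (t - v n))"
          using add.hyps by (auto intro: integrable_lborel_shift)
        have "(LINT t|lborel. norm (f (t - v n) + g (t - v n) - (f t + g t)))
          \<le> (LINT t|lborel. norm (f (t - v n) - f t) + norm (g (t - v n) - g t))"
          using add.hyps sh by (intro integral_mono) (auto simp: norm_diff_triangle_ineq)
        then show "(LINT t|lborel. norm (f (t - v n) + g (t - v n) - (f t + g t)))
         \<le> (LINT t|lborel. norm (f (t - v n) - f t)) + (LINT t|lborel. norm (g (t - v n) - g t))"
          using add.hyps sh by simp
      qed
    qed (auto simp: integral_nonneg)
  next
    case (lim f s)
    show ?case
    proof (rule approx)
      fix e :: real assume "e > 0"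
      have "(\<lambda>i. LINT t|lborel. norm (f t - s i t)) \<longlonglongrightarrow> (LINT t|(lborel::real measure). 0)"
      proof (rule integral_dominated_convergence)
        show "integrable lborel (\<lambda>t. 3 * norm (f t))" using lim by auto
        show "AE t in lborel. (\<lambda>i. norm (f t - s i t)) \<longlonglongrightarrow> 0"
        proof (rule AE_I2)
          fix t
          show "(\<lambda>i. norm (f t - s i t)) \<longlonglongrightarrow> 0"
            using tendsto_norm_zero[OF LIM_zero[OF lim.hyps(2)[of t]]] by (simp add: norm_minus_commute)
        qed
        show "AE t in lborel. norm (norm (f t - s i t)) \<le> 3 * norm (f t)" for i
        proof (rule AE_I2)
          fix t
          show "norm (norm (f t - s i t)) \<le> 3 * norm (f t)"
            using lim.hyps(3)[of t i] norm_triangle_ineq4[of "f t" "s i t"] by simp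
        qed
      qed (use lim in auto)
      then have "\<forall>\<^sub>F i in sequentially. (LINT t|lborel. norm (f t - s i t)) < e"
        using \<open>e > 0\<close> by (intro order_tendstoD(2)) auto
      then obtain i where "(LINT t|lborel. norm (f t - s i t)) \<le> e"
        by (auto simp: eventually_sequentially intro: less_imp_le)
      then show "\<exists>h. integrable lborel h \<and> (LINT t|lborel. norm (f t - h t)) \<le> e
               \<and> (\<lambda>n. LINT t|lborel. norm (h (t - v n) - h t)) \<longlonglongrightarrow> 0"
        using lim by blast
    qed (use lim in simp)
  qed
qed

section \<open>Continuity of the autocorrelation at 0\<close>

lemma borel_measurable_cis [measurable]: "cis \<in> borel_measurable borel"
  unfolding cis_conv_exp by measurable

lemma borel_measurable_cnj [measurable]: "cnj \<in> borel_measurable borel"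
  by (intro borel_measurable_continuous_onI continuous_intros)

text \<open>Continuity of translation is at hand in L1, while the product calls for an L2 estimate.
  Where \<open>norm (g t)\<close> is at most k, the L1 result suffices after multiplication by k;
  where it is larger, the truncated tail \<open>h k\<close> is small in L2.\<close>

lemma autocorrelation_tendsto:
  fixes g :: "real \<Rightarrow> complex"
  assumes g1: "integrable lborel g" and g2: "integrable lborel (\<lambda>t. (norm (g t))\<^sup>2)"
    and v: "v \<longlonglongrightarrow> (0::real)"
  shows "(\<lambda>n. LINT t|lborel. g t * cnj (g (t - v n))) \<longlonglongrightarrow> of_real (LINT t|lborel. (norm (g t))\<^sup>2)"
proof -
  have [measurable]: "g \<in> borel_measurable borel" using g1 by auto
  define S where "S = (LINT t|lborel. (norm (g t))\<^sup>2)"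
  have S0: "S \<ge> 0" by (simp add: S_def)
  have sh1: "integrable lborel (\<lambda>t. g (t - v n))" for n by (rule integrable_lborel_shift[OF g1])
  have sh2: "integrable lborel (\<lambda>t. (norm (g (t - v n)))\<^sup>2)" for n by (rule integrable_lborel_shift[OF g2])
  have Sv: "(LINT t|lborel. (norm (g (t - v n)))\<^sup>2) = S" for n
    unfolding S_def by (rule integral_lborel_shift)
  have d1: "integrable lborel (\<lambda>t. norm (g (t - v n) - g t))" for n using g1 sh1 by simp
  define h where "h k t = (if norm (g t) \<le> real k then 0 else norm (g t))" for k t
  have [measurable]: "h k \<in> borel_measurable borel" for k unfolding h_def by measurable
  have h2: "integrable lborel (\<lambda>t. (h k t)\<^sup>2)" for k
    by (rule Bochner_Integration.integrable_bound[OF g2]) (auto simp: h_def)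
  have hlim: "(\<lambda>k. LINT t|lborel. (h k t)\<^sup>2) \<longlonglongrightarrow> (LINT t|(lborel::real measure). 0)"
  proof (rule integral_dominated_convergence[OF _ _ g2])
    show "AE t in lborel. (\<lambda>k. (h k t)\<^sup>2) \<longlonglongrightarrow> 0"
    proof (rule AE_I2)
      fix t
      obtain N where "norm (g t) \<le> real N" using real_arch_simple by blast
      then have "\<forall>k\<ge>N. (h k t)\<^sup>2 = 0" by (auto simp: h_def)
      then show "(\<lambda>k. (h k t)\<^sup>2) \<longlonglongrightarrow> 0"
        by (intro tendsto_eventually) (auto simp: eventually_sequentially)
    qed
  qed (auto simp: h_def)
  have gd: "integrable lborel (\<lambda>t. norm (g t) * norm (g (t - v n) - g t))" for n
  proof (rule Bochner_Integration.integrable_bound)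
    show "integrable lborel (\<lambda>t. 2 * (norm (g (t - v n)))\<^sup>2 + 3 * (norm (g t))\<^sup>2)"
      using g2 sh2 by simp
    have "norm (g t) * norm (g (t - v n) - g t) \<le> 2 * (norm (g (t - v n)))\<^sup>2 + 3 * (norm (g t))\<^sup>2" for t
    proof -
      have "norm (g t) * norm (g (t - v n) - g t) \<le> norm (g t) * (norm (g (t - v n)) + norm (g t))"
        by (intro mult_left_mono norm_triangle_ineq4) auto
      also have "\<dots> = norm (g t) * norm (g (t - v n)) + (norm (g t))\<^sup>2"
        by (simp add: power2_eq_square algebra_simps)
      also have "\<dots> \<le> 2 * (norm (g (t - v n)))\<^sup>2 + 3 * (norm (g t))\<^sup>2"
        using mult_le_sum_power2[of "norm (g t)" "norm (g (t - v n))"] zero_le_power2[of "norm (g t)"]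
          zero_le_power2[of "norm (g (t - v n))"] by linarith
      finally show ?thesis .
    qed
    then show "AE t in lborel. norm (norm (g t) * norm (g (t - v n) - g t))
        \<le> norm (2 * (norm (g (t - v n)))\<^sup>2 + 3 * (norm (g t))\<^sup>2)" by auto
  qed measurable
  have D: "(\<lambda>n. LINT t|lborel. norm (g t) * norm (g (t - v n) - g t)) \<longlonglongrightarrow> 0"
  proof (rule LIMSEQ_I)
    fix e :: real assume e: "e > 0"
    \<comment> \<open>The three terms of \<open>bound\<close> are to be at most e / 8, e / 4 and e /
      2: the last by this d, the middle one by choosing k after d, the first by choosing n after
      k.\<close>
    define d where "d = e / (8 * (S + 1))"
    have d: "d > 0" "2 * d * S \<le> e / 4"
      using e S0 by (auto simp: d_def field_simps)
    have "\<forall>\<^sub>F k in sequentially. (LINT t|lborel. (h k t)\<^sup>2) < d * e"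
      using d e by (intro order_tendstoD(2)[OF hlim]) auto
    then obtain k where k: "(LINT t|lborel. (h k t)\<^sup>2) < d * e"
      by (auto simp: eventually_sequentially)
    have bound: "(LINT t|lborel. norm (g t) * norm (g (t - v n) - g t))
       \<le> real k * (LINT t|lborel. norm (g (t - v n) - g t)) + (1 / (4 * d)) * (LINT t|lborel. (h k t)\<^sup>2) + 2 * d * (S + S)" for n
    proof -
      have "(LINT t|lborel. norm (g t) * norm (g (t - v n) - g t))
        \<le> (LINT t|lborel. real k * norm (g (t - v n) - g t) + ((1 / (4 * d)) * (h k t)\<^sup>2 + 2 * d * ((norm (g (t - v n)))\<^sup>2 + (norm (g t))\<^sup>2)))"
      proof (rule integral_mono[OF gd])
        show "integrable lborel (\<lambda>t. real k * norm (g (t - v n) - g t) + ((1 / (4 * d)) * (h k t)\<^sup>2 + 2 * d * ((norm (g (t - v n)))\<^sup>2 + (norm (g t))\<^sup>2)))"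
          using d1 h2 sh2 g2 by (intro Bochner_Integration.integrable_add integrable_mult_right)
        fix t
        let ?a = "norm (g t)" and ?b = "norm (g (t - v n))" and ?c = "norm (g (t - v n) - g t)"
        show "?a * ?c \<le> real k * ?c + ((1 / (4 * d)) * (h k t)\<^sup>2 + 2 * d * (?b\<^sup>2 + ?a\<^sup>2))"
        proof (cases "?a \<le> real k")
          case True
          then have "?a * ?c \<le> real k * ?c" by (intro mult_right_mono) auto
          moreover have "0 \<le> (1 / (4 * d)) * (h k t)\<^sup>2 + 2 * d * (?b\<^sup>2 + ?a\<^sup>2)" using d by simp
          ultimately show ?thesis by linarith
        next
          case False
          \<comment> \<open>In a c \<le> a^2 / (4 d) + d c^2 the large coefficient falls on the tail
            of g, whose L2 norm has already been made small.\<close>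
          have "0 \<le> (?a - 2 * d * ?c)\<^sup>2" by simp
          then have "4 * d * (?a * ?c) \<le> ?a\<^sup>2 + 4 * d\<^sup>2 * ?c\<^sup>2"
            by (simp add: power2_eq_square algebra_simps)
          then have "?a * ?c \<le> (1 / (4 * d)) * ?a\<^sup>2 + d * ?c\<^sup>2"
            using d by (simp add: field_simps power2_eq_square)
          moreover have "?c\<^sup>2 \<le> 2 * (?b\<^sup>2 + ?a\<^sup>2)"
          proof -
            have "?c\<^sup>2 \<le> (?b + ?a)\<^sup>2" by (intro power_mono norm_triangle_ineq4) auto
            also have "\<dots> \<le> 2 * (?b\<^sup>2 + ?a\<^sup>2)"
              using sum_squares_bound[of ?b ?a] by (simp add: power2_sum)
            finally show ?thesis .
          qed
          then have "d * ?c\<^sup>2 \<le> 2 * d * (?b\<^sup>2 + ?a\<^sup>2)"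
            using mult_left_mono[of "?c\<^sup>2" "2 * (?b\<^sup>2 + ?a\<^sup>2)" d] d by simp
          moreover have hk: "h k t = ?a" using False by (auto simp: h_def)
          moreover have "0 \<le> real k * ?c" by (rule mult_nonneg_nonneg) auto
          ultimately show ?thesis unfolding hk by linarith
        qed
      qed
      also have "\<dots> = real k * (LINT t|lborel. norm (g (t - v n) - g t)) + ((1 / (4 * d)) * (LINT t|lborel. (h k t)\<^sup>2) + 2 * d * (S + S))"
      proof -
        have a: "integrable lborel (\<lambda>t. real k * norm (g (t - v n) - g t))" using d1 by simp
        have b: "integrable lborel (\<lambda>t. (1 / (4 * d)) * (h k t)\<^sup>2)" using h2 by simp
        have c0: "integrable lborel (\<lambda>t. (norm (g (t - v n)))\<^sup>2 + (norm (g t))\<^sup>2)"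
          by (rule Bochner_Integration.integrable_add[OF sh2 g2])
        then have c: "integrable lborel (\<lambda>t. 2 * d * ((norm (g (t - v n)))\<^sup>2 + (norm (g t))\<^sup>2))" by simp
        show ?thesis
          by (simp only: Bochner_Integration.integral_add[OF a Bochner_Integration.integrable_add[OF b c]]
              Bochner_Integration.integral_add[OF b c] integral_mult_right_zero
              Bochner_Integration.integral_add[OF sh2 g2] Sv S_def[symmetric])
      qed
      finally show ?thesis by simp
    qed
    have "(\<lambda>n. real k * (LINT t|lborel. norm (g (t - v n) - g t))) \<longlonglongrightarrow> 0"
      using tendsto_mult_right_zero[OF L1_translation[OF g1 v], of "real k"] .
    then have "\<forall>\<^sub>F n in sequentially. real k * (LINT t|lborel. norm (g (t - v n) - g t)) < e / 8"
      using e by (intro order_tendstoD(2)) auto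
    then obtain N where N: "\<forall>n\<ge>N. real k * (LINT t|lborel. norm (g (t - v n) - g t)) < e / 8"
      by (auto simp: eventually_sequentially)
    have "(LINT t|lborel. norm (g t) * norm (g (t - v n) - g t)) < e" if "n \<ge> N" for n
    proof -
      have "(1 / (4 * d)) * (LINT t|lborel. (h k t)\<^sup>2) \<le> (1 / (4 * d)) * (d * e)"
        using k d by (intro mult_left_mono) auto
      also have "\<dots> = e / 4" using d by simp
      finally show ?thesis using bound[of n] N[rule_format, OF that] d e by (simp add: algebra_simps)
    qed
    then show "\<exists>no. \<forall>n\<ge>no. norm ((LINT t|lborel. norm (g t) * norm (g (t - v n) - g t)) - 0) < e"
      by (intro exI[of _ N]) simp
  qed
  have gg: "integrable lborel (\<lambda>t. g t * cnj (g (t - v n)))" for n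
    using g2 sh2 by (intro integrable_mult_of_squares) auto
  have gg0: "integrable lborel (\<lambda>t. g t * cnj (g t))"
    using g2 by (intro integrable_mult_of_squares) auto
  have S: "of_real S = (LINT t|lborel. g t * cnj (g t))"
    unfolding S_def by (subst integral_complex_of_real[symmetric]) (simp only: complex_norm_square)
  have "(\<lambda>n. (LINT t|lborel. g t * cnj (g (t - v n))) - of_real S) \<longlonglongrightarrow> 0"
  proof (rule Lim_null_comparison[OF _ D], intro always_eventually allI)
    fix n
    have "(LINT t|lborel. g t * cnj (g (t - v n))) - of_real S = (LINT t|lborel. g t * cnj (g (t - v n) - g t))"
      unfolding S by (subst Bochner_Integration.integral_diff[symmetric, OF gg gg0]) (simp add: algebra_simps)
    also have "norm \<dots> \<le> (LINT t|lborel. norm (g t * cnj (g (t - v n) - g t)))"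
      by (rule integral_norm_bound)
    finally show "norm ((LINT t|lborel. g t * cnj (g (t - v n))) - of_real S)
       \<le> (LINT t|lborel. norm (g t) * norm (g (t - v n) - g t))"
      by (simp only: norm_mult complex_mod_cnj)
  qed
  then show ?thesis unfolding S_def by (rule LIM_zero_cancel)
qed

lemma std_normal_fourier:
  "integrable lborel (\<lambda>y. of_real (std_normal_density y) * cis (\<theta> * y))"
  "(LINT y|lborel. of_real (std_normal_density y) * cis (\<theta> * y)) = of_real (exp (- \<theta>\<^sup>2 / 2))"
proof -
  show "integrable lborel (\<lambda>y. of_real (std_normal_density y) * cis (\<theta> * y))"
    by (rule Bochner_Integration.integrable_bound[OF integrable_normal_density[of 1 0]])
       (auto simp: norm_mult)
  have "(LINT y|lborel. of_real (std_normal_density y) * cis (\<theta> * y))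
      = (LINT y|lborel. std_normal_density y *\<^sub>R iexp (\<theta> * y))"
    by (simp add: cis_conv_exp scaleR_conv_of_real)
  also have "\<dots> = char std_normal_distribution \<theta>"
    unfolding char_def by (subst integral_density) auto
  finally show "(LINT y|lborel. of_real (std_normal_density y) * cis (\<theta> * y)) = of_real (exp (- \<theta>\<^sup>2 / 2))"
    by (simp add: char_std_normal_distribution)
qed

section \<open>The Fourier transform on L1 and Plancherel's theorem\<close>

definition fourier :: "(real \<Rightarrow> complex) \<Rightarrow> real \<Rightarrow> complex" where
  "fourier g \<omega> = (LINT t|lborel. g t * cis (- (2 * pi * \<omega> * t)))"

lemma borel_measurable_fourier [measurable]:
  assumes [measurable]: "g \<in> borel_measurable borel"
  shows "fourier g \<in> borel_measurable borel"
  unfolding fourier_def cis_conv_exp by measurable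

lemma norm_fourier_le: "norm (fourier g \<omega>) \<le> (LINT t|lborel. norm (g t))"
  unfolding fourier_def using integral_norm_bound[of lborel "\<lambda>t. g t * cis (- (2 * pi * \<omega> * t))"]
  by (simp add: norm_mult)

lemma autocorrelation_integrable:
  fixes g :: "real \<Rightarrow> complex"
  assumes g: "integrable lborel g"
  shows "integrable (lborel \<Otimes>\<^sub>M lborel) (\<lambda>(v, t). g t * cnj (g (t - v)))"
proof -
  have [measurable]: "g \<in> borel_measurable borel" using g by auto
  have n: "(LINT v|lborel. norm (g (t - v))) = (LINT v|lborel. norm (g v))" for t
    using lborel_integral_real_affine[of "-1" "\<lambda>v. norm (g v)" t] by simp
  have "integrable (lborel \<Otimes>\<^sub>M lborel) (\<lambda>(t, v). g t * cnj (g (t - v)))"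
  proof (rule lborel_pair.Fubini_integrable)
    show "AE t in lborel. integrable lborel (\<lambda>v. case (t, v) of (t, v) \<Rightarrow> g t * cnj (g (t - v)))"
      using lborel_integrable_real_affine[OF g, of "-1"] by auto
    show "integrable lborel (\<lambda>t. LINT v|lborel. norm (case (t, v) of (t, v) \<Rightarrow> g t * cnj (g (t - v))))"
      using g by (simp add: norm_mult n)
  qed measurable
  then show ?thesis
    using lborel_pair.integrable_product_swap_iff[of "\<lambda>(t, v). g t * cnj (g (t - v))"] by simp
qed

text \<open>Regularizing \<open>\<parallel>fourier g\<parallel>\<^sup>2\<close> with a normal density turns it into an average of the
  autocorrelation of \<^term>\<open>g\<close> near 0.\<close>

lemma gaussian_mean_fourier:
  fixes g :: "real \<Rightarrow> complex"
  assumes g: "integrable lborel g" and c: "c > 0"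
  shows "of_real (c * (LINT y|lborel. std_normal_density y * (norm (fourier g (c * y)))\<^sup>2))
    = (LINT u|lborel. (LINT t|lborel. g t * cnj (g (t - u / c))) * of_real (exp (- 2 * pi\<^sup>2 * u\<^sup>2)))"
proof -
  have [measurable]: "g \<in> borel_measurable borel" using g by auto
  define A where "A v = (LINT t|lborel. g t * cnj (g (t - v)))" for v
  have intA: "integrable lborel A" 
    using lborel_pair.integrable_fst'[OF autocorrelation_integrable[OF g]] by (simp add: A_def[abs_def])
  have [measurable]: "A \<in> borel_measurable borel" using intA by auto
  \<comment> \<open>The squared modulus of a Fourier transform is the Fourier transform of the
    autocorrelation: re-centring the conjugate factor at t leaves a phase in v alone.\<close>
  have sq: "of_real ((norm (fourier g \<omega>))\<^sup>2) = (LINT v|lborel. A v * cis (- (2 * pi * \<omega> * v)))" for \<omega>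
  proof -
    let ?e = "\<lambda>t. cis (- (2 * pi * \<omega> * t))"
    have int: "integrable (lborel \<Otimes>\<^sub>M lborel) (\<lambda>(v, t). g t * cnj (g (t - v)) * ?e v)"
      by (rule Bochner_Integration.integrable_bound[OF autocorrelation_integrable[OF g]])
         (auto simp: norm_mult cis_conv_exp split_beta)
    have "of_real ((norm (fourier g \<omega>))\<^sup>2) = fourier g \<omega> * cnj (fourier g \<omega>)"
      by (rule complex_norm_square)
    also have "\<dots> = (LINT t|lborel. g t * ?e t * cnj (fourier g \<omega>))"
      unfolding fourier_def by simp
    also have "\<dots> = (LINT t|lborel. LINT v|lborel. g t * cnj (g (t - v)) * ?e v)"
    proof (rule Bochner_Integration.integral_cong[OF refl])
      fix t
      have "cnj (fourier g \<omega>) = (LINT v|lborel. cnj (g v) * cis (2 * pi * \<omega> * v))"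
        unfolding fourier_def by (rule trans[OF Bochner_Integration.integral_cnj[symmetric]]) (simp add: cis_cnj del: Bochner_Integration.integral_cnj)
      also have "\<dots> = (LINT v|lborel. cnj (g (t - v)) * cis (2 * pi * \<omega> * (t - v)))"
        using lborel_integral_real_affine[of "-1" "\<lambda>v. cnj (g v) * cis (2 * pi * \<omega> * v)" t] by simp
      finally have "g t * ?e t * cnj (fourier g \<omega>)
          = (LINT v|lborel. g t * ?e t * (cnj (g (t - v)) * cis (2 * pi * \<omega> * (t - v))))"
        by simp
      also have "\<dots> = (LINT v|lborel. g t * cnj (g (t - v)) * ?e v)"
        by (rule Bochner_Integration.integral_cong[OF refl])
           (simp add: cis_mult algebra_simps)
      finally show "g t * ?e t * cnj (fourier g \<omega>) = (LINT v|lborel. g t * cnj (g (t - v)) * ?e v)" .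
    qed
    also have "\<dots> = (LINT v|lborel. LINT t|lborel. g t * cnj (g (t - v)) * ?e v)"
      by (rule lborel_pair.Fubini_integral[OF int])
    also have "\<dots> = (LINT v|lborel. A v * ?e v)"
      unfolding A_def by simp
    finally show ?thesis .
  qed
  have int: "integrable (lborel \<Otimes>\<^sub>M lborel) (\<lambda>(v, y). A v * (of_real (std_normal_density y) * cis (- (2 * pi * c * v) * y)))"
  proof (rule lborel_pair.Fubini_integrable)
    show "AE v in lborel. integrable lborel (\<lambda>y. case (v, y) of (v, y) \<Rightarrow> A v * (of_real (std_normal_density y) * cis (- (2 * pi * c * v) * y)))"
      unfolding prod.case by (intro AE_I2 integrable_mult_right std_normal_fourier(1))
    show "integrable lborel (\<lambda>v. LINT y|lborel. norm (case (v, y) of (v, y) \<Rightarrow> A v * (of_real (std_normal_density y) * cis (- (2 * pi * c * v) * y))))"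
      using intA by (simp add: norm_mult)
  qed (unfold cis_conv_exp, measurable)
  have "(of_real (LINT y|lborel. std_normal_density y * (norm (fourier g (c * y)))\<^sup>2) :: complex)
      = (LINT y|lborel. of_real (std_normal_density y) * (LINT v|lborel. A v * cis (- (2 * pi * (c * y) * v))))"
    by (simp add: sq flip: integral_complex_of_real of_real_power)
  also have "\<dots> = (LINT y|lborel. LINT v|lborel. A v * (of_real (std_normal_density y) * cis (- (2 * pi * c * v) * y)))"
    by (intro Bochner_Integration.integral_cong refl, subst integral_mult_right_zero[symmetric])
       (intro Bochner_Integration.integral_cong refl, simp add: algebra_simps)
  also have "\<dots> = (LINT v|lborel. LINT y|lborel. A v * (of_real (std_normal_density y) * cis (- (2 * pi * c * v) * y)))"
    by (rule lborel_pair.Fubini_integral[OF int])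
  also have "\<dots> = (LINT v|lborel. A v * of_real (exp (- (- (2 * pi * c * v))\<^sup>2 / 2)))"
    by (simp only: integral_mult_right_zero std_normal_fourier)
  \<comment> \<open>The substitution v = u / c moves all dependence on c into the argument of A: the
    Gaussian weight is then fixed, and A is sampled ever closer to 0 as c grows.\<close>
  also have "\<dots> = (1 / c) *\<^sub>R (LINT u|lborel. A (u / c) * of_real (exp (- 2 * pi\<^sup>2 * u\<^sup>2)))"
    using c lborel_integral_real_affine[of "1 / c" "\<lambda>v. A v * of_real (exp (- (- (2 * pi * c * v))\<^sup>2 / 2))" 0]
    by (simp add: power2_eq_square mult_ac)
  finally show ?thesis using c by (simp add: A_def scaleR_conv_of_real)
qed


lemma std_normal_density_scaled_LIMSEQ:
  "(\<lambda>n. std_normal_density (\<omega> / Suc n)) \<longlonglongrightarrow> 1 / sqrt (2 * pi)"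
proof -
  have "(\<lambda>n. \<omega> * (1 / Suc n)) \<longlonglongrightarrow> \<omega> * 0"
    by (intro tendsto_intros LIMSEQ_Suc[OF lim_1_over_n])
  then have "(\<lambda>n. \<omega> / real (Suc n)) \<longlonglongrightarrow> 0" by simp
  then have "(\<lambda>n. 1 / sqrt (2 * pi) * exp (- (\<omega> / real (Suc n))\<^sup>2 / 2)) \<longlonglongrightarrow> 1 / sqrt (2 * pi) * exp (- 0\<^sup>2 / 2)"
    by (intro tendsto_intros) auto
  then show ?thesis unfolding std_normal_density_def by simp
qed

lemma gaussian_integral:
  fixes a :: real
  assumes a: "a > 0"
  shows "integrable lborel (\<lambda>t. exp (- a * t\<^sup>2))" "(LINT t|lborel. exp (- a * t\<^sup>2)) = sqrt (pi / a)"
proof -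
  define \<sigma> where "\<sigma> = 1 / sqrt (2 * a)"
  have \<sigma>: "\<sigma> > 0" "\<sigma>\<^sup>2 = 1 / (2 * a)" using a by (auto simp: \<sigma>_def power_divide)
  have *: "exp (- a * t\<^sup>2) = sqrt (pi / a) * normal_density 0 \<sigma> t" for t
  proof -
    have "2 * pi * \<sigma>\<^sup>2 = pi / a" "- (t - 0)\<^sup>2 / (2 * \<sigma>\<^sup>2) = - a * t\<^sup>2" using a \<sigma> by (auto simp: field_simps)
    then show ?thesis using a by (simp add: normal_density_def)
  qed
  show "integrable lborel (\<lambda>t. exp (- a * t\<^sup>2))"
    unfolding * using \<sigma> by (intro integrable_mult_right integrable_normal_density)
  show "(LINT t|lborel. exp (- a * t\<^sup>2)) = sqrt (pi / a)"
    unfolding * using \<sigma> by simp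
qed

text \<open>Square integrability of the transform is not known beforehand, so the left side is an
  extended real. The weights \<open>std_normal_density (\<omega> / Suc n)\<close> increase to a
  constant r, which permits monotone convergence there; the same quantities are Gaussian means of
  the autocorrelation, whose limit dominated convergence computes from its value S at 0.\<close>

theorem Plancherel:
  fixes g :: "real \<Rightarrow> complex"
  assumes g1: "integrable lborel g" and g2: "integrable lborel (\<lambda>t. (norm (g t))\<^sup>2)"
  shows "(\<integral>\<^sup>+\<omega>. ennreal ((norm (fourier g \<omega>))\<^sup>2) \<partial>lborel) = (\<integral>\<^sup>+t. ennreal ((norm (g t))\<^sup>2) \<partial>lborel)"
proof -
  have [measurable]: "g \<in> borel_measurable borel" using g1 by auto
  define S where "S = (LINT t|lborel. (norm (g t))\<^sup>2)"
  define A where "A v = (LINT t|lborel. g t * cnj (g (t - v)))" for v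
  define J where "J n = (LINT u|lborel. A (u / real (Suc n)) * of_real (exp (- 2 * pi\<^sup>2 * u\<^sup>2)))" for n
  define r where "r = 1 / sqrt (2 * pi)"
  have r: "r > 0" by (simp add: r_def)
  have "integrable lborel A"
    using lborel_pair.integrable_fst'[OF autocorrelation_integrable[OF g1]] by (simp add: A_def[abs_def])
  then have [measurable]: "A \<in> borel_measurable borel" by auto
  \<comment> \<open>Cauchy-Schwarz supplies the majorant for dominated convergence: S times a
    Gaussian.\<close>
  have A_bound: "norm (A v) \<le> S" for v
  proof -
    have sh2: "integrable lborel (\<lambda>t. (norm (g (t - v)))\<^sup>2)" by (rule integrable_lborel_shift[OF g2])
    have "(norm (A v))\<^sup>2 \<le> (LINT t|lborel. norm (g t) * norm (g (t - v)))\<^sup>2"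
      unfolding A_def using integral_norm_bound[of lborel "\<lambda>t. g t * cnj (g (t - v))"]
      by (intro power_mono) (auto simp: norm_mult)
    also have "\<dots> \<le> S * (LINT t|lborel. (norm (g (t - v)))\<^sup>2)"
      unfolding S_def by (rule Cauchy_Schwarz_integral[OF _ _ g2 sh2]) measurable
    also have "\<dots> = S\<^sup>2"
      using integral_lborel_shift[of "\<lambda>t. (norm (g t))\<^sup>2" v]
      by (simp only: S_def[symmetric] power2_eq_square[of S])
    finally show ?thesis by (rule power2_le_imp_le) (simp add: S_def)
  qed
  have "J \<longlonglongrightarrow> (LINT u|lborel. of_real S * of_real (exp (- 2 * pi\<^sup>2 * u\<^sup>2)))"
    unfolding J_def
  proof (rule integral_dominated_convergence)
    show "integrable lborel (\<lambda>u. S * exp (- (2 * pi\<^sup>2) * u\<^sup>2))"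
      by (intro integrable_mult_right gaussian_integral) auto
    show "AE u in lborel. (\<lambda>n. A (u / real (Suc n)) * of_real (exp (- 2 * pi\<^sup>2 * u\<^sup>2))) \<longlonglongrightarrow> of_real S * of_real (exp (- 2 * pi\<^sup>2 * u\<^sup>2))"
    proof (rule AE_I2)
      fix u
      have "(\<lambda>n. u * (1 / Suc n)) \<longlonglongrightarrow> u * 0"
        by (intro tendsto_intros LIMSEQ_Suc[OF lim_1_over_n])
      then have "(\<lambda>n. u / real (Suc n)) \<longlonglongrightarrow> 0" by simp
      then show "(\<lambda>n. A (u / real (Suc n)) * of_real (exp (- 2 * pi\<^sup>2 * u\<^sup>2))) \<longlonglongrightarrow> of_real S * of_real (exp (- 2 * pi\<^sup>2 * u\<^sup>2))"
        unfolding A_def S_def by (intro tendsto_mult tendsto_const autocorrelation_tendsto[OF g1 g2])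
    qed
    show "AE u in lborel. norm (A (u / real (Suc n)) * of_real (exp (- 2 * pi\<^sup>2 * u\<^sup>2))) \<le> S * exp (- (2 * pi\<^sup>2) * u\<^sup>2)" for n
      using A_bound by (auto simp: norm_mult)
  qed measurable
  \<comment> \<open>The mass of this Gaussian equals the limit r of the weights, so r cancels at the
    end and the identity holds without a constant.\<close>
  also have "(LINT u|lborel. of_real S * of_real (exp (- 2 * pi\<^sup>2 * u\<^sup>2))) = (of_real (S * r) :: complex)"
  proof -
    have "sqrt (pi / (2 * pi\<^sup>2)) = r"
      by (simp add: r_def power2_eq_square real_sqrt_divide real_sqrt_mult)
    then show ?thesis
      using gaussian_integral(2)[of "2 * pi\<^sup>2"] by (simp flip: of_real_mult)
  qed
  finally have J_lim: "J \<longlonglongrightarrow> of_real (S * r)" .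
  have nn: "ennreal (Re (J n)) = (\<integral>\<^sup>+\<omega>. ennreal (std_normal_density (\<omega> / Suc n) * (norm (fourier g \<omega>))\<^sup>2) \<partial>lborel)" for n
  proof -
    define c where "c = real (Suc n)"
    have c: "c > 0" by (simp add: c_def)
    have i: "integrable lborel (\<lambda>y. std_normal_density y * (norm (fourier g (c * y)))\<^sup>2)"
    proof (rule Bochner_Integration.integrable_bound)
      show "integrable lborel (\<lambda>y. std_normal_density y * (LINT t|lborel. norm (g t))\<^sup>2)" by simp
      show "AE y in lborel. norm (std_normal_density y * (norm (fourier g (c * y)))\<^sup>2) \<le> norm (std_normal_density y * (LINT t|lborel. norm (g t))\<^sup>2)"
        using norm_fourier_le[of g] by (auto intro!: mult_left_mono power_mono simp: abs_mult)
    qed measurable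
    have "J n = of_real (c * (LINT y|lborel. std_normal_density y * (norm (fourier g (c * y)))\<^sup>2))"
      unfolding J_def A_def using gaussian_mean_fourier[OF g1, of "real (Suc n)"] by (simp add: c_def)
    then have "ennreal (Re (J n)) = ennreal c * ennreal (LINT y|lborel. std_normal_density y * (norm (fourier g (c * y)))\<^sup>2)"
      using c by (simp add: ennreal_mult')
    also have "\<dots> = ennreal c * (\<integral>\<^sup>+y. ennreal (std_normal_density y * (norm (fourier g (c * y)))\<^sup>2) \<partial>lborel)"
      by (subst nn_integral_eq_integral[OF i]) auto
    also have "\<dots> = (\<integral>\<^sup>+\<omega>. ennreal (std_normal_density (\<omega> / c) * (norm (fourier g \<omega>))\<^sup>2) \<partial>lborel)"
      using nn_integral_real_affine[of "\<lambda>\<omega>. ennreal (std_normal_density (\<omega> / c) * (norm (fourier g \<omega>))\<^sup>2)" c 0] c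
      by simp
    finally show ?thesis by (simp add: c_def)
  qed
  have "(\<lambda>n. \<integral>\<^sup>+\<omega>. ennreal (std_normal_density (\<omega> / Suc n) * (norm (fourier g \<omega>))\<^sup>2) \<partial>lborel)
      \<longlonglongrightarrow> (\<integral>\<^sup>+\<omega>. ennreal (r * (norm (fourier g \<omega>))\<^sup>2) \<partial>lborel)"
  proof (rule nn_integral_LIMSEQ)
    show "incseq (\<lambda>n \<omega>. ennreal (std_normal_density (\<omega> / Suc n) * (norm (fourier g \<omega>))\<^sup>2))"
    proof (rule incseq_SucI, rule le_funI)
      fix n \<omega>
      have "(\<omega> / Suc (Suc n))\<^sup>2 \<le> (\<omega> / Suc n)\<^sup>2"
        by (simp add: power_divide frac_le power_mono)
      then show "ennreal (std_normal_density (\<omega> / Suc n) * (norm (fourier g \<omega>))\<^sup>2)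
          \<le> ennreal (std_normal_density (\<omega> / Suc (Suc n)) * (norm (fourier g \<omega>))\<^sup>2)"
        unfolding std_normal_density_def by (intro ennreal_leI mult_right_mono mult_left_mono) auto
    qed
    show "(\<lambda>n. ennreal (std_normal_density (\<omega> / Suc n) * (norm (fourier g \<omega>))\<^sup>2)) \<longlonglongrightarrow> ennreal (r * (norm (fourier g \<omega>))\<^sup>2)" for \<omega>
      unfolding r_def by (intro tendsto_ennrealI tendsto_mult tendsto_const std_normal_density_scaled_LIMSEQ)
  qed measurable
  moreover have "(\<lambda>n. ennreal (Re (J n))) \<longlonglongrightarrow> ennreal (S * r)"
    using tendsto_ennrealI[OF tendsto_Re[OF J_lim]] by simp
  ultimately have "(\<integral>\<^sup>+\<omega>. ennreal (r * (norm (fourier g \<omega>))\<^sup>2) \<partial>lborel) = ennreal (S * r)"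
    unfolding nn by (rule LIMSEQ_unique)
  moreover have "(\<integral>\<^sup>+\<omega>. ennreal (r * (norm (fourier g \<omega>))\<^sup>2) \<partial>lborel) = ennreal r * (\<integral>\<^sup>+\<omega>. ennreal ((norm (fourier g \<omega>))\<^sup>2) \<partial>lborel)"
    using r by (simp add: ennreal_mult' nn_integral_cmult)
  ultimately have "ennreal r * (\<integral>\<^sup>+\<omega>. ennreal ((norm (fourier g \<omega>))\<^sup>2) \<partial>lborel) = ennreal r * ennreal S"
    using r by (simp add: mult.commute[of S] ennreal_mult')
  then have "(\<integral>\<^sup>+\<omega>. ennreal ((norm (fourier g \<omega>))\<^sup>2) \<partial>lborel) = ennreal S"
    using r by (simp add: ennreal_mult_cancel_left)
  also have "ennreal S = (\<integral>\<^sup>+t. ennreal ((norm (g t))\<^sup>2) \<partial>lborel)"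
    unfolding S_def by (subst nn_integral_eq_integral[OF g2]) auto
  finally show ?thesis .
qed

section \<open>The short-time Fourier transform with Gaussian window\<close>

lemma borel_measurable_gauss0 [measurable]: "gauss0 \<in> borel_measurable borel"
  unfolding gauss0_def[abs_def] by measurable

lemma cnj_gauss0 [simp]: "cnj (gauss0 t) = gauss0 t"
  by (simp add: gauss0_def)

lemma norm_gauss0: "norm (gauss0 t) = 2 powr (1/4) * exp (- pi * t\<^sup>2)"
  by (simp only: gauss0_def norm_of_real) simp

lemma norm_gauss0_le: "norm (gauss0 t) \<le> 2"
proof -
  have "2 powr (1/4) * exp (- pi * t\<^sup>2) \<le> 2 powr 1 * (1::real)"
    by (intro mult_mono powr_mono) auto
  then show ?thesis by (simp add: norm_gauss0)
qed

lemma norm_gauss0_sq: "(norm (gauss0 t))\<^sup>2 = sqrt 2 * exp (- (2 * pi) * t\<^sup>2)"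
proof -
  have "(2 powr (1/4))\<^sup>2 = (2::real) powr (1/2)"
    by (simp add: power2_eq_square flip: powr_add)
  moreover have "(exp (- pi * t\<^sup>2))\<^sup>2 = exp (- (2 * pi) * t\<^sup>2)"
    by (simp add: power2_eq_square flip: exp_add)
  ultimately show ?thesis by (simp add: norm_gauss0 power_mult_distrib powr_half_sqrt)
qed

lemma integrable_gauss0: "integrable lborel gauss0"
  unfolding gauss0_def[abs_def] using gaussian_integral(1)[of pi]
  by (intro integrable_of_real integrable_mult_right) auto

lemma gauss0_sq_integral:
  "integrable lborel (\<lambda>t. (norm (gauss0 t))\<^sup>2)" "(LINT t|lborel. (norm (gauss0 t))\<^sup>2) = 1"
  using gaussian_integral[of "2 * pi"] unfolding norm_gauss0_sq
  by (auto simp: real_sqrt_divide)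

lemma L2D:
  assumes "f \<in> L2"
  shows "f \<in> borel_measurable borel" "integrable lborel (\<lambda>t. (norm (f t))\<^sup>2)"
  using assms by (auto simp: L2_def)

lemma L2_gauss0: "gauss0 \<in> L2"
  using gauss0_sq_integral by (auto simp: L2_def)

lemma L2_lincomb:
  assumes "f \<in> L2" "g \<in> L2"
  shows "(\<lambda>t. f t + c * g t) \<in> L2"
proof -
  note [measurable] = L2D(1)[OF assms(1)] L2D(1)[OF assms(2)]
  have "integrable lborel (\<lambda>t. (norm (f t + c * g t))\<^sup>2)"
  proof (rule Bochner_Integration.integrable_bound)
    show "integrable lborel (\<lambda>t. 2 * (norm (f t))\<^sup>2 + 2 * (norm c)\<^sup>2 * (norm (g t))\<^sup>2)"
      using L2D(2)[OF assms(1)] L2D(2)[OF assms(2)] by auto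
    have "(norm (f t + c * g t))\<^sup>2 \<le> 2 * (norm (f t))\<^sup>2 + 2 * (norm c)\<^sup>2 * (norm (g t))\<^sup>2" for t
    proof -
      have "(norm (f t + c * g t))\<^sup>2 \<le> (norm (f t) + norm c * norm (g t))\<^sup>2"
        by (intro power_mono order_trans[OF norm_triangle_ineq]) (auto simp: norm_mult)
      also have "\<dots> \<le> 2 * (norm (f t))\<^sup>2 + 2 * (norm c * norm (g t))\<^sup>2"
        using sum_squares_bound[of "norm (f t)" "norm c * norm (g t)"] unfolding power2_sum by linarith
      finally show ?thesis by (simp add: power_mult_distrib)
    qed
    then show "AE t in lborel. norm ((norm (f t + c * g t))\<^sup>2)
       \<le> norm (2 * (norm (f t))\<^sup>2 + 2 * (norm c)\<^sup>2 * (norm (g t))\<^sup>2)" by auto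
  qed measurable
  then show ?thesis by (auto simp: L2_def)
qed

lemma L2_norm_sq_eq:
  assumes "f \<in> L2"
  shows "L2_norm_sq f = ennreal (LINT t|lborel. (norm (f t))\<^sup>2)"
  unfolding L2_norm_sq_def using L2D(2)[OF assms] by (subst nn_integral_eq_integral) auto

lemma norm_tf_shift: "norm (tf_shift z \<phi> t) = norm (\<phi> (t - fst z))"
  by (simp add: tf_shift_def norm_mult)

lemma borel_measurable_tf_shift [measurable]:
  assumes [measurable]: "\<phi> \<in> borel_measurable borel"
  shows "(\<lambda>p. tf_shift (fst p) \<phi> (snd p)) \<in> borel_measurable (borel \<Otimes>\<^sub>M borel)"
proof -
  have [measurable]: "fst \<in> borel_measurable (borel :: (real \<times> real) measure)"
      "snd \<in> borel_measurable (borel :: (real \<times> real) measure)"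
    by (auto simp flip: borel_prod)
  show ?thesis unfolding tf_shift_def by measurable
qed

lemma L2_tf_shift: "\<phi> \<in> L2 \<Longrightarrow> tf_shift z \<phi> \<in> L2"
proof -
  assume \<phi>: "\<phi> \<in> L2"
  note [measurable] = L2D(1)[OF \<phi>]
  have "tf_shift z \<phi> \<in> borel_measurable borel" unfolding tf_shift_def[abs_def] by measurable
  then show ?thesis
    using integrable_lborel_shift[OF L2D(2)[OF \<phi>], of "fst z"] by (simp add: L2_def norm_tf_shift)
qed

lemma borel_measurable_stft [measurable]:
  assumes [measurable]: "\<phi> \<in> borel_measurable borel" "f \<in> borel_measurable borel"
  shows "stft \<phi> f \<in> borel_measurable borel"
proof -
  have "(\<lambda>z. LINT t|lborel. f (snd (z, t)) * cnj (tf_shift (fst (z, t)) \<phi> (snd (z, t)))) \<in> borel_measurable borel"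
    by measurable
  then show ?thesis by (simp add: stft_def[abs_def] L2_inner_def)
qed

lemma L2_mult_cnj_integrable:
  assumes "f \<in> L2" "g \<in> L2"
  shows "integrable lborel (\<lambda>t. f t * cnj (g t))"
proof -
  note [measurable] = L2D(1)[OF assms(1)] L2D(1)[OF assms(2)]
  show ?thesis
    using L2D(2)[OF assms(1)] L2D(2)[OF assms(2)] by (intro integrable_mult_of_squares) auto
qed

lemma norm_L2_inner_sq_le:
  assumes "f \<in> L2" "g \<in> L2"
  shows "(norm (L2_inner f g))\<^sup>2 \<le> (LINT t|lborel. (norm (f t))\<^sup>2) * (LINT t|lborel. (norm (g t))\<^sup>2)"
proof -
  note [measurable] = L2D(1)[OF assms(1)] L2D(1)[OF assms(2)]
  have "(norm (L2_inner f g))\<^sup>2 \<le> (LINT t|lborel. norm (f t) * norm (g t))\<^sup>2"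
    unfolding L2_inner_def using integral_norm_bound[of lborel "\<lambda>t. f t * cnj (g t)"]
    by (intro power_mono) (auto simp: norm_mult)
  also have "\<dots> \<le> (LINT t|lborel. (norm (f t))\<^sup>2) * (LINT t|lborel. (norm (g t))\<^sup>2)"
    by (rule Cauchy_Schwarz_integral[OF _ _ L2D(2)[OF assms(1)] L2D(2)[OF assms(2)]]) measurable
  finally show ?thesis .
qed

lemma norm_stft_sq_le:
  assumes f: "f \<in> L2"
  shows "(norm (stft gauss0 f z))\<^sup>2 \<le> (LINT t|lborel. (norm (f t))\<^sup>2)"
proof -
  have "(LINT t|lborel. (norm (tf_shift z gauss0 t))\<^sup>2) = 1"
    unfolding norm_tf_shift using integral_lborel_shift[of "\<lambda>t. (norm (gauss0 t))\<^sup>2" "fst z"]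
    by (simp only: gauss0_sq_integral)
  then show ?thesis
    using norm_L2_inner_sq_le[OF f L2_tf_shift[OF L2_gauss0], of z] by (simp add: stft_def)
qed

lemma stft_lincomb:
  assumes "f \<in> L2" "g \<in> L2" "\<phi> \<in> L2"
  shows "stft \<phi> (\<lambda>t. f t + c * g t) z = stft \<phi> f z + c * stft \<phi> g z"
proof -
  have a: "integrable lborel (\<lambda>t. f t * cnj (tf_shift z \<phi> t))"
    by (rule L2_mult_cnj_integrable[OF assms(1) L2_tf_shift[OF assms(3)]])
  have b: "integrable lborel (\<lambda>t. c * (g t * cnj (tf_shift z \<phi> t)))"
    by (rule integrable_mult_right[OF L2_mult_cnj_integrable[OF assms(2) L2_tf_shift[OF assms(3)]]])
  have "stft \<phi> (\<lambda>t. f t + c * g t) z = (LINT t|lborel. f t * cnj (tf_shift z \<phi> t) + c * (g t * cnj (tf_shift z \<phi> t)))"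
    unfolding stft_def L2_inner_def by (simp add: algebra_simps)
  also have "\<dots> = stft \<phi> f z + c * stft \<phi> g z"
    unfolding Bochner_Integration.integral_add[OF a b] by (simp add: stft_def L2_inner_def)
  finally show ?thesis .
qed

lemma stft_gauss0_eq_fourier:
  "stft gauss0 f (x, \<omega>) = fourier (\<lambda>t. f t * gauss0 (t - x)) \<omega>"
  unfolding stft_def L2_inner_def fourier_def tf_shift_def
  by (rule Bochner_Integration.integral_cong) (auto simp: cis_cnj)

text \<open>For fixed x the transform is, in \<omega>, the Fourier transform of
  \<open>f t * gauss0 (t - x)\<close>, which is in L1 and L2 because the Gaussian is square
  integrable and bounded. Plancherel in \<omega> and Tonelli in x leave the factor \<integral>
  |gauss0|^2 = 1.\<close>

lemma stft_norm_nn: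
  assumes f: "f \<in> L2"
  shows "(\<integral>\<^sup>+z. ennreal ((norm (stft gauss0 f z))\<^sup>2) \<partial>lborel) = L2_norm_sq f"
proof -
  note [measurable] = L2D(1)[OF f]
  have 1: "integrable lborel (\<lambda>t. f t * gauss0 (t - x))" for x
    using L2D(2)[OF f] integrable_lborel_shift[OF gauss0_sq_integral(1)]
    by (intro integrable_mult_of_squares) auto
  have 2: "integrable lborel (\<lambda>t. (norm (f t * gauss0 (t - x)))\<^sup>2)" for x
  proof (rule Bochner_Integration.integrable_bound)
    show "integrable lborel (\<lambda>t. 4 * (norm (f t))\<^sup>2)" using L2D(2)[OF f] by simp
    have "(norm (f t * gauss0 (t - x)))\<^sup>2 \<le> 4 * (norm (f t))\<^sup>2" for t
      using mult_left_mono[OF power_mono[OF norm_gauss0_le norm_ge_zero, of "t - x" 2], of "(norm (f t))\<^sup>2"]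
      by (simp add: norm_mult power_mult_distrib mult.commute)
    then show "AE t in lborel. norm ((norm (f t * gauss0 (t - x)))\<^sup>2) \<le> norm (4 * (norm (f t))\<^sup>2)" by auto
  qed measurable
  have unit: "(\<integral>\<^sup>+x. ennreal ((norm (gauss0 (t - x)))\<^sup>2) \<partial>lborel) = 1" for t
  proof -
    have "(\<integral>\<^sup>+x. ennreal ((norm (gauss0 (t - x)))\<^sup>2) \<partial>lborel) = (\<integral>\<^sup>+x. ennreal ((norm (gauss0 x))\<^sup>2) \<partial>lborel)"
      using nn_integral_real_affine[of "\<lambda>x. ennreal ((norm (gauss0 x))\<^sup>2)" "-1" t] by simp
    also have "\<dots> = 1"
      using gauss0_sq_integral by (subst nn_integral_eq_integral) auto
    finally show ?thesis .
  qed
  have "(\<integral>\<^sup>+z. ennreal ((norm (stft gauss0 f z))\<^sup>2) \<partial>lborel)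
      = (\<integral>\<^sup>+z. ennreal ((norm (stft gauss0 f z))\<^sup>2) \<partial>(lborel \<Otimes>\<^sub>M lborel))"
    by (simp only: lborel_prod)
  also have "\<dots> = (\<integral>\<^sup>+x. \<integral>\<^sup>+\<omega>. ennreal ((norm (stft gauss0 f (x, \<omega>)))\<^sup>2) \<partial>lborel \<partial>lborel)"
    by (rule lborel.nn_integral_fst[symmetric]) (simp add: lborel_prod)
  also have "\<dots> = (\<integral>\<^sup>+x. \<integral>\<^sup>+t. ennreal ((norm (f t * gauss0 (t - x)))\<^sup>2) \<partial>lborel \<partial>lborel)"
    by (simp only: stft_gauss0_eq_fourier Plancherel[OF 1 2])
  also have "\<dots> = (\<integral>\<^sup>+t. \<integral>\<^sup>+x. ennreal ((norm (f t * gauss0 (t - x)))\<^sup>2) \<partial>lborel \<partial>lborel)"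
    by (rule lborel_pair.Fubini'[symmetric]) measurable
  also have "\<dots> = (\<integral>\<^sup>+t. ennreal ((norm (f t))\<^sup>2) * (\<integral>\<^sup>+x. ennreal ((norm (gauss0 (t - x)))\<^sup>2) \<partial>lborel) \<partial>lborel)"
    by (simp add: norm_mult power_mult_distrib ennreal_mult nn_integral_cmult)
  also have "\<dots> = L2_norm_sq f" by (simp add: unit L2_norm_sq_def)
  finally show ?thesis .
qed

lemma stft_norm:
  assumes f: "f \<in> L2"
  shows "integrable lborel (\<lambda>z. (norm (stft gauss0 f z))\<^sup>2)"
    and "(LINT z|lborel. (norm (stft gauss0 f z))\<^sup>2) = (LINT t|lborel. (norm (f t))\<^sup>2)"
proof -
  note [measurable] = L2D(1)[OF f]
  have eq: "(\<integral>\<^sup>+z. ennreal ((norm (stft gauss0 f z))\<^sup>2) \<partial>lborel) = ennreal (LINT t|lborel. (norm (f t))\<^sup>2)"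
    using stft_norm_nn[OF f] L2_norm_sq_eq[OF f] by simp
  then have "integrable lborel (\<lambda>z. (norm (stft gauss0 f z))\<^sup>2) \<and>
     (LINT z|lborel. (norm (stft gauss0 f z))\<^sup>2) = (LINT t|lborel. (norm (f t))\<^sup>2)"
    by (subst (asm) nn_integral_eq_integrable) auto
  then show "integrable lborel (\<lambda>z. (norm (stft gauss0 f z))\<^sup>2)"
    and "(LINT z|lborel. (norm (stft gauss0 f z))\<^sup>2) = (LINT t|lborel. (norm (f t))\<^sup>2)" by auto
qed

lemma Re_integral_mult_cnj:
  fixes f g :: "'a \<Rightarrow> complex"
  assumes [measurable]: "f \<in> borel_measurable M" "g \<in> borel_measurable M"
    and f: "integrable M (\<lambda>x. (norm (f x))\<^sup>2)" and g: "integrable M (\<lambda>x. (norm (g x))\<^sup>2)"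
  shows "2 * Re (LINT x|M. f x * cnj (g x)) = (LINT x|M. (norm (f x + g x))\<^sup>2)
           - (LINT x|M. (norm (f x))\<^sup>2) - (LINT x|M. (norm (g x))\<^sup>2)"
proof -
  have fg: "integrable M (\<lambda>x. f x * cnj (g x))"
    using f g by (intro integrable_mult_of_squares) auto
  have pt: "(norm (f x + g x))\<^sup>2 = (norm (f x))\<^sup>2 + ((norm (g x))\<^sup>2 + 2 * Re (f x * cnj (g x)))" for x
    unfolding cmod_power2 by (simp add: algebra_simps power2_eq_square)
  have R: "integrable M (\<lambda>x. 2 * Re (f x * cnj (g x)))" using integrable_Re[OF fg] by (rule integrable_mult_right)
  have "(LINT x|M. 2 * Re (f x * cnj (g x))) = 2 * Re (LINT x|M. f x * cnj (g x))"
    by (subst integral_Re[OF fg, symmetric]) (rule integral_mult_right_zero)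
  then show ?thesis
    unfolding pt Bochner_Integration.integral_add[OF f Bochner_Integration.integrable_add[OF g R]]
      Bochner_Integration.integral_add[OF g R] by simp
qed

text \<open>Polarization of the isometry, applied to f, g and f + g. Real parts suffice, since the
  lower bound pairs the operator output with f through the real part.\<close>

lemma stft_inner_Re:
  assumes f: "f \<in> L2" and g: "g \<in> L2"
  shows "Re (LINT z|lborel. stft gauss0 f z * cnj (stft gauss0 g z)) = Re (L2_inner f g)"
proof -
  note [measurable] = L2D(1)[OF f] L2D(1)[OF g]
  have fg: "(\<lambda>t. f t + g t) \<in> L2" using L2_lincomb[OF f g, of 1] by simp
  have "stft gauss0 (\<lambda>t. f t + g t) z = stft gauss0 f z + stft gauss0 g z" for z
    using stft_lincomb[OF f g L2_gauss0, of 1] by simp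
  then have "2 * Re (LINT z|lborel. stft gauss0 f z * cnj (stft gauss0 g z)) = 2 * Re (L2_inner f g)"
    using Re_integral_mult_cnj[OF _ _ stft_norm(1)[OF f] stft_norm(1)[OF g]]
      Re_integral_mult_cnj[OF _ _ L2D(2)[OF f] L2D(2)[OF g]] stft_norm(2)[OF fg]
    by (simp add: stft_norm(2) f g L2_inner_def)
  then show ?thesis by simp
qed

text \<open>Around the midpoint the mixed terms of the two exponents cancel, so the product
  separates into a factor in x and a factor in u. This is why \<open>stft_gauss0_gauss0\<close>
  substitutes t = x / 2 + u.\<close>

lemma gauss0_mult: "gauss0 (u + x / 2) * gauss0 (u - x / 2) = of_real (sqrt 2 * exp (- pi * x\<^sup>2 / 2) * exp (- (2 * pi) * u\<^sup>2))"
proof -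
  have "2 powr (1/4) * 2 powr (1/4) = (sqrt 2 :: real)"
    by (simp add: powr_half_sqrt flip: powr_add)
  moreover have "exp (- pi * (u + x / 2)\<^sup>2) * exp (- pi * (u - x / 2)\<^sup>2) = exp (- pi * x\<^sup>2 / 2) * exp (- (2 * pi) * u\<^sup>2)"
    unfolding exp_add[symmetric] by (rule arg_cong[of _ _ exp]) (simp add: power2_eq_square field_simps)
  ultimately have "(2 powr (1/4) * exp (- pi * (u + x / 2)\<^sup>2)) * (2 powr (1/4) * exp (- pi * (u - x / 2)\<^sup>2))
     = sqrt 2 * exp (- pi * x\<^sup>2 / 2) * exp (- (2 * pi) * u\<^sup>2)"
    by (simp add: mult_ac)
  then show ?thesis unfolding gauss0_def of_real_mult[symmetric] by (rule arg_cong)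
qed

lemma gaussian_fourier:
  "(LINT u|lborel. of_real (exp (- (2 * pi) * u\<^sup>2)) * cis (2 * pi * \<theta> * u)) = of_real (exp (- pi * \<theta>\<^sup>2 / 2) / sqrt 2)"
proof -
  \<comment> \<open>With u = c y the exponent 2 pi u^2 becomes y^2 / 2, that of the standard normal
    density.\<close>
  define c where "c = 1 / (2 * sqrt pi)"
  have c: "c > 0" by (simp add: c_def)
  have "(LINT u|lborel. of_real (exp (- (2 * pi) * u\<^sup>2)) * cis (2 * pi * \<theta> * u))
      = c *\<^sub>R (LINT y|lborel. of_real (exp (- (2 * pi) * (c * y)\<^sup>2)) * cis (2 * pi * \<theta> * (c * y)))"
    using lborel_integral_real_affine[of c "\<lambda>u. of_real (exp (- (2 * pi) * u\<^sup>2)) * cis (2 * pi * \<theta> * u)" 0] c by simp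
  also have "(LINT y|lborel. of_real (exp (- (2 * pi) * (c * y)\<^sup>2)) * cis (2 * pi * \<theta> * (c * y)))
     = (LINT y|lborel. of_real (sqrt (2 * pi)) * (of_real (std_normal_density y) * cis (sqrt pi * \<theta> * y)))"
  proof (rule Bochner_Integration.integral_cong[OF refl])
    fix y
    have 1: "exp (- (2 * pi) * (c * y)\<^sup>2) = sqrt (2 * pi) * std_normal_density y"
      by (simp add: std_normal_density_def c_def power_divide power_mult_distrib)
    have 2: "2 * pi * \<theta> * (c * y) = sqrt pi * \<theta> * y"
    proof -
      have "2 * pi * \<theta> * (c * y) = (pi / sqrt pi) * \<theta> * y" by (simp add: c_def)
      then show ?thesis by (simp add: real_div_sqrt)
    qed
    show "of_real (exp (- (2 * pi) * (c * y)\<^sup>2)) * cis (2 * pi * \<theta> * (c * y))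
      = of_real (sqrt (2 * pi)) * (of_real (std_normal_density y) * cis (sqrt pi * \<theta> * y))"
      unfolding 1 2 by simp
  qed
  also have "\<dots> = of_real (sqrt (2 * pi)) * of_real (exp (- (sqrt pi * \<theta>)\<^sup>2 / 2))"
    by (simp only: integral_mult_right_zero std_normal_fourier)
  also have "c *\<^sub>R (of_real (sqrt (2 * pi)) * of_real (exp (- (sqrt pi * \<theta>)\<^sup>2 / 2))) = (of_real (c * sqrt (2 * pi) * exp (- pi * \<theta>\<^sup>2 / 2)) :: complex)"
    by (simp add: scaleR_conv_of_real power_mult_distrib)
  also have "c * sqrt (2 * pi) * exp (- pi * \<theta>\<^sup>2 / 2) = exp (- pi * \<theta>\<^sup>2 / 2) / sqrt 2"
    by (simp add: c_def real_sqrt_mult field_simps)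
  finally show ?thesis .
qed

lemma stft_gauss0_gauss0:
  "stft gauss0 gauss0 (x, \<omega>) = cis (- (pi * x * \<omega>)) * of_real (exp (- pi * (x\<^sup>2 + \<omega>\<^sup>2) / 2))"
proof -
  have "stft gauss0 gauss0 (x, \<omega>) = (LINT t|lborel. gauss0 t * gauss0 (t - x) * cis (- (2 * pi * \<omega> * t)))"
    by (simp add: stft_gauss0_eq_fourier fourier_def)
  also have "\<dots> = (LINT u|lborel. gauss0 (x / 2 + u) * gauss0 (x / 2 + u - x) * cis (- (2 * pi * \<omega> * (x / 2 + u))))"
    using lborel_integral_real_affine[of 1 "\<lambda>t. gauss0 t * gauss0 (t - x) * cis (- (2 * pi * \<omega> * t))" "x / 2"] by simp
  also have "\<dots> = (LINT u|lborel. (of_real (sqrt 2 * exp (- pi * x\<^sup>2 / 2)) * cis (- (pi * x * \<omega>))) *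
      (of_real (exp (- (2 * pi) * u\<^sup>2)) * cis (2 * pi * (- \<omega>) * u)))"
  proof (rule Bochner_Integration.integral_cong[OF refl])
    fix u
    have 1: "x / 2 + u = u + x / 2" "u + x / 2 - x = u - x / 2" by (simp_all add: field_simps)
    have 2: "cis (- (2 * pi * \<omega> * (u + x / 2))) = cis (- (pi * x * \<omega>)) * cis (2 * pi * (- \<omega>) * u)"
      by (simp add: cis_mult algebra_simps)
    show "gauss0 (x / 2 + u) * gauss0 (x / 2 + u - x) * cis (- (2 * pi * \<omega> * (x / 2 + u)))
      = (of_real (sqrt 2 * exp (- pi * x\<^sup>2 / 2)) * cis (- (pi * x * \<omega>))) * (of_real (exp (- (2 * pi) * u\<^sup>2)) * cis (2 * pi * (- \<omega>) * u))"
      unfolding 1 gauss0_mult 2 by simp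
  qed
  also have "\<dots> = of_real (sqrt 2 * exp (- pi * x\<^sup>2 / 2)) * cis (- (pi * x * \<omega>)) * of_real (exp (- pi * (- \<omega>)\<^sup>2 / 2) / sqrt 2)"
    by (simp only: integral_mult_right_zero gaussian_fourier)
  also have "\<dots> = cis (- (pi * x * \<omega>)) * of_real (sqrt 2 * exp (- pi * x\<^sup>2 / 2) * (exp (- pi * (- \<omega>)\<^sup>2 / 2) / sqrt 2))"
    by (simp only: of_real_mult mult_ac)
  also have "sqrt 2 * exp (- pi * x\<^sup>2 / 2) * (exp (- pi * (- \<omega>)\<^sup>2 / 2) / sqrt 2) = exp (- pi * (x\<^sup>2 + \<omega>\<^sup>2) / 2)"
    by (simp add: field_simps flip: exp_add)
  finally show ?thesis .
qed

lemma norm_stft_gauss0_gauss0: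
  "norm (stft gauss0 gauss0 z) = exp (- (pi / 2) * (norm z)\<^sup>2)"
proof -
  obtain x \<omega> where z: "z = (x, \<omega>)" by fastforce
  have "norm (stft gauss0 gauss0 z) = exp (- pi * (x\<^sup>2 + \<omega>\<^sup>2) / 2)"
    unfolding z stft_gauss0_gauss0 norm_mult norm_cis norm_of_real by simp
  then show ?thesis by (simp add: z norm_Pair)
qed

text \<open>Covariance of the transform under time-frequency shifts. Without moduli the identity
  carries the phase \<open>cis (2 * pi * (b - y) * a)\<close>, which the later estimates
  discard.\<close>

lemma norm_stft_tf_shift:
  "norm (stft \<phi> (tf_shift z f) w) = norm (stft \<phi> f (w - z))"
proof -
  obtain a b x y where zw: "z = (a, b)" "w = (x, y)" by fastforce
  have "stft \<phi> (tf_shift z f) w = (LINT t|lborel. cis (2 * pi * b * t) * f (t - a) * cnj (cis (2 * pi * y * t) * \<phi> (t - x)))"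
    by (simp add: stft_def L2_inner_def tf_shift_def zw)
  also have "\<dots> = (LINT u|lborel. cis (2 * pi * b * (a + u)) * f (a + u - a) * cnj (cis (2 * pi * y * (a + u)) * \<phi> (a + u - x)))"
    using lborel_integral_real_affine[of 1 "\<lambda>t. cis (2 * pi * b * t) * f (t - a) * cnj (cis (2 * pi * y * t) * \<phi> (t - x))" a] by simp
  also have "\<dots> = (LINT u|lborel. cis (2 * pi * (b - y) * a) * (f u * cnj (cis (2 * pi * (y - b) * u) * \<phi> (u - (x - a)))))"
  proof (rule Bochner_Integration.integral_cong[OF refl])
    fix u
    have c: "cis (2 * pi * b * (a + u)) * cnj (cis (2 * pi * y * (a + u))) = cis (2 * pi * (b - y) * a) * cnj (cis (2 * pi * (y - b) * u))"
      by (simp add: cis_cnj cis_mult algebra_simps)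
    have e: "a + u - x = u - (x - a)" by simp
    have "cis (2 * pi * b * (a + u)) * f (a + u - a) * cnj (cis (2 * pi * y * (a + u)) * \<phi> (a + u - x))
      = (cis (2 * pi * b * (a + u)) * cnj (cis (2 * pi * y * (a + u)))) * (f u * cnj (\<phi> (u - (x - a))))"
      unfolding e by simp
    then show "cis (2 * pi * b * (a + u)) * f (a + u - a) * cnj (cis (2 * pi * y * (a + u)) * \<phi> (a + u - x))
      = cis (2 * pi * (b - y) * a) * (f u * cnj (cis (2 * pi * (y - b) * u) * \<phi> (u - (x - a))))"
      unfolding c by simp
  qed
  also have "\<dots> = cis (2 * pi * (b - y) * a) * stft \<phi> f (w - z)"
    by (simp add: stft_def L2_inner_def tf_shift_def zw)
  finally show ?thesis by (simp add: norm_mult)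
qed

lemma gaussian_integral_plane:
  fixes a :: real
  assumes a: "a > 0"
  shows "integrable lborel (\<lambda>z :: real \<times> real. exp (- a * (norm z)\<^sup>2))"
    and "(LINT z|(lborel :: (real \<times> real) measure). exp (- a * (norm z)\<^sup>2)) = pi / a"
proof -
  have e: "exp (- a * (norm z)\<^sup>2) = exp (- a * (fst z)\<^sup>2) * exp (- a * (snd z)\<^sup>2)" for z :: "real \<times> real"
    by (cases z) (simp add: norm_Pair algebra_simps flip: exp_add)
  have i: "integrable (lborel \<Otimes>\<^sub>M lborel) (\<lambda>(x, y). exp (- a * x\<^sup>2) * exp (- a * y\<^sup>2))"
  proof (rule lborel_pair.Fubini_integrable)
    show "integrable lborel (\<lambda>x. LINT y|lborel. norm (case (x, y) of (x, y) \<Rightarrow> exp (- a * x\<^sup>2) * exp (- a * y\<^sup>2)))"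
      using gaussian_integral[OF a] by (simp add: abs_mult)
    show "AE x in lborel. integrable lborel (\<lambda>y. case (x, y) of (x, y) \<Rightarrow> exp (- a * x\<^sup>2) * exp (- a * y\<^sup>2))"
      unfolding prod.case by (intro AE_I2 integrable_mult_right gaussian_integral a)
  qed measurable
  then have i': "integrable (lborel \<Otimes>\<^sub>M lborel) (\<lambda>z. exp (- a * (fst z)\<^sup>2) * exp (- a * (snd z)\<^sup>2))"
    by (simp add: split_beta')
  show "integrable lborel (\<lambda>z :: real \<times> real. exp (- a * (norm z)\<^sup>2))"
    unfolding e using i' by (simp only: lborel_prod)
  have "(LINT z|(lborel :: (real \<times> real) measure). exp (- a * (norm z)\<^sup>2)) = (LINT z|(lborel \<Otimes>\<^sub>M lborel). exp (- a * (fst z)\<^sup>2) * exp (- a * (snd z)\<^sup>2))"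
    unfolding e by (simp only: lborel_prod)
  also have "\<dots> = (LINT x|lborel. LINT y|lborel. exp (- a * x\<^sup>2) * exp (- a * y\<^sup>2))"
    using lborel_pair.integral_fst'[OF i'] by simp
  also have "\<dots> = sqrt (pi / a) * sqrt (pi / a)"
    using gaussian_integral(2)[OF a] by simp
  also have "\<dots> = pi / a" using a by simp
  finally show "(LINT z|(lborel :: (real \<times> real) measure). exp (- a * (norm z)\<^sup>2)) = pi / a" .
qed

text \<open>The exact value turns the hypothesis on C0 into C0 < 1, the threshold that keeps the
  window multiples away from 0.\<close>

lemma stft_gauss0_gauss0_L1: "(LINT z|lborel. norm (stft gauss0 gauss0 z)) = 2"
  unfolding norm_stft_gauss0_gauss0 using gaussian_integral_plane(2)[of "pi / 2"] by simp

section \<open>The synthesis operator, adjoint to the transform\<close>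

definition synthesis :: "(real \<times> real \<Rightarrow> complex) \<Rightarrow> real \<Rightarrow> complex" where
  "synthesis G t = (LINT z|lborel. G z * tf_shift z gauss0 t)"

lemma loc_op_gauss0: "loc_op m gauss0 f = synthesis (\<lambda>z. stft gauss0 f z * of_real (m z))"
  by (simp add: loc_op_def[abs_def] synthesis_def[abs_def])

text \<open>This licenses Fubini in \<open>synthesis_inner\<close>. The inner integral over t is at
  most 1 + \<open>?S\<close> uniformly in z, so integrability of G controls the whole
  kernel.\<close>

lemma integrable_synthesis_kernel:
  assumes G: "integrable lborel G" and h: "h \<in> L2"
  shows "integrable (lborel \<Otimes>\<^sub>M lborel) (\<lambda>(z, t). G z * (tf_shift z gauss0 t * cnj (h t)))"
proof (rule lborel_pair.Fubini_integrable)
  note [measurable] = L2D(1)[OF h]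
  have [measurable]: "G \<in> borel_measurable borel" using G by auto
  let ?S = "LINT t|lborel. (norm (h t))\<^sup>2"
  have i: "integrable lborel (\<lambda>t. tf_shift z gauss0 t * cnj (h t))" for z
    by (rule L2_mult_cnj_integrable[OF L2_tf_shift[OF L2_gauss0] h])
  have m: "(\<lambda>p. G (fst p) * (tf_shift (fst p) gauss0 (snd p) * cnj (h (snd p)))) \<in> borel_measurable (borel \<Otimes>\<^sub>M borel)"
    by measurable
  then show m': "(\<lambda>(z, t). G z * (tf_shift z gauss0 t * cnj (h t))) \<in> borel_measurable (lborel \<Otimes>\<^sub>M lborel)"
    by (simp add: split_beta')
  show "AE z in lborel. integrable lborel (\<lambda>t. case (z, t) of (z, t) \<Rightarrow> G z * (tf_shift z gauss0 t * cnj (h t)))"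
    unfolding prod.case by (intro AE_I2 integrable_mult_right i)
  have b: "(LINT t|lborel. norm (tf_shift z gauss0 t * cnj (h t))) \<le> 1 + ?S" for z
  proof -
    have sh: "integrable lborel (\<lambda>t. (norm (gauss0 (t - fst z)))\<^sup>2)"
      by (rule integrable_lborel_shift[OF gauss0_sq_integral(1)])
    have "(LINT t|lborel. norm (tf_shift z gauss0 t * cnj (h t))) \<le> (LINT t|lborel. (norm (gauss0 (t - fst z)))\<^sup>2 + (norm (h t))\<^sup>2)"
    proof (rule integral_mono)
      show "norm (tf_shift z gauss0 t * cnj (h t)) \<le> (norm (gauss0 (t - fst z)))\<^sup>2 + (norm (h t))\<^sup>2" for t
        using mult_le_sum_power2[of "norm (gauss0 (t - fst z))" "norm (h t)"]
        by (simp only: norm_mult norm_tf_shift complex_mod_cnj)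
    qed (use i sh L2D(2)[OF h] in auto)
    also have "\<dots> = 1 + ?S"
      using integral_lborel_shift[of "\<lambda>t. (norm (gauss0 t))\<^sup>2" "fst z"]
      by (simp only: Bochner_Integration.integral_add[OF sh L2D(2)[OF h]] gauss0_sq_integral)
    finally show ?thesis .
  qed
  show "integrable lborel (\<lambda>z. LINT t|lborel. norm (case (z, t) of (z, t) \<Rightarrow> G z * (tf_shift z gauss0 t * cnj (h t))))"
  proof (rule Bochner_Integration.integrable_bound)
    show "integrable lborel (\<lambda>z. norm (G z) * (1 + ?S))" using G by simp
    show "(\<lambda>z. LINT t|lborel. norm (case (z, t) of (z, t) \<Rightarrow> G z * (tf_shift z gauss0 t * cnj (h t)))) \<in> borel_measurable lborel"
      using m' by measurable
    show "AE z in lborel. norm (LINT t|lborel. norm (case (z, t) of (z, t) \<Rightarrow> G z * (tf_shift z gauss0 t * cnj (h t))))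
      \<le> norm (norm (G z) * (1 + ?S))"
    proof (rule AE_I2)
      fix z
      have "norm (LINT t|lborel. norm (G z * (tf_shift z gauss0 t * cnj (h t)))) = norm (G z) * (LINT t|lborel. norm (tf_shift z gauss0 t * cnj (h t)))"
        by (simp only: norm_mult[of "G z"] integral_mult_right_zero real_norm_def abs_mult abs_norm_cancel) (simp add: abs_of_nonneg)
      also have "\<dots> \<le> norm (G z) * (1 + ?S)" by (intro mult_left_mono b) auto
      finally show "norm (LINT t|lborel. norm (case (z, t) of (z, t) \<Rightarrow> G z * (tf_shift z gauss0 t * cnj (h t))))
        \<le> norm (norm (G z) * (1 + ?S))" by simp
    qed
  qed
qed

lemma synthesis_inner:
  assumes G: "integrable lborel G" and h: "h \<in> L2"
  shows "L2_inner (synthesis G) h = (LINT z|lborel. G z * cnj (stft gauss0 h z))"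
proof -
  have "L2_inner (synthesis G) h = (LINT t|lborel. LINT z|lborel. G z * (tf_shift z gauss0 t * cnj (h t)))"
    unfolding L2_inner_def synthesis_def by (simp flip: mult.assoc)
  also have "\<dots> = (LINT z|lborel. LINT t|lborel. G z * (tf_shift z gauss0 t * cnj (h t)))"
    by (rule lborel_pair.Fubini_integral[OF integrable_synthesis_kernel[OF G h]])
  also have "\<dots> = (LINT z|lborel. G z * cnj (stft gauss0 h z))"
    unfolding stft_def L2_inner_def Bochner_Integration.integral_cnj[symmetric]
    by (simp add: mult.commute)
  finally show ?thesis .
qed

text \<open>A bounded integrable function is square integrable: boundedness of the Gaussian bounds
  the output, and its integrability makes the output integrable by Fubini. The bound with constant 1
  comes from the duality argument of \<open>synthesis_norm_le\<close>, which needs this membership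
  first.\<close>

lemma synthesis_L2:
  assumes G: "integrable lborel G"
  shows "synthesis G \<in> L2"
proof -
  have [measurable]: "G \<in> borel_measurable borel" using G by auto
  let ?N = "LINT z|lborel. norm (G z)"
  have kb: "norm (G z * tf_shift z gauss0 t) \<le> 2 * norm (G z)" for z t
    using mult_left_mono[OF norm_gauss0_le[of "t - fst z"] norm_ge_zero[of "G z"]] by (simp add: norm_mult norm_tf_shift)
  have "(\<lambda>p. G (fst p) * tf_shift (fst p) gauss0 (snd p)) \<in> borel_measurable (borel \<Otimes>\<^sub>M borel)"
    by measurable
  then have m: "(\<lambda>(z, t). G z * tf_shift z gauss0 t) \<in> borel_measurable (lborel \<Otimes>\<^sub>M lborel)"
    by (simp add: split_beta')
  have sh: "integrable lborel (\<lambda>t. norm (gauss0 (t - a)))" for a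
    by (rule integrable_lborel_shift) (rule integrable_norm[OF integrable_gauss0])
  have "integrable (lborel \<Otimes>\<^sub>M lborel) (\<lambda>(z, t). G z * tf_shift z gauss0 t)"
  proof (rule lborel_pair.Fubini_integrable[OF m])
    have "integrable lborel (tf_shift z gauss0)" for z
    proof -
      have "tf_shift z gauss0 \<in> borel_measurable borel" by (rule L2D(1)[OF L2_tf_shift[OF L2_gauss0]])
      then show ?thesis
        using sh[of "fst z"] by (intro Bochner_Integration.integrable_bound[OF sh[of "fst z"]]) (auto simp: norm_tf_shift)
    qed
    then show "AE z in lborel. integrable lborel (\<lambda>t. case (z, t) of (z, t) \<Rightarrow> G z * tf_shift z gauss0 t)"
      unfolding prod.case by (intro AE_I2 integrable_mult_right)
    have "(LINT t|lborel. norm (G z * tf_shift z gauss0 t)) = norm (G z) * (LINT t|lborel. norm (gauss0 t))" for z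
      using integral_lborel_shift[of "\<lambda>t. norm (gauss0 t)" "fst z"]
      by (simp only: norm_mult norm_tf_shift integral_mult_right_zero)
    then show "integrable lborel (\<lambda>z. LINT t|lborel. norm (case (z, t) of (z, t) \<Rightarrow> G z * tf_shift z gauss0 t))"
      using G by simp
  qed
  then have int: "integrable lborel (synthesis G)"
    using lborel_pair.integrable_snd[of "\<lambda>z t. G z * tf_shift z gauss0 t"] by (simp add: synthesis_def[abs_def])
  have bound: "norm (synthesis G t) \<le> 2 * ?N" for t
  proof -
    have [measurable]: "(\<lambda>z. tf_shift z gauss0 t) \<in> borel_measurable borel"
      using measurable_compose[OF measurable_Pair2'[of t borel borel] borel_measurable_tf_shift[OF borel_measurable_gauss0]]
      by simp
    have i: "integrable lborel (\<lambda>z. G z * tf_shift z gauss0 t)"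
      by (rule Bochner_Integration.integrable_bound[of _ "\<lambda>z. 2 * norm (G z)"]) (use G kb in auto)
    have "norm (synthesis G t) \<le> (LINT z|lborel. norm (G z * tf_shift z gauss0 t))"
      unfolding synthesis_def by (rule integral_norm_bound)
    also have "\<dots> \<le> (LINT z|lborel. 2 * norm (G z))"
      by (rule integral_mono) (use i G kb in auto)
    finally show ?thesis by simp
  qed
  have "integrable lborel (\<lambda>t. (norm (synthesis G t))\<^sup>2)"
  proof (rule Bochner_Integration.integrable_bound)
    show "integrable lborel (\<lambda>t. 2 * ?N * norm (synthesis G t))" using int by simp
    show "(\<lambda>t. (norm (synthesis G t))\<^sup>2) \<in> borel_measurable lborel" using int by auto
    have "(norm (synthesis G t))\<^sup>2 \<le> 2 * ?N * norm (synthesis G t)" for t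
      unfolding power2_eq_square by (intro mult_right_mono bound) auto
    then show "AE t in lborel. norm ((norm (synthesis G t))\<^sup>2) \<le> norm (2 * ?N * norm (synthesis G t))"
      by (auto simp: abs_of_nonneg)
  qed
  then show ?thesis using int by (auto simp: L2_def)
qed

text \<open>With V the transform and W the synthesis, ||W G||^2 = <G, V W G> \<le> ||G|| ||V W G|| =
  ||G|| ||W G||, and one factor cancels. The cancellation is legitimate because ||W G|| is already
  known to be finite.\<close>

lemma synthesis_norm_le:
  assumes G: "integrable lborel G" and G2: "integrable lborel (\<lambda>z. (norm (G z))\<^sup>2)"
  shows "(LINT t|lborel. (norm (synthesis G t))\<^sup>2) \<le> (LINT z|lborel. (norm (G z))\<^sup>2)"
proof -
  have [measurable]: "G \<in> borel_measurable borel" using G by auto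
  note h = synthesis_L2[OF G]
  note [measurable] = L2D(1)[OF h]
  let ?S = "LINT t|lborel. (norm (synthesis G t))\<^sup>2"
  have "complex_of_real ?S = L2_inner (synthesis G) (synthesis G)"
    unfolding L2_inner_def by (subst integral_complex_of_real[symmetric]) (simp only: complex_norm_square)
  also have "\<dots> = (LINT z|lborel. G z * cnj (stft gauss0 (synthesis G) z))"
    by (rule synthesis_inner[OF G h])
  finally have eq: "complex_of_real ?S = (LINT z|lborel. G z * cnj (stft gauss0 (synthesis G) z))" .
  have "?S\<^sup>2 = (norm (complex_of_real ?S))\<^sup>2" by simp
  also have "\<dots> \<le> (LINT z|lborel. norm (G z) * norm (stft gauss0 (synthesis G) z))\<^sup>2"
    unfolding eq using integral_norm_bound[of lborel "\<lambda>z. G z * cnj (stft gauss0 (synthesis G) z)"]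
    by (intro power_mono) (auto simp: norm_mult)
  also have "\<dots> \<le> (LINT z|lborel. (norm (G z))\<^sup>2) * (LINT z|lborel. (norm (stft gauss0 (synthesis G) z))\<^sup>2)"
    by (rule Cauchy_Schwarz_integral[OF _ _ G2 stft_norm(1)[OF h]]) measurable
  also have "\<dots> = (LINT z|lborel. (norm (G z))\<^sup>2) * ?S" by (simp only: stft_norm(2)[OF h])
  finally have "?S * ?S \<le> (LINT z|lborel. (norm (G z))\<^sup>2) * ?S" by (simp add: power2_eq_square)
  moreover have "?S \<ge> 0" "(LINT z|lborel. (norm (G z))\<^sup>2) \<ge> 0" by auto
  ultimately show ?thesis by (metis mult_le_cancel_right order_le_less)
qed

text \<open>The value of the transform at z is a pairing with a shifted Gaussian, so moving the
  synthesis to the other side produces the reproducing kernel, of modulus exp (- (pi / 2) |w -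
  z|^2). Its decay off the diagonal keeps the output concentrated where G is.\<close>

lemma norm_stft_synthesis_le:
  assumes G: "integrable lborel G"
  shows "norm (stft gauss0 (synthesis G) z) \<le> (LINT w|lborel. norm (G w) * exp (- (pi / 2) * (norm (w - z))\<^sup>2))"
proof -
  have "stft gauss0 (synthesis G) z = (LINT w|lborel. G w * cnj (stft gauss0 (tf_shift z gauss0) w))"
    unfolding stft_def[of gauss0 "synthesis G"] by (rule synthesis_inner[OF G L2_tf_shift[OF L2_gauss0]])
  also have "norm \<dots> \<le> (LINT w|lborel. norm (G w * cnj (stft gauss0 (tf_shift z gauss0) w)))"
    by (rule integral_norm_bound)
  also have "\<dots> = (LINT w|lborel. norm (G w) * exp (- (pi / 2) * (norm (w - z))\<^sup>2))"
    by (simp only: norm_mult complex_mod_cnj norm_stft_tf_shift norm_stft_gauss0_gauss0)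
  finally show ?thesis .
qed

section \<open>Windows close to the Gaussian\<close>

text \<open>The Bargmann transform of \<^term>\<open>f\<close> up to normalization; \<^term>\<open>stft gauss0 f\<close> is this entire function
  in the variable \<open>x - \<i> \<omega>\<close> times a Gaussian.\<close>

definition bargmann :: "(real \<Rightarrow> complex) \<Rightarrow> complex \<Rightarrow> complex" where
  "bargmann f w = (LINT t|lborel. f t * gauss0 t * exp (of_real (2 * pi * t) * w))"

lemma stft_gauss0_eq_bargmann:
  "stft gauss0 f (x, \<omega>) = of_real (exp (- pi * x\<^sup>2)) * bargmann f (Complex x (- \<omega>))"
proof -
  have "stft gauss0 f (x, \<omega>) = (LINT t|lborel. of_real (exp (- pi * x\<^sup>2)) * (f t * gauss0 t * exp (of_real (2 * pi * t) * Complex x (- \<omega>))))"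
    unfolding stft_gauss0_eq_fourier fourier_def
  proof (rule Bochner_Integration.integral_cong[OF refl])
    fix t
    have "exp (- pi * (t - x)\<^sup>2) = exp (- pi * x\<^sup>2) * exp (- pi * t\<^sup>2) * exp (2 * pi * t * x)"
      unfolding exp_add[symmetric] by (rule arg_cong[of _ _ exp]) (simp add: power2_eq_square algebra_simps)
    then have 1: "gauss0 (t - x) = of_real (exp (- pi * x\<^sup>2)) * gauss0 t * of_real (exp (2 * pi * t * x))"
      by (simp add: gauss0_def)
    have 2: "exp (of_real (2 * pi * t) * Complex x (- \<omega>)) = of_real (exp (2 * pi * t * x)) * cis (- (2 * pi * \<omega> * t))"
      by (subst exp_eq_polar) (simp add: mult_ac flip: exp_of_real)
    show "f t * gauss0 (t - x) * cis (- (2 * pi * \<omega> * t))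
        = of_real (exp (- pi * x\<^sup>2)) * (f t * gauss0 t * exp (of_real (2 * pi * t) * Complex x (- \<omega>)))"
      unfolding 1 2 by (simp add: mult_ac)
  qed
  then show ?thesis by (simp add: bargmann_def)
qed

text \<open>This function majorizes the exponential series in \<open>bargmann_holomorphic\<close>.
  The square of |gauss0 t| exp (2 pi |t| r) is a Gaussian times exp (4 pi |t| r); bounding the
  exponential by the sum over both signs of t and completing the square gives two shifted
  Gaussians.\<close>

lemma integrable_mult_gauss0_exp:
  assumes f: "f \<in> L2"
  shows "integrable lborel (\<lambda>t. norm (f t) * norm (gauss0 t) * exp (2 * pi * \<bar>t\<bar> * r))"
proof (rule Bochner_Integration.integrable_bound)
  note [measurable] = L2D(1)[OF f]
  have e: "exp (- (2 * pi) * t\<^sup>2) * exp (4 * pi * t * a) = exp (2 * pi * a\<^sup>2) * exp (- (2 * pi) * (t - a)\<^sup>2)" for t a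
    unfolding exp_add[symmetric] by (rule arg_cong[of _ _ exp]) (simp add: power2_eq_square algebra_simps)
  have i: "integrable lborel (\<lambda>t. exp (2 * pi * a\<^sup>2) * exp (- (2 * pi) * (t - a)\<^sup>2))" for a
    by (intro integrable_mult_right integrable_lborel_shift[of "\<lambda>t. exp (- (2 * pi) * t\<^sup>2)"] gaussian_integral) auto
  show "integrable lborel (\<lambda>t. (norm (f t))\<^sup>2 + sqrt 2 * (exp (- (2 * pi) * t\<^sup>2) * exp (4 * pi * t * r) + exp (- (2 * pi) * t\<^sup>2) * exp (4 * pi * t * (- r))))"
    unfolding e by (intro Bochner_Integration.integrable_add integrable_mult_right[of "sqrt 2"] L2D(2)[OF f] i)
  have "norm (f t) * norm (gauss0 t) * exp (2 * pi * \<bar>t\<bar> * r)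
    \<le> (norm (f t))\<^sup>2 + sqrt 2 * (exp (- (2 * pi) * t\<^sup>2) * exp (4 * pi * t * r) + exp (- (2 * pi) * t\<^sup>2) * exp (4 * pi * t * (- r)))" for t
  proof -
    have "norm (f t) * (norm (gauss0 t) * exp (2 * pi * \<bar>t\<bar> * r)) \<le> (norm (f t))\<^sup>2 + (norm (gauss0 t) * exp (2 * pi * \<bar>t\<bar> * r))\<^sup>2"
      by (rule mult_le_sum_power2)
    also have "(norm (gauss0 t) * exp (2 * pi * \<bar>t\<bar> * r))\<^sup>2 = sqrt 2 * (exp (- (2 * pi) * t\<^sup>2) * exp (4 * pi * \<bar>t\<bar> * r))"
      unfolding power_mult_distrib norm_gauss0_sq by (simp add: mult_ac flip: exp_double)
    also have "exp (4 * pi * \<bar>t\<bar> * r) \<le> exp (4 * pi * t * r) + exp (4 * pi * t * (- r))"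
      by (cases "t \<ge> 0") (auto simp: abs_if)
    finally show ?thesis by (simp add: algebra_simps mult_left_mono)
  qed
  then show "AE t in lborel. norm (norm (f t) * norm (gauss0 t) * exp (2 * pi * \<bar>t\<bar> * r))
    \<le> norm ((norm (f t))\<^sup>2 + sqrt 2 * (exp (- (2 * pi) * t\<^sup>2) * exp (4 * pi * t * r) + exp (- (2 * pi) * t\<^sup>2) * exp (4 * pi * t * (- r))))"
    by (auto intro!: order_trans[OF _ abs_ge_self])
qed (use L2D(1)[OF f] in measurable)

text \<open>The exponential series may be integrated term by term, since its absolute values sum to
  the integrable majorant \<open>?E\<close>. The result is a power series in w that converges
  everywhere.\<close>

lemma bargmann_holomorphic:
  assumes f: "f \<in> L2"
  shows "bargmann f holomorphic_on UNIV"
proof -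
  note [measurable] = L2D(1)[OF f]
  define a where "a n = (LINT t|lborel. f t * gauss0 t * of_real ((2 * pi * t) ^ n / fact n))" for n
  have sums: "(\<lambda>n. a n * w ^ n) sums bargmann f w" for w
  proof -
    define u where "u n t = f t * gauss0 t * of_real ((2 * pi * t) ^ n / fact n) * w ^ n" for n t
    have [measurable]: "u n \<in> borel_measurable borel" for n unfolding u_def[abs_def] by measurable
    let ?E = "\<lambda>t. norm (f t) * norm (gauss0 t) * exp (2 * pi * \<bar>t\<bar> * norm w)"
    have nu: "norm (u n t) = norm (f t) * norm (gauss0 t) * ((2 * pi * \<bar>t\<bar> * norm w) ^ n / fact n)" for n t
      by (simp add: u_def norm_mult norm_power norm_divide abs_mult power_mult_distrib)
    have ex: "(\<lambda>n. y ^ n / fact n) sums exp y" for y :: real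
      using exp_converges[of y] by (simp add: field_simps)
    have nsum: "(\<lambda>n. norm (u n t)) sums ?E t" for t
      unfolding nu by (intro sums_mult ex)
    have psum: "(\<Sum>n<k. norm (u n t)) \<le> ?E t" for k t
      using nsum[of t] by (metis sum_le_suminf sums_summable sums_unique finite_lessThan norm_ge_zero)
    have iu: "integrable lborel (u n)" for n
    proof (rule Bochner_Integration.integrable_bound[OF integrable_mult_gauss0_exp[OF f, of "norm w"]])
      have "norm (u n t) \<le> ?E t" for t
        using psum[of t "Suc n"] sum_nonneg[of "{..<n}" "\<lambda>n. norm (u n t)"] by simp
      then show "AE t in lborel. norm (u n t) \<le> norm (?E t)" by auto
    qed simp
    have "summable (\<lambda>n. LINT t|lborel. norm (u n t))"
    proof (rule summableI_nonneg_bounded)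
      fix k
      have "(\<Sum>n<k. LINT t|lborel. norm (u n t)) = (LINT t|lborel. (\<Sum>n<k. norm (u n t)))"
        using iu by (subst Bochner_Integration.integral_sum) auto
      also have "\<dots> \<le> (LINT t|lborel. ?E t)"
        by (intro integral_mono Bochner_Integration.integrable_sum integrable_norm iu psum integrable_mult_gauss0_exp[OF f])
      finally show "(\<Sum>n<k. LINT t|lborel. norm (u n t)) \<le> (LINT t|lborel. ?E t)" .
    qed auto
    then have "(\<lambda>n. LINT t|lborel. u n t) sums (LINT t|lborel. (\<Sum>n. u n t))"
      by (intro sums_integral iu AE_I2 sums_summable[OF nsum])
    moreover have "(\<Sum>n. u n t) = f t * gauss0 t * exp (of_real (2 * pi * t) * w)" for t
    proof -
      have "(\<lambda>n. (of_real (2 * pi * t) * w) ^ n /\<^sub>R fact n) sums exp (of_real (2 * pi * t) * w)"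
        by (rule exp_converges)
      then have "(\<lambda>n. f t * gauss0 t * ((of_real (2 * pi * t) * w) ^ n /\<^sub>R fact n)) sums (f t * gauss0 t * exp (of_real (2 * pi * t) * w))"
        by (rule sums_mult)
      moreover have "f t * gauss0 t * ((of_real (2 * pi * t) * w) ^ n /\<^sub>R fact n) = u n t" for n
        by (simp add: u_def power_mult_distrib scaleR_conv_of_real field_simps)
      ultimately show ?thesis by (simp add: sums_iff)
    qed
    moreover have "(LINT t|lborel. u n t) = a n * w ^ n" for n
      unfolding u_def a_def by (rule integral_mult_left_zero)
    ultimately show ?thesis by (simp add: bargmann_def)
  qed
  have "(bargmann f has_field_derivative (\<Sum>n. diffs a n * w ^ n)) (at w)" for w
  proof -
    have "bargmann f = (\<lambda>w. \<Sum>n. a n * w ^ n)" using sums by (auto simp: sums_iff)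
    then show ?thesis
      using termdiffs_strong_converges_everywhere[of a w] sums by (auto simp: sums_iff)
  qed
  then show ?thesis by (auto simp: holomorphic_on_def field_differentiable_def)
qed

lemma stft_gauss0_injective:
  assumes f: "f \<in> L2" and zero: "\<And>z. stft gauss0 f z = 0"
  shows "AE t in lborel. f t = 0"
proof -
  have "(LINT t|lborel. (norm (f t))\<^sup>2) = 0"
    using stft_norm(2)[OF f] by (simp add: zero)
  then have "AE t in lborel. (norm (f t))\<^sup>2 = 0"
    using integral_nonneg_eq_0_iff_AE[OF L2D(2)[OF f]] by simp
  then show ?thesis by simp
qed

text \<open>By Liouville's theorem, a window whose transform is this close to that of the Gaussian is a multiple of it.\<close>

lemma window_rigidity:
  assumes \<phi>: "\<phi> \<in> L2"
    and close: "\<And>z. norm (stft gauss0 gauss0 z - stft gauss0 \<phi> z) < C0 * norm (stft gauss0 gauss0 z)"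
  obtains c where "norm (1 - c) < C0" "AE t in lborel. \<phi> t = c * gauss0 t"
proof -
  \<comment> \<open>Both transforms carry the same Gaussian prefactor, so their ratio at (Re w, - Im
    w) is a ratio of entire functions whose denominator has no zeros.\<close>
  define D where "D w = bargmann \<phi> w / bargmann gauss0 w" for w
  have nz: "bargmann gauss0 w \<noteq> 0" for w
  proof -
    have "stft gauss0 gauss0 (Re w, - Im w) \<noteq> 0"
      using norm_stft_gauss0_gauss0[of "(Re w, - Im w)"] by (metis exp_not_eq_zero norm_zero)
    then show ?thesis unfolding stft_gauss0_eq_bargmann by simp
  qed
  have bound: "norm (1 - D w) < C0" for w
  proof -
    let ?e = "complex_of_real (exp (- pi * (Re w)\<^sup>2))"
    have 1: "norm (?e * bargmann gauss0 w - ?e * bargmann \<phi> w) < C0 * norm (?e * bargmann gauss0 w)"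
      using close[of "(Re w, - Im w)"] unfolding stft_gauss0_eq_bargmann by simp
    have 2: "?e * bargmann gauss0 w - ?e * bargmann \<phi> w = (?e * bargmann gauss0 w) * (1 - D w)"
      using nz[of w] by (simp add: D_def field_simps)
    have 3: "norm (?e * bargmann gauss0 w) > 0" using nz[of w] by simp
    show ?thesis using 1 3 unfolding 2 norm_mult[of "?e * bargmann gauss0 w"]
      by (simp only: mult.commute[of C0] mult_less_cancel_left_pos)
  qed
  have "D holomorphic_on UNIV"
    unfolding D_def[abs_def] using nz by (intro holomorphic_on_divide bargmann_holomorphic \<phi> L2_gauss0) auto
  moreover have "bounded (range D)"
  proof (rule boundedI)
    fix y assume "y \<in> range D"
    then obtain w where "y = D w" by auto
    then show "norm y \<le> 1 + C0"
      using bound[of w] norm_triangle_ineq4[of 1 "1 - D w"] by simp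
  qed
  ultimately have "D constant_on UNIV" by (rule Liouville_theorem)
  then obtain c where c: "\<And>w. D w = c" by (auto simp: constant_on_def)
  have st: "stft gauss0 \<phi> z = c * stft gauss0 gauss0 z" for z
  proof -
    obtain x \<omega> where z: "z = (x, \<omega>)" by fastforce
    show ?thesis
      using c[of "Complex x (- \<omega>)"] nz[of "Complex x (- \<omega>)"] unfolding z stft_gauss0_eq_bargmann D_def
      by (simp add: field_simps)
  qed
  \<comment> \<open>Proportionality of the transforms is pulled back by injectivity, applied to the
    difference of the window and the multiple of the Gaussian.\<close>
  have "AE t in lborel. \<phi> t + (- c) * gauss0 t = 0"
    by (rule stft_gauss0_injective[OF L2_lincomb[OF \<phi> L2_gauss0]])
       (simp only: stft_lincomb[OF \<phi> L2_gauss0 L2_gauss0] st, simp)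
  then have "AE t in lborel. \<phi> t = c * gauss0 t" by simp
  moreover have "norm (1 - c) < C0" using bound[of 0] c by simp
  ultimately show thesis by (rule that[rotated])
qed

text \<open>The window enters once conjugated in the analysis and once in the synthesis, hence the
  factor cnj c * c. The identity holds at every t although the windows agree almost everywhere: for
  fixed t the exceptional z are those with t - fst z in a null set of the line, and these form a
  null set of the plane.\<close>

lemma loc_op_multiple_window:
  assumes \<phi>: "\<phi> \<in> L2" and ae: "AE t in lborel. \<phi> t = c * gauss0 t"
    and f: "f \<in> borel_measurable borel" and m: "m \<in> borel_measurable borel"
  shows "loc_op m \<phi> f t = of_real ((norm c)\<^sup>2) * loc_op m gauss0 f t"
proof -
  note [measurable] = L2D(1)[OF \<phi>] f m
  have stft: "stft \<phi> f z = cnj c * stft gauss0 f z" for z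
  proof -
    have "AE u in lborel. \<phi> (- fst z + 1 * u) = c * gauss0 (- fst z + 1 * u)"
      by (rule AE_borel_affine[OF _ _ ae]) (simp, measurable)
    then have "AE u in lborel. f u * cnj (tf_shift z \<phi> u) = cnj c * (f u * cnj (tf_shift z gauss0 u))"
      by eventually_elim (simp add: tf_shift_def)
    then have "stft \<phi> f z = (LINT u|lborel. cnj c * (f u * cnj (tf_shift z gauss0 u)))"
      unfolding stft_def L2_inner_def by (intro integral_cong_AE) (auto simp: tf_shift_def)
    then show ?thesis by (simp add: stft_def L2_inner_def)
  qed
  have "AE x in lborel. \<phi> (t + (- 1) * x) = c * gauss0 (t + (- 1) * x)"
    by (rule AE_borel_affine[OF _ _ ae]) (simp, measurable)
  then have ae': "AE x in lborel. AE \<omega> in (lborel :: real measure). \<phi> (t - fst (x, \<omega>)) = c * gauss0 (t - fst (x, \<omega>))"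
    by eventually_elim simp
  have "Measurable.pred borel (\<lambda>u. \<phi> u = c * gauss0 u)" by measurable
  moreover have "(\<lambda>z. t - fst z) \<in> borel_measurable (lborel \<Otimes>\<^sub>M (lborel :: real measure))" by measurable
  ultimately have "Measurable.pred (lborel \<Otimes>\<^sub>M (lborel :: real measure)) (\<lambda>z. \<phi> (t - fst z) = c * gauss0 (t - fst z))"
    by (rule measurable_compose[rotated])
  then have "AE z in (lborel \<Otimes>\<^sub>M (lborel :: real measure)). \<phi> (t - fst z) = c * gauss0 (t - fst z)"
    by (intro lborel_pair.AE_pair_measure ae') (simp add: pred_def)
  then have "AE z in (lborel :: (real \<times> real) measure). \<phi> (t - fst z) = c * gauss0 (t - fst z)" by (simp only: lborel_prod)
  then have "AE z in lborel. stft \<phi> f z * of_real (m z) * tf_shift z \<phi> t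
      = of_real ((norm c)\<^sup>2) * (stft gauss0 f z * of_real (m z) * tf_shift z gauss0 t)"
    by eventually_elim (simp only: stft tf_shift_def complex_norm_square mult_ac)
  moreover have [measurable]: "(\<lambda>z. tf_shift z \<psi> t) \<in> borel_measurable borel" if "\<psi> \<in> borel_measurable borel" for \<psi>
    using measurable_compose[OF measurable_Pair2'[of t borel borel] borel_measurable_tf_shift[OF that]] by simp
  ultimately have "loc_op m \<phi> f t = (LINT z|lborel. of_real ((norm c)\<^sup>2) * (stft gauss0 f z * of_real (m z) * tf_shift z gauss0 t))"
    unfolding loc_op_def by (intro integral_cong_AE) auto
  then show ?thesis by (simp add: loc_op_def)
qed

lemma integrable_stft_mult:
  assumes f: "f \<in> L2" and m: "integrable lborel m"
  shows "integrable lborel (\<lambda>z. stft gauss0 f z * of_real (m z))"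
proof (rule Bochner_Integration.integrable_bound)
  note [measurable] = L2D(1)[OF f]
  have [measurable]: "m \<in> borel_measurable borel" using m by auto
  show "integrable lborel (\<lambda>z. sqrt (LINT t|lborel. (norm (f t))\<^sup>2) * m z)" using m by simp
  show "(\<lambda>z. stft gauss0 f z * of_real (m z)) \<in> borel_measurable lborel" by measurable
  have "norm (stft gauss0 f z) \<le> sqrt (LINT t|lborel. (norm (f t))\<^sup>2)" for z
    using norm_stft_sq_le[OF f, of z] by (rule real_le_rsqrt)
  then show "AE z in lborel. norm (stft gauss0 f z * of_real (m z)) \<le> norm (sqrt (LINT t|lborel. (norm (f t))\<^sup>2) * m z)"
    by (auto simp: norm_mult abs_mult intro!: mult_right_mono)
qed

lemma L2_norm_sq_loc_op_multiple_window:
  assumes \<phi>: "\<phi> \<in> L2" and ae: "AE t in lborel. \<phi> t = c * gauss0 t"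
    and f: "f \<in> L2" and m: "integrable lborel m"
  shows "L2_norm_sq (loc_op m \<phi> f) = ennreal ((norm c) ^ 4) * L2_norm_sq (loc_op m gauss0 f)"
proof -
  note [measurable] = L2D(1)[OF f]
  have mm[measurable]: "m \<in> borel_measurable borel" using m by auto
  have eq: "loc_op m \<phi> f t = of_real ((norm c)\<^sup>2) * loc_op m gauss0 f t" for t
    by (rule loc_op_multiple_window[OF \<phi> ae L2D(1)[OF f] mm])
  have i: "integrable lborel (\<lambda>z. stft gauss0 f z * of_real (m z))" by (rule integrable_stft_mult[OF f m])
  have [measurable]: "loc_op m gauss0 f \<in> borel_measurable borel"
    unfolding loc_op_gauss0 by (rule L2D(1)[OF synthesis_L2[OF i]])
  show ?thesis
    unfolding L2_norm_sq_def eq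
    by (simp add: norm_mult norm_power power_mult_distrib ennreal_mult nn_integral_cmult flip: power_mult)
qed

section \<open>Sums of decaying functions over separated sets\<close>

text \<open>Since (1 + |x|)^2 \<le> 2 (1 + x^2), the integrand is at most 2^a (1 + |x|)^(- 2 a);
  this power has an explicit antiderivative tending to 0 at infinity because 2 a > 1.\<close>

lemma integrable_inverse_power_line:
  fixes a :: real
  assumes a: "a > 1/2"
  shows "integrable lborel (\<lambda>x::real. (1 + x\<^sup>2) powr (- a))"
proof -
  define p where "p = 2 * a"
  have p: "p > 1" using a by (simp add: p_def)
  let ?g = "\<lambda>x::real. ennreal ((1 + x) powr (- p)) * indicator {0..} x"
  have "(\<integral>\<^sup>+x. ennreal ((1 + x) powr (- p)) * indicator {0..} x \<partial>lborel) = 0 - (- ((1 + 0) powr (1 - p) / (p - 1)))"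
  proof (rule nn_integral_FTC_atLeast)
    show "((\<lambda>x. - ((1 + x) powr (1 - p) / (p - 1))) has_real_derivative (1 + x) powr (- p)) (at x)" if "0 \<le> x" for x
    proof -
      have "((\<lambda>x. (1 + x) powr (1 - p)) has_real_derivative (1 - p) * (1 + x) powr (1 - p - of_nat 1) * 1) (at x)"
        using that by (intro DERIV_fun_powr) (auto intro!: derivative_eq_intros)
      moreover have "- ((1 - p) * (1 + x) powr (1 - p - of_nat 1) * 1 / (p - 1)) = (1 + x) powr (- p)"
        using p by (simp add: divide_simps) (simp add: algebra_simps)
      ultimately show ?thesis
        using DERIV_cong[OF DERIV_minus[OF DERIV_cdivide]] by blast
    qed
    have "((\<lambda>x. - ((1 + x) powr (1 - p) / (p - 1))) \<longlongrightarrow> - (0 / (p - 1))) at_top"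
      using p by (intro tendsto_intros tendsto_neg_powr filterlim_tendsto_add_at_top[OF tendsto_const] filterlim_ident) auto
    then show "((\<lambda>x. - ((1 + x) powr (1 - p) / (p - 1))) \<longlongrightarrow> 0) at_top" by simp
  qed auto
  then have fin: "(\<integral>\<^sup>+x. ?g x \<partial>lborel) < \<infinity>" by simp
  have refl: "(\<integral>\<^sup>+x. ?g (- x) \<partial>lborel) = (\<integral>\<^sup>+x. ?g x \<partial>lborel)"
    using nn_integral_real_affine[of ?g "-1" 0] by simp
  have pt: "ennreal ((1 + x\<^sup>2) powr (- a)) \<le> ennreal (2 powr a) * (?g x + ?g (- x))" for x
  proof -
    have "(1 + \<bar>x\<bar>)\<^sup>2 / 2 \<le> 1 + x\<^sup>2"
      using sum_squares_bound[of 1 "\<bar>x\<bar>"] by (simp add: power2_sum)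
    moreover have "(1 + \<bar>x\<bar>)\<^sup>2 / 2 > 0" by (simp add: add_pos_nonneg)
    ultimately have "(1 + x\<^sup>2) powr (- a) \<le> ((1 + \<bar>x\<bar>)\<^sup>2 / 2) powr (- a)"
      using a by (intro powr_mono2') auto
    also have "\<dots> = 2 powr a * (1 + \<bar>x\<bar>) powr (- p)"
    proof -
      have *: "(1 + \<bar>x\<bar>)\<^sup>2 = (1 + \<bar>x\<bar>) powr 2" by (subst powr_numeral) auto
      have "((1 + \<bar>x\<bar>)\<^sup>2) powr (- a) = (1 + \<bar>x\<bar>) powr (- p)"
        unfolding * powr_powr by (simp add: p_def)
      then show ?thesis by (simp add: powr_divide powr_minus_divide[of 2 a])
    qed
    finally have "ennreal ((1 + x\<^sup>2) powr (- a)) \<le> ennreal (2 powr a) * ennreal ((1 + \<bar>x\<bar>) powr (- p))"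
      by (simp add: ennreal_leI flip: ennreal_mult)
    also have "ennreal ((1 + \<bar>x\<bar>) powr (- p)) \<le> ?g x + ?g (- x)"
      by (cases "x \<ge> 0") (auto simp: abs_if)
    finally show ?thesis by (simp add: mult_left_mono)
  qed
  have "(\<integral>\<^sup>+x. ennreal ((1 + x\<^sup>2) powr (- a)) \<partial>lborel) \<le> (\<integral>\<^sup>+x. ennreal (2 powr a) * (?g x + ?g (- x)) \<partial>lborel)"
    by (intro nn_integral_mono pt)
  also have "\<dots> = ennreal (2 powr a) * ((\<integral>\<^sup>+x. ?g x \<partial>lborel) + (\<integral>\<^sup>+x. ?g (- x) \<partial>lborel))"
    by (subst nn_integral_cmult, measurable, subst nn_integral_add) auto
  also have "\<dots> < \<infinity>" using fin unfolding refl by (simp add: ennreal_mult_less_top)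
  finally show ?thesis by (intro integrableI_bounded) auto
qed

lemma norm_diff_sq_le:
  fixes x y :: "'a::real_normed_vector"
  shows "(norm (x - z))\<^sup>2 \<le> 2 * (norm (x - y))\<^sup>2 + 2 * (norm (y - z))\<^sup>2"
proof -
  have "(norm (x - z))\<^sup>2 \<le> (norm (x - y) + norm (y - z))\<^sup>2"
    by (intro power_mono norm_diff_triangle_ineq[of x y y z, simplified] norm_ge_zero)
  also have "\<dots> \<le> 2 * (norm (x - y))\<^sup>2 + 2 * (norm (y - z))\<^sup>2"
    using sum_squares_bound[of "norm (x - y)" "norm (y - z)"] unfolding power2_sum by linarith
  finally show ?thesis .
qed

definition decay :: "real \<Rightarrow> real \<times> real \<Rightarrow> real" where
  "decay s z = (1 + (norm z)\<^sup>2) powr (- s)"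

lemma decay_nonneg [simp]: "0 \<le> decay s z" by (simp add: decay_def)

lemma one_plus_norm_sq_pos: "0 < 1 + (norm z)\<^sup>2" "1 \<le> 1 + (norm z)\<^sup>2"
  by (simp_all add: add_pos_nonneg)

lemma decay_le_1: "0 \<le> s \<Longrightarrow> decay s z \<le> 1"
  unfolding decay_def using powr_mono[of "- s" 0 "1 + (norm z)\<^sup>2"] by (auto split: if_splits)

lemma borel_measurable_decay [measurable]: "decay s \<in> borel_measurable borel"
  unfolding decay_def[abs_def] by measurable

text \<open>From (1 + x^2) (1 + y^2) \<le> (1 + x^2 + y^2)^2 the function is dominated by a product
  of one-dimensional ones with exponent s / 2, and s > 1 becomes s / 2 > 1 / 2.\<close>

lemma integrable_decay:
  assumes s: "s > 1"
  shows "integrable lborel (decay s)"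
proof -
  let ?h = "\<lambda>x::real. (1 + x\<^sup>2) powr (- (s / 2))"
  have h: "integrable lborel ?h" using s by (intro integrable_inverse_power_line) auto
  have "integrable (lborel \<Otimes>\<^sub>M lborel) (\<lambda>(x, y). ?h x * ?h y)"
  proof (rule lborel_pair.Fubini_integrable)
    show "integrable lborel (\<lambda>x. LINT y|lborel. norm (case (x, y) of (x, y) \<Rightarrow> ?h x * ?h y))"
      using h by (simp add: abs_mult)
    show "AE x in lborel. integrable lborel (\<lambda>y. case (x, y) of (x, y) \<Rightarrow> ?h x * ?h y)"
      unfolding prod.case by (intro AE_I2 integrable_mult_right h)
  qed measurable
  then have i: "integrable lborel (\<lambda>z. ?h (fst z) * ?h (snd z))"
    by (simp add: split_beta' lborel_prod)
  show ?thesis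
  proof (rule Bochner_Integration.integrable_bound[OF i])
    have "decay s z \<le> ?h (fst z) * ?h (snd z)" for z
    proof -
      obtain x y where z: "z = (x, y)" by fastforce
      have "(1 + x\<^sup>2) * (1 + y\<^sup>2) \<le> (1 + (x\<^sup>2 + y\<^sup>2))\<^sup>2"
      proof -
        have *: "(1 + X) * (1 + Y) \<le> (1 + (X + Y))\<^sup>2" if "0 \<le> X" "0 \<le> Y" for X Y :: real
          using that mult_nonneg_nonneg[OF that] by (simp add: power2_eq_square algebra_simps)
        show ?thesis by (rule *) auto
      qed
      then have "((1 + (x\<^sup>2 + y\<^sup>2))\<^sup>2) powr (- (s / 2)) \<le> ((1 + x\<^sup>2) * (1 + y\<^sup>2)) powr (- (s / 2))"
        using s by (intro powr_mono2') (auto simp: add_pos_nonneg)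
      moreover have "((1 + (x\<^sup>2 + y\<^sup>2))\<^sup>2) powr (- (s / 2)) = decay s z"
      proof -
        have *: "(1 + (x\<^sup>2 + y\<^sup>2))\<^sup>2 = (1 + (x\<^sup>2 + y\<^sup>2)) powr 2" by (subst powr_numeral) auto
        show ?thesis unfolding * powr_powr by (simp add: decay_def z norm_Pair)
      qed
      ultimately show ?thesis by (simp add: powr_mult z)
    qed
    then show "AE z in lborel. norm (decay s z) \<le> norm (?h (fst z) * ?h (snd z))"
      by (auto simp: abs_mult)
  qed measurable
qed

lemma nn_integral_plane_shift:
  fixes h :: "real \<times> real \<Rightarrow> ennreal"
  assumes [measurable]: "h \<in> borel_measurable borel"
  shows "(\<integral>\<^sup>+z. h (z - a) \<partial>lborel) = (\<integral>\<^sup>+z. h z \<partial>lborel)"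
proof -
  have "(\<integral>\<^sup>+z. h z \<partial>lborel) = (\<integral>\<^sup>+z. h z \<partial>(distr lborel borel ((+) (- a))))"
    by (simp only: lborel_distr_plus)
  also have "\<dots> = (\<integral>\<^sup>+z. h (- a + z) \<partial>lborel)"
    by (rule nn_integral_distr) auto
  finally show ?thesis by simp
qed

text \<open>Comparing a sum over a relatively separated set with the integral over unit balls around its points.\<close>

lemma separated_sum_decay_bounded:
  assumes s: "s > 1" and N: "\<And>z. finite (\<Gamma> \<inter> cball z 1) \<and> card (\<Gamma> \<inter> cball z 1) \<le> (N::nat)"
  obtains M where "M > 0" "\<And>X z. finite X \<Longrightarrow> X \<subseteq> \<Gamma> \<Longrightarrow> (\<Sum>\<gamma>\<in>X. decay s (z - \<gamma>)) \<le> M"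
proof -
  define J where "J = (LINT u|lborel. decay s u)"
  have J0: "J \<ge> 0" by (simp add: J_def)
  have J: "(\<integral>\<^sup>+u. ennreal (decay s u) \<partial>lborel) = ennreal J"
    unfolding J_def by (rule nn_integral_eq_integral[OF integrable_decay[OF s]]) auto
  define \<beta> where "\<beta> = unit_ball_vol (real DIM(real \<times> real))"
  have \<beta>: "\<beta> > 0" by (simp add: \<beta>_def)
  have ball: "emeasure lborel (ball \<gamma> 1) = ennreal \<beta>" for \<gamma> :: "real \<times> real"
    by (simp add: emeasure_ball \<beta>_def)
  \<comment> \<open>\<open>3 powr s\<close> compares the decay at the centre of a unit ball with
    that at its other points, N bounds the overlap of the balls, J is the full integral and \<beta>
    the area of a ball. The added 1 keeps M positive when N = 0.\<close>
  define M where "M = 3 powr s * real N * J / \<beta> + 1"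
  have "(\<Sum>\<gamma>\<in>X. decay s (z - \<gamma>)) \<le> M" if X: "finite X" "X \<subseteq> \<Gamma>" for X z
  proof -
    have pt: "decay s (z - \<gamma>) \<le> 3 powr s * decay s (u - z)" if u: "u \<in> ball \<gamma> 1" for \<gamma> u
    proof -
      have "norm (u - \<gamma>) \<le> 1" using u by (simp add: dist_norm norm_minus_commute)
      then have "(norm (\<gamma> - u))\<^sup>2 \<le> 1" by (simp add: norm_minus_commute power_le_one)
      then have uz: "(norm (u - z))\<^sup>2 \<le> 2 * (norm (z - \<gamma>))\<^sup>2 + 2"
        using norm_diff_sq_le[of z u \<gamma>] unfolding norm_minus_commute[of u z] by linarith
      have "(1 + (norm (u - z))\<^sup>2) / 3 \<le> 1 + (norm (z - \<gamma>))\<^sup>2"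
      proof -
        have *: "(1 + U) / 3 \<le> 1 + W" if "U \<le> 2 * W + 2" "0 \<le> W" for U W :: real
          using that by simp
        show ?thesis by (rule *) (use uz in auto)
      qed
      then have "(1 + (norm (z - \<gamma>))\<^sup>2) powr (- s) \<le> ((1 + (norm (u - z))\<^sup>2) / 3) powr (- s)"
        using s one_plus_norm_sq_pos(1)[of "u - z"] by (intro powr_mono2') auto
      also have "\<dots> = 3 powr s * (1 + (norm (u - z))\<^sup>2) powr (- s)"
        by (simp add: powr_divide powr_minus field_simps)
      finally show ?thesis by (simp add: decay_def)
    qed
    have cnt: "(\<Sum>\<gamma>\<in>X. indicator (ball \<gamma> 1) u :: ennreal) \<le> of_nat N" for u
    proof -
      have "(\<Sum>\<gamma>\<in>X. indicator (ball \<gamma> 1) u :: ennreal) = of_nat (card {\<gamma>\<in>X. u \<in> ball \<gamma> 1})"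
        using X(1) by (simp add: indicator_def sum.If_cases Int_def)
      also have "card {\<gamma>\<in>X. u \<in> ball \<gamma> 1} \<le> card (\<Gamma> \<inter> cball u 1)"
        using X N[of u] by (intro card_mono) (auto simp: dist_commute)
      also have "\<dots> \<le> N" using N by auto
      finally show ?thesis by simp
    qed
    have sc: "(\<integral>\<^sup>+u. ennreal d * indicator (ball \<gamma> 1) u \<partial>lborel) = ennreal \<beta> * ennreal d" for d and \<gamma> :: "real \<times> real"
      by (subst nn_integral_cmult_indicator) (auto simp: ball mult.commute)
    have "ennreal \<beta> * ennreal (\<Sum>\<gamma>\<in>X. decay s (z - \<gamma>)) = (\<Sum>\<gamma>\<in>X. \<integral>\<^sup>+u. ennreal (decay s (z - \<gamma>)) * indicator (ball \<gamma> 1) u \<partial>lborel)"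
      by (simp add: sc sum_distrib_left flip: sum_ennreal)
    also have "\<dots> \<le> (\<Sum>\<gamma>\<in>X. \<integral>\<^sup>+u. ennreal (3 powr s * decay s (u - z)) * indicator (ball \<gamma> 1) u \<partial>lborel)"
      by (intro sum_mono nn_integral_mono) (auto split: split_indicator intro!: ennreal_leI pt)
    also have "\<dots> = (\<integral>\<^sup>+u. ennreal (3 powr s * decay s (u - z)) * (\<Sum>\<gamma>\<in>X. indicator (ball \<gamma> 1) u) \<partial>lborel)"
    proof -
      have "(\<lambda>u. ennreal (3 powr s * decay s (u - z)) * indicator (ball \<gamma> 1) u) \<in> borel_measurable lborel" for \<gamma>
        by (intro borel_measurable_times_ennreal borel_measurable_indicator) (simp, simp)
      then have "(\<integral>\<^sup>+u. (\<Sum>\<gamma>\<in>X. ennreal (3 powr s * decay s (u - z)) * indicator (ball \<gamma> 1) u) \<partial>lborel)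
        = (\<Sum>\<gamma>\<in>X. \<integral>\<^sup>+u. ennreal (3 powr s * decay s (u - z)) * indicator (ball \<gamma> 1) u \<partial>lborel)"
        by (rule nn_integral_sum)
      then show ?thesis by (simp only: sum_distrib_left)
    qed
    also have "\<dots> \<le> (\<integral>\<^sup>+u. ennreal (3 powr s * decay s (u - z)) * of_nat N \<partial>lborel)"
      by (intro nn_integral_mono mult_left_mono cnt) auto
    also have "\<dots> = (\<integral>\<^sup>+u. ennreal (3 powr s * real N) * ennreal (decay s (u - z)) \<partial>lborel)"
      by (simp add: ennreal_mult ennreal_of_nat_eq_real_of_nat mult_ac)
    also have "\<dots> = ennreal (3 powr s * real N) * (\<integral>\<^sup>+u. ennreal (decay s (u - z)) \<partial>lborel)"
      by (rule nn_integral_cmult) measurable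
    also have "(\<integral>\<^sup>+u. ennreal (decay s (u - z)) \<partial>lborel) = ennreal J"
      using nn_integral_plane_shift[of "\<lambda>u. ennreal (decay s u)" z] J by simp
    finally have "ennreal (\<beta> * (\<Sum>\<gamma>\<in>X. decay s (z - \<gamma>))) \<le> ennreal (3 powr s * real N * J)"
      using \<beta> J0 by (simp add: ennreal_mult sum_nonneg)
    then have "\<beta> * (\<Sum>\<gamma>\<in>X. decay s (z - \<gamma>)) \<le> 3 powr s * real N * J"
      using J0 by (subst (asm) ennreal_le_iff) auto
    then have "(\<Sum>\<gamma>\<in>X. decay s (z - \<gamma>)) \<le> 3 powr s * real N * J / \<beta>"
      using \<beta> by (simp add: field_simps)
    then show ?thesis by (simp add: M_def)
  qed
  moreover have "M > 0" using \<beta> J0 by (simp add: M_def add_nonneg_pos)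
  ultimately show thesis using that by blast
qed

text \<open>In \<open>weighted_stft_loc_op\<close> it moves a weight centred at \<gamma> from z to
  w, at a cost depending on z - w alone. The general constant 2^d is at most 2 because d \<le>
  1.\<close>

lemma Peetre_inequality:
  fixes x y z :: "'a::real_normed_vector"
  assumes d: "0 \<le> d" "d \<le> 1"
  shows "(1 + (norm (x - z))\<^sup>2) powr d \<le> 2 * (1 + (norm (x - y))\<^sup>2) powr d * (1 + (norm (y - z))\<^sup>2) powr d"
proof -
  let ?a = "1 + (norm (x - y))\<^sup>2" and ?b = "1 + (norm (y - z))\<^sup>2"
  have "0 \<le> (norm (x - y))\<^sup>2 * (norm (y - z))\<^sup>2" by (intro mult_nonneg_nonneg) auto
  then have "1 + (norm (x - z))\<^sup>2 \<le> 2 * (?a * ?b)"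
    using norm_diff_sq_le[of x z y] unfolding distrib_left distrib_right by linarith
  then have "(1 + (norm (x - z))\<^sup>2) powr d \<le> (2 * (?a * ?b)) powr d"
    using d by (intro powr_mono2) auto
  also have "\<dots> = 2 powr d * (?a powr d * ?b powr d)" by (simp add: powr_mult)
  also have "\<dots> \<le> 2 * (?a powr d * ?b powr d)"
    using powr_mono[of d 1 "2::real"] d by (intro mult_right_mono) auto
  finally show ?thesis by (simp add: mult.assoc)
qed

section \<open>Localization operators with Gaussian window\<close>

text \<open>Schur's test: |F z| |F w| \<le> |F z|^2 + |F w|^2, and the kernel integrates to pi / q
  in either variable. The factor 2 counts the two squares.\<close>

lemma gaussian_Schur_bound:
  fixes F :: "real \<times> real \<Rightarrow> complex"
  assumes [measurable]: "F \<in> borel_measurable borel" and q: "q > 0"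
  shows "(\<integral>\<^sup>+z. \<integral>\<^sup>+w. ennreal (norm (F z) * norm (F w) * exp (- q * (norm (w - z))\<^sup>2)) \<partial>lborel \<partial>lborel)
    \<le> ennreal (2 * (pi / q)) * (\<integral>\<^sup>+z. ennreal ((norm (F z))\<^sup>2) \<partial>lborel)"
proof -
  let ?Q = "\<lambda>u::real \<times> real. ennreal (exp (- q * (norm u)\<^sup>2))"
  have J: "(\<integral>\<^sup>+u. ?Q u \<partial>lborel) = ennreal (pi / q)"
    using nn_integral_eq_integral[OF gaussian_integral_plane(1)[OF q]] gaussian_integral_plane(2)[OF q] by simp
  have J1: "(\<integral>\<^sup>+w. ?Q (w - z) \<partial>lborel) = ennreal (pi / q)" for z
    using nn_integral_plane_shift[of ?Q z] J by simp
  have J2: "(\<integral>\<^sup>+z. ?Q (w - z) \<partial>lborel) = ennreal (pi / q)" for w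
    using J1[of w] by (simp add: norm_minus_commute)
  let ?f = "\<lambda>z. ennreal ((norm (F z))\<^sup>2)"
  have "(\<integral>\<^sup>+z. \<integral>\<^sup>+w. ennreal (norm (F z) * norm (F w) * exp (- q * (norm (w - z))\<^sup>2)) \<partial>lborel \<partial>lborel)
     \<le> (\<integral>\<^sup>+z. \<integral>\<^sup>+w. ?f z * ?Q (w - z) + ?f w * ?Q (w - z) \<partial>lborel \<partial>lborel)"
  proof (intro nn_integral_mono)
    fix z w
    have "norm (F z) * norm (F w) * exp (- q * (norm (w - z))\<^sup>2) \<le> ((norm (F z))\<^sup>2 + (norm (F w))\<^sup>2) * exp (- q * (norm (w - z))\<^sup>2)"
      by (intro mult_right_mono mult_le_sum_power2) auto
    then have "ennreal (norm (F z) * norm (F w) * exp (- q * (norm (w - z))\<^sup>2)) \<le> ennreal (((norm (F z))\<^sup>2 + (norm (F w))\<^sup>2) * exp (- q * (norm (w - z))\<^sup>2))"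
      by (rule ennreal_leI)
    also have "\<dots> = ?f z * ?Q (w - z) + ?f w * ?Q (w - z)"
      unfolding distrib_right by (subst ennreal_plus) (auto simp: ennreal_mult')
    finally show "ennreal (norm (F z) * norm (F w) * exp (- q * (norm (w - z))\<^sup>2)) \<le> ?f z * ?Q (w - z) + ?f w * ?Q (w - z)" .
  qed
  also have "\<dots> = (\<integral>\<^sup>+z. \<integral>\<^sup>+w. ?f z * ?Q (w - z) \<partial>lborel \<partial>lborel) + (\<integral>\<^sup>+z. \<integral>\<^sup>+w. ?f w * ?Q (w - z) \<partial>lborel \<partial>lborel)"
    by (subst nn_integral_add[symmetric]; (intro nn_integral_cong nn_integral_add)?; measurable)
  also have "(\<integral>\<^sup>+z. \<integral>\<^sup>+w. ?f w * ?Q (w - z) \<partial>lborel \<partial>lborel) = (\<integral>\<^sup>+w. \<integral>\<^sup>+z. ?f w * ?Q (w - z) \<partial>lborel \<partial>lborel)"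
    by (rule lborel_pair.Fubini') measurable
  also have "(\<integral>\<^sup>+w. \<integral>\<^sup>+z. ?f w * ?Q (w - z) \<partial>lborel \<partial>lborel) = (\<integral>\<^sup>+w. ?f w \<partial>lborel) * ennreal (pi / q)"
    by (subst nn_integral_cmult, measurable, simp only: J2, rule nn_integral_multc, measurable)
  also have "(\<integral>\<^sup>+z. \<integral>\<^sup>+w. ?f z * ?Q (w - z) \<partial>lborel \<partial>lborel) = (\<integral>\<^sup>+z. ?f z \<partial>lborel) * ennreal (pi / q)"
    by (subst nn_integral_cmult, measurable, simp only: J1, rule nn_integral_multc, measurable)
  also have "(\<integral>\<^sup>+z. ?f z \<partial>lborel) * ennreal (pi / q) + (\<integral>\<^sup>+z. ?f z \<partial>lborel) * ennreal (pi / q)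
      = ennreal (2 * (pi / q)) * (\<integral>\<^sup>+z. ?f z \<partial>lborel)"
  proof -
    have "ennreal (2 * (pi / q)) = ennreal (pi / q) + ennreal (pi / q)"
      using q unfolding mult_2 by (intro ennreal_plus) auto
    then show ?thesis by (simp only: distrib_right) (simp only: mult.commute)
  qed
  finally show ?thesis .
qed

lemma localized_integrable:
  assumes f: "f \<in> L2" and m: "integrable lborel m" and B: "\<And>z. \<bar>m z\<bar> \<le> (B::real)"
  shows "integrable lborel (\<lambda>z. stft gauss0 f z * of_real (m z))"
    and "integrable lborel (\<lambda>z. (norm (stft gauss0 f z * of_real (m z)))\<^sup>2)"
proof -
  note [measurable] = L2D(1)[OF f]
  have [measurable]: "m \<in> borel_measurable borel" using m by auto
  show "integrable lborel (\<lambda>z. stft gauss0 f z * of_real (m z))" by (rule integrable_stft_mult[OF f m])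
  show "integrable lborel (\<lambda>z. (norm (stft gauss0 f z * of_real (m z)))\<^sup>2)"
  proof (rule Bochner_Integration.integrable_bound)
    show "integrable lborel (\<lambda>z. B\<^sup>2 * (norm (stft gauss0 f z))\<^sup>2)" using stft_norm(1)[OF f] by simp
    have "(norm (stft gauss0 f z * of_real (m z)))\<^sup>2 \<le> B\<^sup>2 * (norm (stft gauss0 f z))\<^sup>2" for z
    proof -
      have "\<bar>m z\<bar>\<^sup>2 \<le> B\<^sup>2" by (intro power_mono B) auto
      then have "(norm (stft gauss0 f z))\<^sup>2 * (m z)\<^sup>2 \<le> (norm (stft gauss0 f z))\<^sup>2 * B\<^sup>2" by (intro mult_left_mono) auto
      then show ?thesis by (simp add: norm_mult power_mult_distrib mult.commute)
    qed
    then show "AE z in lborel. norm ((norm (stft gauss0 f z * of_real (m z)))\<^sup>2) \<le> norm (B\<^sup>2 * (norm (stft gauss0 f z))\<^sup>2)"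
      by auto
  qed measurable
qed

text \<open>The quadratic form integrates the symbol against the nonnegative density |V f|^2. Being
  linear in the symbol, it is the place where the sum of the symbols enters the lower bound.\<close>

lemma Re_L2_inner_loc_op:
  assumes f: "f \<in> L2" and G: "integrable lborel (\<lambda>z. stft gauss0 f z * of_real (m z))"
  shows "Re (L2_inner (loc_op m gauss0 f) f) = (LINT z|lborel. m z * (norm (stft gauss0 f z))\<^sup>2)"
proof -
  have "L2_inner (loc_op m gauss0 f) f = (LINT z|lborel. stft gauss0 f z * of_real (m z) * cnj (stft gauss0 f z))"
    unfolding loc_op_gauss0 by (rule synthesis_inner[OF G f])
  also have "\<dots> = (LINT z|lborel. of_real (m z * (norm (stft gauss0 f z))\<^sup>2))"
    by (intro Bochner_Integration.integral_cong refl) (simp only: of_real_mult complex_norm_square mult_ac)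
  also have "\<dots> = of_real (LINT z|lborel. m z * (norm (stft gauss0 f z))\<^sup>2)"
    by (rule integral_complex_of_real)
  finally show ?thesis by simp
qed

section \<open>Families of symbols with uniform decay around a separated set\<close>

locale spread_symbols =
  fixes \<Gamma> :: "(real \<times> real) set" and \<eta> :: "real \<times> real \<Rightarrow> real \<times> real \<Rightarrow> real" and s K :: real and N :: nat
  assumes s: "s > 1" and K: "K > 0"
    and separated: "\<And>z. finite (\<Gamma> \<inter> cball z 1) \<and> card (\<Gamma> \<inter> cball z 1) \<le> N"
    and symbol_integrable: "\<And>\<gamma>. \<gamma> \<in> \<Gamma> \<Longrightarrow> integrable lborel (\<eta> \<gamma>)"
    and symbol_bound: "\<And>\<gamma> \<xi>. \<gamma> \<in> \<Gamma> \<Longrightarrow> \<bar>\<eta> \<gamma> \<xi>\<bar> \<le> K * decay s (\<xi> - \<gamma>)"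
begin

lemma symbol_bounded: "\<gamma> \<in> \<Gamma> \<Longrightarrow> \<bar>\<eta> \<gamma> \<xi>\<bar> \<le> K"
  using order_trans[OF symbol_bound mult_left_mono[OF decay_le_1, of s K]] s K by simp

lemma symbol_measurable: "\<gamma> \<in> \<Gamma> \<Longrightarrow> \<eta> \<gamma> \<in> borel_measurable borel"
  using symbol_integrable by fastforce

lemmas localized = localized_integrable[OF _ symbol_integrable symbol_bounded]

lemma loc_op_L2:
  assumes f: "f \<in> L2" and \<gamma>: "\<gamma> \<in> \<Gamma>"
  shows "loc_op (\<eta> \<gamma>) gauss0 f \<in> L2"
  unfolding loc_op_gauss0 by (rule synthesis_L2[OF localized(1)[OF f \<gamma> \<gamma>]])

text \<open>As \<open>decay s\<close> is at most 1, the squared symbols sum to at most K^2 M at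
  every point, and each output norm is bounded by the norm of symbol times transform. Finite X are
  enough because the final sum is the supremum of its finite partial sums.\<close>

lemma upper_bound:
  obtains B where "B > 0" "\<And>f X. f \<in> L2 \<Longrightarrow> finite X \<Longrightarrow> X \<subseteq> \<Gamma> \<Longrightarrow>
    (\<Sum>\<gamma>\<in>X. LINT t|lborel. (norm (loc_op (\<eta> \<gamma>) gauss0 f t))\<^sup>2) \<le> B * (LINT t|lborel. (norm (f t))\<^sup>2)"
proof -
  obtain M where M: "M > 0" "\<And>X z. finite X \<Longrightarrow> X \<subseteq> \<Gamma> \<Longrightarrow> (\<Sum>\<gamma>\<in>X. decay s (z - \<gamma>)) \<le> M"
    using separated_sum_decay_bounded[OF s separated] by blast
  show thesis
  proof (rule that)
    show "K\<^sup>2 * M > 0" using K M by simp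
    fix f X assume f: "f \<in> L2" and X: "finite X" "X \<subseteq> \<Gamma>"
    note [measurable] = L2D(1)[OF f]
    let ?F = "stft gauss0 f"
    have pt: "(\<Sum>\<gamma>\<in>X. (norm (?F z * of_real (\<eta> \<gamma> z)))\<^sup>2) \<le> (K\<^sup>2 * M) * (norm (?F z))\<^sup>2" for z
    proof -
      have "(\<Sum>\<gamma>\<in>X. (\<eta> \<gamma> z)\<^sup>2) \<le> (\<Sum>\<gamma>\<in>X. K\<^sup>2 * decay s (z - \<gamma>))"
      proof (rule sum_mono)
        fix \<gamma> assume "\<gamma> \<in> X"
        then have \<gamma>: "\<gamma> \<in> \<Gamma>" using X by auto
        have "(\<eta> \<gamma> z)\<^sup>2 \<le> (K * decay s (z - \<gamma>))\<^sup>2"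
          using symbol_bound[OF \<gamma>, of z] by (rule abs_le_square_iff[THEN iffD1, OF order_trans[OF _ abs_ge_self]])
        also have "\<dots> = K\<^sup>2 * (decay s (z - \<gamma>))\<^sup>2" by (rule power_mult_distrib)
        also have "\<dots> \<le> K\<^sup>2 * decay s (z - \<gamma>)"
          using decay_le_1[of s "z - \<gamma>"] s by (intro mult_left_mono) (auto simp: power2_eq_square mult_left_le_one_le)
        finally show "(\<eta> \<gamma> z)\<^sup>2 \<le> K\<^sup>2 * decay s (z - \<gamma>)" .
      qed
      also have "\<dots> \<le> K\<^sup>2 * M"
        unfolding sum_distrib_left[symmetric] by (intro mult_left_mono M(2) X) auto
      finally have "(norm (?F z))\<^sup>2 * (\<Sum>\<gamma>\<in>X. (\<eta> \<gamma> z)\<^sup>2) \<le> (norm (?F z))\<^sup>2 * (K\<^sup>2 * M)"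
        by (intro mult_left_mono) auto
      then show ?thesis by (simp add: norm_mult power_mult_distrib sum_distrib_left mult.commute)
    qed
    have i: "integrable lborel (\<lambda>z. (norm (?F z * of_real (\<eta> \<gamma> z)))\<^sup>2)" if "\<gamma> \<in> X" for \<gamma>
      using localized(2)[OF f] X that by blast
    have "(\<Sum>\<gamma>\<in>X. LINT t|lborel. (norm (loc_op (\<eta> \<gamma>) gauss0 f t))\<^sup>2) \<le> (\<Sum>\<gamma>\<in>X. LINT z|lborel. (norm (?F z * of_real (\<eta> \<gamma> z)))\<^sup>2)"
      unfolding loc_op_gauss0 using X by (intro sum_mono synthesis_norm_le localized f) auto
    also have "\<dots> = (LINT z|lborel. (\<Sum>\<gamma>\<in>X. (norm (?F z * of_real (\<eta> \<gamma> z)))\<^sup>2))"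
      by (rule Bochner_Integration.integral_sum[symmetric]) (rule i)
    also have "\<dots> \<le> (LINT z|lborel. (K\<^sup>2 * M) * (norm (?F z))\<^sup>2)"
      by (intro integral_mono Bochner_Integration.integrable_sum i pt integrable_mult_right stft_norm(1) f)
    also have "\<dots> = (K\<^sup>2 * M) * (LINT t|lborel. (norm (f t))\<^sup>2)"
      by (simp only: integral_mult_right_zero stft_norm(2)[OF f])
    finally show "(\<Sum>\<gamma>\<in>X. LINT t|lborel. (norm (loc_op (\<eta> \<gamma>) gauss0 f t))\<^sup>2) \<le> K\<^sup>2 * M * (LINT t|lborel. (norm (f t))\<^sup>2)" .
  qed
qed

text \<open>V H f inherits the decay of the symbol around \<gamma>. Peetre's inequality splits the
  weight at z: the part in w - \<gamma> is taken from the symbol and lowers its exponent to s - d;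
  the part in z - w is absorbed by the kernel, as (1 + r^2)^d \<le> exp (r^2) for d \<le> 1 leaves
  the positive Gaussian rate pi / 2 - 1.\<close>

lemma weighted_stft_loc_op:
  assumes f: "f \<in> L2" and \<gamma>: "\<gamma> \<in> \<Gamma>" and d: "0 \<le> d" "d \<le> 1"
  shows "ennreal ((1 + (norm (z - \<gamma>))\<^sup>2) powr d * norm (stft gauss0 (loc_op (\<eta> \<gamma>) gauss0 f) z))
    \<le> (\<integral>\<^sup>+w. ennreal (2 * K * (norm (stft gauss0 f w) * decay (s - d) (w - \<gamma>) * exp (- (pi / 2 - 1) * (norm (w - z))\<^sup>2))) \<partial>lborel)"
proof -
  note [measurable] = L2D(1)[OF f] symbol_measurable[OF \<gamma>]
  let ?F = "stft gauss0 f" and ?c = "(1 + (norm (z - \<gamma>))\<^sup>2) powr d"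
  let ?G = "\<lambda>w. ?F w * of_real (\<eta> \<gamma> w)"
  let ?E = "\<lambda>w. exp (- (pi / 2) * (norm (w - z))\<^sup>2)"
  have G: "integrable lborel ?G" by (rule localized(1)[OF f \<gamma> \<gamma>])
  have GE: "integrable lborel (\<lambda>w. norm (?G w) * ?E w)"
  proof (rule Bochner_Integration.integrable_bound[OF integrable_norm[OF G]])
    show "AE w in lborel. norm (norm (?G w) * ?E w) \<le> norm (norm (?G w))"
      by (auto simp: abs_mult intro!: mult_right_le_one_le)
  qed measurable
  have "?c * norm (stft gauss0 (loc_op (\<eta> \<gamma>) gauss0 f) z) \<le> ?c * (LINT w|lborel. norm (?G w) * ?E w)"
    unfolding loc_op_gauss0 by (intro mult_left_mono norm_stft_synthesis_le G) auto
  then have "ennreal (?c * norm (stft gauss0 (loc_op (\<eta> \<gamma>) gauss0 f) z)) \<le> ennreal (?c * (LINT w|lborel. norm (?G w) * ?E w))"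
    by (rule ennreal_leI)
  also have "\<dots> = ennreal (LINT w|lborel. ?c * (norm (?G w) * ?E w))" by simp
  also have "\<dots> = (\<integral>\<^sup>+w. ennreal (?c * (norm (?G w) * ?E w)) \<partial>lborel)"
    by (rule nn_integral_eq_integral[symmetric]) (use GE in auto)
  also have "\<dots> \<le> (\<integral>\<^sup>+w. ennreal (2 * K * (norm (?F w) * decay (s - d) (w - \<gamma>) * exp (- (pi / 2 - 1) * (norm (w - z))\<^sup>2))) \<partial>lborel)"
  proof (intro nn_integral_mono ennreal_leI)
    fix w
    let ?a = "1 + (norm (z - w))\<^sup>2" and ?b = "1 + (norm (w - \<gamma>))\<^sup>2"
    have b: "decay s (w - \<gamma>) * ?b powr d = decay (s - d) (w - \<gamma>)"
      by (simp add: decay_def flip: powr_add)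
    have a: "?a powr d * ?E w \<le> exp (- (pi / 2 - 1) * (norm (w - z))\<^sup>2)"
    proof -
      have "?a powr d \<le> ?a powr 1" using d by (intro powr_mono) auto
      also have "\<dots> \<le> exp ((norm (w - z))\<^sup>2)"
        using exp_ge_add_one_self[of "(norm (w - z))\<^sup>2"] one_plus_norm_sq_pos(1)[of "z - w"] by (simp add: norm_minus_commute)
      finally have "?a powr d * ?E w \<le> exp ((norm (w - z))\<^sup>2) * ?E w" by (intro mult_right_mono) auto
      also have "\<dots> = exp (- (pi / 2 - 1) * (norm (w - z))\<^sup>2)"
        unfolding exp_add[symmetric] by (rule arg_cong[of _ _ exp]) (simp add: algebra_simps)
      finally show ?thesis .
    qed
    have "?c * (norm (?G w) * ?E w) \<le> (2 * ?a powr d * ?b powr d) * (norm (?F w) * (K * decay s (w - \<gamma>)) * ?E w)"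
      using symbol_bound[OF \<gamma>, of w] K Peetre_inequality[OF d, of z \<gamma> w]
      by (intro mult_mono) (auto simp: norm_mult intro!: mult_left_mono)
    also have "\<dots> = 2 * K * (norm (?F w) * decay (s - d) (w - \<gamma>) * (?a powr d * ?E w))"
      unfolding b[symmetric] by (simp only: mult_ac)
    also have "\<dots> \<le> 2 * K * (norm (?F w) * decay (s - d) (w - \<gamma>) * exp (- (pi / 2 - 1) * (norm (w - z))\<^sup>2))"
      using K by (intro mult_left_mono a) auto
    finally show "?c * (norm (?G w) * ?E w) \<le> 2 * K * (norm (?F w) * decay (s - d) (w - \<gamma>) * exp (- (pi / 2 - 1) * (norm (w - z))\<^sup>2))" .
  qed
  finally show ?thesis .
qed

text \<open>The product |V H f| |V f| is bounded pointwise by the operator energy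
  \<open>?t1\<close>, the loss \<open>?t2\<close> inside the disc and the tail \<open>?t3\<close>
  outside it. After summation the two losses take A / 4 each, so half of A survives; \<kappa>
  depends on neither f nor X.\<close>

lemma lower_bound_finite:
  assumes A: "A > 0"
  obtains \<kappa> where "\<kappa> > 0" "\<And>f X. f \<in> L2 \<Longrightarrow> finite X \<Longrightarrow> X \<subseteq> \<Gamma> \<Longrightarrow>
    (\<Sum>\<gamma>\<in>X. LINT z|lborel. \<eta> \<gamma> z * (norm (stft gauss0 f z))\<^sup>2)
      \<le> \<kappa> * (\<Sum>\<gamma>\<in>X. LINT t|lborel. (norm (loc_op (\<eta> \<gamma>) gauss0 f t))\<^sup>2) + A / 2 * (LINT t|lborel. (norm (f t))\<^sup>2)"
proof -
  \<comment> \<open>Half of the excess of s over 1 is spent, so \<open>decay (s - d)\<close> still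
    has bounded sums; the cap 1 is what Peetre's inequality and the absorption by the Gaussian
    allow.\<close>
  define d where "d = min ((s - 1) / 2) 1"
  have d: "0 < d" "d \<le> 1" "s - d > 1" using s by (auto simp: d_def min_def field_simps)
  obtain M where M: "M > 0" "\<And>X z. finite X \<Longrightarrow> X \<subseteq> \<Gamma> \<Longrightarrow> (\<Sum>\<gamma>\<in>X. decay s (z - \<gamma>)) \<le> M"
    using separated_sum_decay_bounded[OF s separated] by blast
  obtain M' where M': "M' > 0" "\<And>X z. finite X \<Longrightarrow> X \<subseteq> \<Gamma> \<Longrightarrow> (\<Sum>\<gamma>\<in>X. decay (s - d) (z - \<gamma>)) \<le> M'"
    using separated_sum_decay_bounded[OF d(3) separated] by blast
  define q where "q = pi / 2 - 1"
  have q: "q > 0" using pi_gt3 by (simp add: q_def)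
  define J where "J = 2 * (pi / q)"
  have J: "J > 0" using q by (simp add: J_def)
  \<comment> \<open>Solves 2 K e M' J = A / 4, the share granted to the tail; M' comes from the sum
    over \<gamma> and J from Schur's test.\<close>
  define e where "e = A / (8 * K * M' * J)"
  have e: "e > 0" using A K M' J by (simp add: e_def)
  \<comment> \<open>Y is the threshold for 1 + |z - \<gamma>|^2 that delimits the disc, large enough
    for Y^(- d) \<le> e.\<close>
  define Y where "Y = max 1 (e powr (- 1 / d))"
  have Y1: "Y \<ge> 1" by (simp add: Y_def)
  have Ye: "Y powr (- d) \<le> e"
  proof -
    have "Y powr (- d) \<le> (e powr (- 1 / d)) powr (- d)"
      using d e by (intro powr_mono2') (auto simp: Y_def)
    also have "\<dots> = e" using d e by (simp add: powr_powr)
    finally show ?thesis .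
  qed
  \<comment> \<open>Makes 1 / (4 \<kappa>) equal to A / (4 M) times Y^(- s), which on the disc is at
    most A / (4 M) times \<open>decay s (z - \<gamma>)\<close>. The sum over \<gamma> then
    contributes the factor M that cancels.\<close>
  define \<kappa> where "\<kappa> = Y powr s * M / A"
  have \<kappa>: "\<kappa> > 0" using Y1 M A by (simp add: \<kappa>_def)
  define c3 where "c3 = Y powr (- d) * (2 * K)"
  have c3: "c3 \<ge> 0" "c3 * M' * J \<le> A / 4"
  proof -
    show "c3 \<ge> 0" using K by (simp add: c3_def)
    have "Y powr (- d) * (2 * K * M' * J) \<le> e * (2 * K * M' * J)"
      using Ye K M' J by (intro mult_right_mono) auto
    also have "\<dots> = A / 4" using K M' J by (simp add: e_def)
    finally show "c3 * M' * J \<le> A / 4" by (simp add: c3_def mult_ac)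
  qed
  have main: "(\<Sum>\<gamma>\<in>X. LINT z|lborel. \<eta> \<gamma> z * (norm (stft gauss0 f z))\<^sup>2)
      \<le> \<kappa> * (\<Sum>\<gamma>\<in>X. LINT t|lborel. (norm (loc_op (\<eta> \<gamma>) gauss0 f t))\<^sup>2) + A / 2 * (LINT t|lborel. (norm (f t))\<^sup>2)"
    if f: "f \<in> L2" and X: "finite X" "X \<subseteq> \<Gamma>" for f X
  proof -
    note [measurable] = L2D(1)[OF f]
    define S where "S = (LINT t|lborel. (norm (f t))\<^sup>2)"
    define F where "F = stft gauss0 f"
    define H where "H \<gamma> = loc_op (\<eta> \<gamma>) gauss0 f" for \<gamma>
    define U where "U \<gamma> = stft gauss0 (H \<gamma>)" for \<gamma>
    have S0: "S \<ge> 0" by (simp add: S_def)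
    have [measurable]: "F \<in> borel_measurable borel" unfolding F_def by measurable
    have F2: "integrable lborel (\<lambda>z. (norm (F z))\<^sup>2)" "(LINT z|lborel. (norm (F z))\<^sup>2) = S"
      unfolding F_def S_def using stft_norm[OF f] by auto
    have F2n: "(\<integral>\<^sup>+z. ennreal ((norm (F z))\<^sup>2) \<partial>lborel) = ennreal S"
      using nn_integral_eq_integral[OF F2(1)] F2(2) by simp
    have H: "H \<gamma> \<in> L2" if "\<gamma> \<in> X" for \<gamma>
      unfolding H_def using loc_op_L2[OF f, of \<gamma>] X that by blast
    have U_meas: "U \<gamma> \<in> borel_measurable borel" if "\<gamma> \<in> X" for \<gamma>
      unfolding U_def by (intro borel_measurable_stft borel_measurable_gauss0 L2D(1)[OF H[OF that]])
    have UF: "integrable lborel (\<lambda>z. U \<gamma> z * cnj (F z))" if "\<gamma> \<in> X" for \<gamma>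
      using U_meas[OF that] F2(1) stft_norm(1)[OF H[OF that]]
      by (intro integrable_mult_of_squares) (auto simp: U_def)
    have UFn: "integrable lborel (\<lambda>z. norm (U \<gamma> z) * norm (F z))" if "\<gamma> \<in> X" for \<gamma>
      using integrable_norm[OF UF[OF that]] by (simp add: norm_mult)
    have le1: "(LINT z|lborel. \<eta> \<gamma> z * (norm (F z))\<^sup>2) \<le> (LINT z|lborel. norm (U \<gamma> z) * norm (F z))" if "\<gamma> \<in> X" for \<gamma>
    proof -
      have \<gamma>: "\<gamma> \<in> \<Gamma>" using that X by auto
      have "(LINT z|lborel. \<eta> \<gamma> z * (norm (F z))\<^sup>2) = Re (L2_inner (H \<gamma>) f)"
        unfolding F_def H_def by (rule Re_L2_inner_loc_op[OF f localized(1)[OF f \<gamma> \<gamma>], symmetric])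
      also have "\<dots> = Re (LINT z|lborel. U \<gamma> z * cnj (F z))"
        unfolding U_def F_def by (rule stft_inner_Re[OF H[OF that] f, symmetric])
      also have "\<dots> \<le> norm (LINT z|lborel. U \<gamma> z * cnj (F z))" by (rule complex_Re_le_cmod)
      also have "\<dots> \<le> (LINT z|lborel. norm (U \<gamma> z * cnj (F z)))" by (rule integral_norm_bound)
      finally show ?thesis by (simp add: norm_mult)
    qed
    let ?t1 = "\<lambda>\<gamma> z. ennreal (\<kappa> * (norm (U \<gamma> z))\<^sup>2)"
    let ?t2 = "\<lambda>\<gamma> z. ennreal (A / (4 * M) * (norm (F z))\<^sup>2 * decay s (z - \<gamma>))"
    let ?k = "\<lambda>z w. c3 * (norm (F z) * norm (F w) * exp (- q * (norm (w - z))\<^sup>2))"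
    let ?t3 = "\<lambda>\<gamma> z. \<integral>\<^sup>+w. ennreal (?k z w * decay (s - d) (w - \<gamma>)) \<partial>lborel"
    have pt: "ennreal (norm (U \<gamma> z) * norm (F z)) \<le> ?t1 \<gamma> z + (?t2 \<gamma> z + ?t3 \<gamma> z)" if "\<gamma> \<in> X" for \<gamma> z
    proof (cases "1 + (norm (z - \<gamma>))\<^sup>2 \<le> Y")
      case True
      have "0 \<le> (2 * \<kappa> * norm (U \<gamma> z) - norm (F z))\<^sup>2" by simp
      then have "4 * \<kappa> * (norm (U \<gamma> z) * norm (F z)) \<le> 4 * \<kappa>\<^sup>2 * (norm (U \<gamma> z))\<^sup>2 + (norm (F z))\<^sup>2"
        by (simp add: power2_eq_square algebra_simps)
      then have "norm (U \<gamma> z) * norm (F z) \<le> \<kappa> * (norm (U \<gamma> z))\<^sup>2 + (norm (F z))\<^sup>2 * (1 / (4 * \<kappa>))"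
        using \<kappa> by (simp add: field_simps power2_eq_square)
      moreover have "1 / (4 * \<kappa>) \<le> A / (4 * M) * decay s (z - \<gamma>)"
      proof -
        have "1 / (4 * \<kappa>) = A / (4 * M) * Y powr (- s)"
        using Y1 A M by (simp add: \<kappa>_def powr_minus field_simps)
        also have "\<dots> \<le> A / (4 * M) * decay s (z - \<gamma>)"
        unfolding decay_def using True A M s one_plus_norm_sq_pos(1)[of "z - \<gamma>"] by (intro mult_left_mono powr_mono2') auto
        finally show ?thesis .
      qed
      then have "(norm (F z))\<^sup>2 * (1 / (4 * \<kappa>)) \<le> (norm (F z))\<^sup>2 * (A / (4 * M) * decay s (z - \<gamma>))"
        by (intro mult_left_mono) auto
      moreover have "(norm (F z))\<^sup>2 * (A / (4 * M) * decay s (z - \<gamma>)) = A / (4 * M) * (norm (F z))\<^sup>2 * decay s (z - \<gamma>)"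
        by simp
      ultimately have "norm (U \<gamma> z) * norm (F z) \<le> \<kappa> * (norm (U \<gamma> z))\<^sup>2 + A / (4 * M) * (norm (F z))\<^sup>2 * decay s (z - \<gamma>)"
        by linarith
      then have "ennreal (norm (U \<gamma> z) * norm (F z)) \<le> ennreal (\<kappa> * (norm (U \<gamma> z))\<^sup>2 + A / (4 * M) * (norm (F z))\<^sup>2 * decay s (z - \<gamma>))"
        by (rule ennreal_leI)
      also have "\<dots> = ?t1 \<gamma> z + ?t2 \<gamma> z" using \<kappa> A M by (intro ennreal_plus) auto
      also have "\<dots> \<le> ?t1 \<gamma> z + (?t2 \<gamma> z + ?t3 \<gamma> z)" by (intro add_left_mono) simp
      finally show ?thesis .
    next
      case False
      have \<gamma>: "\<gamma> \<in> \<Gamma>" using that X by auto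
      let ?c = "(1 + (norm (z - \<gamma>))\<^sup>2) powr d"
      \<comment> \<open>Off the disc the factor 1 is replaced by Y^(- d) times the weight; the
        weighted estimate absorbs the weight and leaves the small number Y^(- d) in c3.\<close>
      have "1 = Y powr (- d) * Y powr d" using Y1 by (simp flip: powr_add)
      also have "\<dots> \<le> Y powr (- d) * ?c" using False Y1 d by (intro mult_left_mono powr_mono2) auto
      finally have "1 * (norm (U \<gamma> z) * norm (F z)) \<le> (Y powr (- d) * ?c) * (norm (U \<gamma> z) * norm (F z))"
        by (intro mult_right_mono) auto
      then have "ennreal (norm (U \<gamma> z) * norm (F z)) \<le> ennreal ((Y powr (- d) * norm (F z)) * (?c * norm (U \<gamma> z)))"
        by (intro ennreal_leI) (simp add: mult_ac)
      also have "\<dots> = ennreal (Y powr (- d) * norm (F z)) * ennreal (?c * norm (U \<gamma> z))"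
        by (rule ennreal_mult) auto
      also have "\<dots> \<le> ennreal (Y powr (- d) * norm (F z)) *
          (\<integral>\<^sup>+w. ennreal (2 * K * (norm (F w) * decay (s - d) (w - \<gamma>) * exp (- q * (norm (w - z))\<^sup>2))) \<partial>lborel)"
        unfolding U_def H_def F_def q_def using d by (intro mult_left_mono weighted_stft_loc_op[OF f \<gamma>]) auto
      also have "\<dots> = (\<integral>\<^sup>+w. ennreal (Y powr (- d) * norm (F z)) * ennreal (2 * K * (norm (F w) * decay (s - d) (w - \<gamma>) * exp (- q * (norm (w - z))\<^sup>2))) \<partial>lborel)"
        by (rule nn_integral_cmult[symmetric]) measurable
      also have "\<dots> = ?t3 \<gamma> z"
      proof (rule nn_integral_cong)
        fix w
        have "ennreal (Y powr (- d) * norm (F z)) * ennreal (2 * K * (norm (F w) * decay (s - d) (w - \<gamma>) * exp (- q * (norm (w - z))\<^sup>2)))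
          = ennreal ((Y powr (- d) * norm (F z)) * (2 * K * (norm (F w) * decay (s - d) (w - \<gamma>) * exp (- q * (norm (w - z))\<^sup>2))))"
          using K by (intro ennreal_mult[symmetric]) auto
        then show "ennreal (Y powr (- d) * norm (F z)) * ennreal (2 * K * (norm (F w) * decay (s - d) (w - \<gamma>) * exp (- q * (norm (w - z))\<^sup>2)))
          = ennreal (?k z w * decay (s - d) (w - \<gamma>))" by (simp only: c3_def mult_ac)
      qed
      also have "\<dots> \<le> ?t1 \<gamma> z + (?t2 \<gamma> z + ?t3 \<gamma> z)" by (simp add: add_increasing)
      finally show ?thesis .
    qed
    have m1: "?t1 \<gamma> \<in> borel_measurable lborel" if "\<gamma> \<in> X" for \<gamma> using U_meas[OF that] by measurable
    have m2: "?t2 \<gamma> \<in> borel_measurable lborel" for \<gamma> by measurable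
    have m3: "?t3 \<gamma> \<in> borel_measurable lborel" for \<gamma> by measurable
    have s1: "(\<Sum>\<gamma>\<in>X. \<integral>\<^sup>+z. ?t1 \<gamma> z \<partial>lborel) = ennreal (\<kappa> * (\<Sum>\<gamma>\<in>X. LINT t|lborel. (norm (H \<gamma> t))\<^sup>2))"
    proof -
      have "(\<integral>\<^sup>+z. ?t1 \<gamma> z \<partial>lborel) = ennreal (\<kappa> * (LINT t|lborel. (norm (H \<gamma> t))\<^sup>2))" if "\<gamma> \<in> X" for \<gamma>
      proof -
        have "(\<integral>\<^sup>+z. ?t1 \<gamma> z \<partial>lborel) = ennreal (LINT z|lborel. \<kappa> * (norm (U \<gamma> z))\<^sup>2)"
          using \<kappa> by (intro nn_integral_eq_integral) (auto simp: U_def intro!: stft_norm(1)[OF H[OF that]])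
        then show ?thesis by (simp add: U_def stft_norm(2)[OF H[OF that]])
      qed
      then show ?thesis using \<kappa> by (simp add: sum_distrib_left sum_ennreal)
    qed
    have s2: "(\<Sum>\<gamma>\<in>X. \<integral>\<^sup>+z. ?t2 \<gamma> z \<partial>lborel) \<le> ennreal (A / 4 * S)"
    proof -
      have "(\<Sum>\<gamma>\<in>X. \<integral>\<^sup>+z. ?t2 \<gamma> z \<partial>lborel) = (\<integral>\<^sup>+z. (\<Sum>\<gamma>\<in>X. ?t2 \<gamma> z) \<partial>lborel)"
        by (rule nn_integral_sum[symmetric]) (rule m2)
      also have "\<dots> \<le> (\<integral>\<^sup>+z. ennreal (A / 4) * ennreal ((norm (F z))\<^sup>2) \<partial>lborel)"
      proof (rule nn_integral_mono)
        fix z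
        have "(\<Sum>\<gamma>\<in>X. ?t2 \<gamma> z) = ennreal (A / (4 * M) * (norm (F z))\<^sup>2 * (\<Sum>\<gamma>\<in>X. decay s (z - \<gamma>)))"
          using A M by (simp add: sum_distrib_left sum_ennreal)
        also have "\<dots> \<le> ennreal (A / (4 * M) * (norm (F z))\<^sup>2 * M)"
          using A M X by (intro ennreal_leI mult_left_mono) auto
        also have "\<dots> = ennreal (A / 4) * ennreal ((norm (F z))\<^sup>2)"
          using A M by (simp flip: ennreal_mult)
        finally show "(\<Sum>\<gamma>\<in>X. ?t2 \<gamma> z) \<le> ennreal (A / 4) * ennreal ((norm (F z))\<^sup>2)" .
      qed
      also have "\<dots> = ennreal (A / 4) * (\<integral>\<^sup>+z. ennreal ((norm (F z))\<^sup>2) \<partial>lborel)"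
        by (rule nn_integral_cmult) measurable
      also have "\<dots> = ennreal (A / 4 * S)" unfolding F2n using A S0 by (intro ennreal_mult[symmetric]) auto
      finally show ?thesis .
    qed
    \<comment> \<open>Summing over \<gamma> under both integrals costs the factor M' and removes
      \<gamma> from the integrand; what remains is the Gaussian form of Schur's test.\<close>
    have s3: "(\<Sum>\<gamma>\<in>X. \<integral>\<^sup>+z. ?t3 \<gamma> z \<partial>lborel) \<le> ennreal (A / 4 * S)"
    proof -
      have "(\<Sum>\<gamma>\<in>X. \<integral>\<^sup>+z. ?t3 \<gamma> z \<partial>lborel) = (\<integral>\<^sup>+z. (\<Sum>\<gamma>\<in>X. ?t3 \<gamma> z) \<partial>lborel)"
        by (rule nn_integral_sum[symmetric]) (rule m3)
      also have "\<dots> = (\<integral>\<^sup>+z. \<integral>\<^sup>+w. (\<Sum>\<gamma>\<in>X. ennreal (?k z w * decay (s - d) (w - \<gamma>))) \<partial>lborel \<partial>lborel)"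
        by (rule nn_integral_cong, rule nn_integral_sum[symmetric]) measurable
      also have "\<dots> \<le> (\<integral>\<^sup>+z. \<integral>\<^sup>+w. ennreal (c3 * M') * ennreal (norm (F z) * norm (F w) * exp (- q * (norm (w - z))\<^sup>2)) \<partial>lborel \<partial>lborel)"
      proof (intro nn_integral_mono)
        fix z w
        have k0: "0 \<le> ?k z w" using c3 by simp
        have "(\<Sum>\<gamma>\<in>X. ennreal (?k z w * decay (s - d) (w - \<gamma>))) = ennreal (?k z w * (\<Sum>\<gamma>\<in>X. decay (s - d) (w - \<gamma>)))"
          unfolding sum_distrib_left by (rule sum_ennreal) (use k0 in auto)
        also have "\<dots> \<le> ennreal (?k z w * M')"
          using k0 X by (intro ennreal_leI mult_left_mono M'(2)) auto
        also have "\<dots> = ennreal ((c3 * M') * (norm (F z) * norm (F w) * exp (- q * (norm (w - z))\<^sup>2)))"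
          by (simp only: mult_ac)
        also have "\<dots> = ennreal (c3 * M') * ennreal (norm (F z) * norm (F w) * exp (- q * (norm (w - z))\<^sup>2))"
          using c3 M' by (intro ennreal_mult) auto
        finally show "(\<Sum>\<gamma>\<in>X. ennreal (?k z w * decay (s - d) (w - \<gamma>)))
           \<le> ennreal (c3 * M') * ennreal (norm (F z) * norm (F w) * exp (- q * (norm (w - z))\<^sup>2))" .
      qed
      also have "\<dots> = (\<integral>\<^sup>+z. ennreal (c3 * M') * (\<integral>\<^sup>+w. ennreal (norm (F z) * norm (F w) * exp (- q * (norm (w - z))\<^sup>2)) \<partial>lborel) \<partial>lborel)"
        by (rule nn_integral_cong, rule nn_integral_cmult) measurable
      also have "\<dots> = ennreal (c3 * M') * (\<integral>\<^sup>+z. \<integral>\<^sup>+w. ennreal (norm (F z) * norm (F w) * exp (- q * (norm (w - z))\<^sup>2)) \<partial>lborel \<partial>lborel)"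
        by (rule nn_integral_cmult) measurable
      also have "\<dots> \<le> ennreal (c3 * M') * (ennreal J * ennreal S)"
        using gaussian_Schur_bound[OF _ q, of F] unfolding J_def[symmetric] F2n by (intro mult_left_mono) auto
      also have "\<dots> = ennreal (c3 * M' * J * S)"
        using c3 M' J S0 by (simp add: ennreal_mult mult.assoc)
      also have "\<dots> \<le> ennreal (A / 4 * S)" by (intro ennreal_leI mult_right_mono c3 S0)
      finally show ?thesis .
    qed
    have "ennreal (\<Sum>\<gamma>\<in>X. LINT z|lborel. norm (U \<gamma> z) * norm (F z)) = (\<Sum>\<gamma>\<in>X. ennreal (LINT z|lborel. norm (U \<gamma> z) * norm (F z)))"
      by (rule sum_ennreal[symmetric]) simp
    also have "\<dots> = (\<Sum>\<gamma>\<in>X. \<integral>\<^sup>+z. ennreal (norm (U \<gamma> z) * norm (F z)) \<partial>lborel)"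
      by (intro sum.cong refl nn_integral_eq_integral[symmetric] UFn) auto
    also have "\<dots> \<le> (\<Sum>\<gamma>\<in>X. \<integral>\<^sup>+z. ?t1 \<gamma> z + (?t2 \<gamma> z + ?t3 \<gamma> z) \<partial>lborel)"
      by (intro sum_mono nn_integral_mono pt)
    also have "\<dots> = (\<Sum>\<gamma>\<in>X. (\<integral>\<^sup>+z. ?t1 \<gamma> z \<partial>lborel) + ((\<integral>\<^sup>+z. ?t2 \<gamma> z \<partial>lborel) + (\<integral>\<^sup>+z. ?t3 \<gamma> z \<partial>lborel)))"
    proof (rule sum.cong[OF refl])
      fix \<gamma> assume "\<gamma> \<in> X"
      show "(\<integral>\<^sup>+z. ?t1 \<gamma> z + (?t2 \<gamma> z + ?t3 \<gamma> z) \<partial>lborel) = (\<integral>\<^sup>+z. ?t1 \<gamma> z \<partial>lborel) + ((\<integral>\<^sup>+z. ?t2 \<gamma> z \<partial>lborel) + (\<integral>\<^sup>+z. ?t3 \<gamma> z \<partial>lborel))"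
        unfolding nn_integral_add[OF m1[OF \<open>\<gamma> \<in> X\<close>] borel_measurable_add[OF m2 m3]] nn_integral_add[OF m2 m3] ..
    qed
    also have "\<dots> \<le> ennreal (\<kappa> * (\<Sum>\<gamma>\<in>X. LINT t|lborel. (norm (H \<gamma> t))\<^sup>2)) + (ennreal (A / 4 * S) + ennreal (A / 4 * S))"
      unfolding sum.distrib s1 by (intro add_left_mono add_mono s2 s3)
    also have "\<dots> = ennreal (\<kappa> * (\<Sum>\<gamma>\<in>X. LINT t|lborel. (norm (H \<gamma> t))\<^sup>2) + A / 2 * S)"
      using \<kappa> A S0 by (simp add: sum_nonneg flip: ennreal_plus)
    finally have "(\<Sum>\<gamma>\<in>X. LINT z|lborel. norm (U \<gamma> z) * norm (F z)) \<le> \<kappa> * (\<Sum>\<gamma>\<in>X. LINT t|lborel. (norm (H \<gamma> t))\<^sup>2) + A / 2 * S"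
      using \<kappa> A S0 by (subst (asm) ennreal_le_iff) (auto intro!: add_nonneg_nonneg mult_nonneg_nonneg sum_nonneg)
    moreover have "(\<Sum>\<gamma>\<in>X. LINT z|lborel. \<eta> \<gamma> z * (norm (F z))\<^sup>2) \<le> (\<Sum>\<gamma>\<in>X. LINT z|lborel. norm (U \<gamma> z) * norm (F z))"
      by (intro sum_mono le1)
    ultimately show ?thesis unfolding F_def H_def S_def by linarith
  qed
  show thesis by (rule that[OF \<kappa> main])
qed

lemma finite_Int_cball:
  assumes "\<And>z. \<not> z islimpt \<Gamma>"
  shows "finite (\<Gamma> \<inter> cball 0 r)"
proof (rule ccontr)
  assume "infinite (\<Gamma> \<inter> cball 0 r)"
  then obtain z where "z islimpt (\<Gamma> \<inter> cball 0 r)"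
    using compact_eq_Bolzano_Weierstrass[of "cball 0 r :: (real \<times> real) set"] by (metis Int_lower2 compact_cball)
  then show False using assms[of z] islimpt_subset[of z "\<Gamma> \<inter> cball 0 r" \<Gamma>] by auto
qed

text \<open>Here \<tau> is any bound for the finite partial sums, so no infinite real sum of norms
  has to be formed. Since the symbols may be negative, the full sum is reached by dominated
  convergence along finite sets exhausting \<Gamma>, with majorant K M |V f|^2.\<close>

lemma lower_bound:
  assumes A: "A > 0" and total: "\<And>z. A \<le> (\<Sum>\<^sub>\<infinity>\<gamma>\<in>\<Gamma>. \<eta> \<gamma> z)" and discrete: "\<And>z. \<not> z islimpt \<Gamma>"
  obtains \<kappa> where "\<kappa> > 0" "\<And>f \<tau>. f \<in> L2 \<Longrightarrow>
    (\<And>X. finite X \<Longrightarrow> X \<subseteq> \<Gamma> \<Longrightarrow> (\<Sum>\<gamma>\<in>X. LINT t|lborel. (norm (loc_op (\<eta> \<gamma>) gauss0 f t))\<^sup>2) \<le> \<tau>) \<Longrightarrow>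
    A / 2 * (LINT t|lborel. (norm (f t))\<^sup>2) \<le> \<kappa> * \<tau>"
proof -
  obtain M where M: "M > 0" "\<And>X z. finite X \<Longrightarrow> X \<subseteq> \<Gamma> \<Longrightarrow> (\<Sum>\<gamma>\<in>X. decay s (z - \<gamma>)) \<le> M"
    using separated_sum_decay_bounded[OF s separated] by blast
  obtain \<kappa> where \<kappa>: "\<kappa> > 0" and fin: "\<And>f X. f \<in> L2 \<Longrightarrow> finite X \<Longrightarrow> X \<subseteq> \<Gamma> \<Longrightarrow>
    (\<Sum>\<gamma>\<in>X. LINT z|lborel. \<eta> \<gamma> z * (norm (stft gauss0 f z))\<^sup>2)
      \<le> \<kappa> * (\<Sum>\<gamma>\<in>X. LINT t|lborel. (norm (loc_op (\<eta> \<gamma>) gauss0 f t))\<^sup>2) + A / 2 * (LINT t|lborel. (norm (f t))\<^sup>2)"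
    using lower_bound_finite[OF A] by blast
  define X where "X n = \<Gamma> \<inter> cball 0 (real n)" for n
  have X: "finite (X n)" "X n \<subseteq> \<Gamma>" for n using finite_Int_cball[OF discrete] by (auto simp: X_def)
  have abs_sum: "(\<Sum>\<gamma>\<in>Z. \<bar>\<eta> \<gamma> z\<bar>) \<le> K * M" if "finite Z" "Z \<subseteq> \<Gamma>" for Z z
  proof -
    have "(\<Sum>\<gamma>\<in>Z. \<bar>\<eta> \<gamma> z\<bar>) \<le> (\<Sum>\<gamma>\<in>Z. K * decay s (z - \<gamma>))"
      using that by (intro sum_mono symbol_bound) auto
    also have "\<dots> \<le> K * M" unfolding sum_distrib_left[symmetric] using K that by (intro mult_left_mono M(2)) auto
    finally show ?thesis .
  qed
  have lim: "(\<lambda>n. \<Sum>\<gamma>\<in>X n. \<eta> \<gamma> z) \<longlonglongrightarrow> (\<Sum>\<^sub>\<infinity>\<gamma>\<in>\<Gamma>. \<eta> \<gamma> z)" for z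
  proof -
    \<comment> \<open>The infinite sum of a family that is not summable is 0 by convention; absolute
      summability makes it a genuine limit.\<close>
    have "(\<lambda>\<gamma>. norm (\<eta> \<gamma> z)) summable_on \<Gamma>"
      using abs_sum[of _ z] by (intro nonneg_bdd_above_summable_on) (auto intro!: bdd_aboveI[of _ "K * M"])
    then have "(\<lambda>\<gamma>. \<eta> \<gamma> z) summable_on \<Gamma>" by (rule abs_summable_summable)
    then have "((\<lambda>\<gamma>. \<eta> \<gamma> z) has_sum (\<Sum>\<^sub>\<infinity>\<gamma>\<in>\<Gamma>. \<eta> \<gamma> z)) \<Gamma>" by (rule has_sum_infsum)
    then have "((sum (\<lambda>\<gamma>. \<eta> \<gamma> z)) \<longlongrightarrow> (\<Sum>\<^sub>\<infinity>\<gamma>\<in>\<Gamma>. \<eta> \<gamma> z)) (finite_subsets_at_top \<Gamma>)"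
      by (simp add: has_sum_def)
    \<comment> \<open>Every finite subset of \<Gamma> lies in some ball, so the sets X n are cofinal
      and the unordered limit may be taken along a sequence, as dominated convergence
      demands.\<close>
    moreover have "filterlim X (finite_subsets_at_top \<Gamma>) sequentially"
      unfolding filterlim_finite_subsets_at_top
    proof (intro allI impI)
      fix Z assume Z: "finite Z \<and> Z \<subseteq> \<Gamma>"
      then have "bounded Z" by (simp add: finite_imp_bounded)
      then obtain r where r: "Z \<subseteq> ball 0 r" using bounded_subset_ballD by blast
      obtain n0 where "r \<le> real n0" using real_arch_simple by blast
      then have "Z \<subseteq> X n" if "n \<ge> n0" for n
        using r Z that unfolding X_def by (fastforce simp: subset_iff)
      then show "\<forall>\<^sub>F n in sequentially. finite (X n) \<and> Z \<subseteq> X n \<and> X n \<subseteq> \<Gamma>"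
        using X by (auto simp: eventually_sequentially)
    qed
    ultimately show ?thesis by (rule filterlim_compose)
  qed
  have main: "A / 2 * (LINT t|lborel. (norm (f t))\<^sup>2) \<le> \<kappa> * \<tau>" if f: "f \<in> L2"
    and \<tau>: "\<And>X. finite X \<Longrightarrow> X \<subseteq> \<Gamma> \<Longrightarrow> (\<Sum>\<gamma>\<in>X. LINT t|lborel. (norm (loc_op (\<eta> \<gamma>) gauss0 f t))\<^sup>2) \<le> \<tau>" for f \<tau>
  proof -
    note [measurable] = L2D(1)[OF f]
    define F where "F = stft gauss0 f"
    define S where "S = (LINT t|lborel. (norm (f t))\<^sup>2)"
    have [measurable]: "F \<in> borel_measurable borel" unfolding F_def by measurable
    have F2: "integrable lborel (\<lambda>z. (norm (F z))\<^sup>2)" "(LINT z|lborel. (norm (F z))\<^sup>2) = S"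
      unfolding F_def S_def using stft_norm[OF f] by auto
    define m where "m z = (\<Sum>\<^sub>\<infinity>\<gamma>\<in>\<Gamma>. \<eta> \<gamma> z)" for z
    have meas_n: "(\<lambda>z. \<Sum>\<gamma>\<in>X n. \<eta> \<gamma> z) \<in> borel_measurable borel" for n
      using X by (intro borel_measurable_sum symbol_measurable) auto
    have meas: "m \<in> borel_measurable borel"
    proof (rule borel_measurable_LIMSEQ_real)
      show "(\<lambda>n. \<Sum>\<gamma>\<in>X n. \<eta> \<gamma> z) \<longlonglongrightarrow> m z" for z unfolding m_def by (rule lim)
    qed (rule meas_n)
    have bd: "AE z in lborel. norm ((\<Sum>\<gamma>\<in>X n. \<eta> \<gamma> z) * (norm (F z))\<^sup>2) \<le> (K * M) * (norm (F z))\<^sup>2" for n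
    proof (rule AE_I2)
      fix z
      have "\<bar>\<Sum>\<gamma>\<in>X n. \<eta> \<gamma> z\<bar> \<le> K * M" using abs_sum[OF X] sum_abs order_trans by metis
      then have "\<bar>\<Sum>\<gamma>\<in>X n. \<eta> \<gamma> z\<bar> * (norm (F z))\<^sup>2 \<le> (K * M) * (norm (F z))\<^sup>2" by (intro mult_right_mono) auto
      then show "norm ((\<Sum>\<gamma>\<in>X n. \<eta> \<gamma> z) * (norm (F z))\<^sup>2) \<le> (K * M) * (norm (F z))\<^sup>2" by (simp add: abs_mult)
    qed
    have ptw: "AE z in lborel. (\<lambda>n. (\<Sum>\<gamma>\<in>X n. \<eta> \<gamma> z) * (norm (F z))\<^sup>2) \<longlonglongrightarrow> m z * (norm (F z))\<^sup>2"
      by (intro AE_I2 tendsto_mult tendsto_const) (simp add: m_def lim)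
    have m1: "(\<lambda>z. m z * (norm (F z))\<^sup>2) \<in> borel_measurable lborel" using meas by measurable
    have m2: "(\<lambda>z. (\<Sum>\<gamma>\<in>X n. \<eta> \<gamma> z) * (norm (F z))\<^sup>2) \<in> borel_measurable lborel" for n using meas_n[of n] by measurable
    have w: "integrable lborel (\<lambda>z. (K * M) * (norm (F z))\<^sup>2)" using F2 by simp
    have int_m: "integrable lborel (\<lambda>z. m z * (norm (F z))\<^sup>2)"
      by (rule integrable_dominated_convergence[OF m1 m2 w ptw bd])
    have "(\<lambda>n. LINT z|lborel. (\<Sum>\<gamma>\<in>X n. \<eta> \<gamma> z) * (norm (F z))\<^sup>2) \<longlonglongrightarrow> (LINT z|lborel. m z * (norm (F z))\<^sup>2)"
      by (rule integral_dominated_convergence[OF m1 m2 w ptw bd])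
    moreover have "(LINT z|lborel. (\<Sum>\<gamma>\<in>X n. \<eta> \<gamma> z) * (norm (F z))\<^sup>2) \<le> \<kappa> * \<tau> + A / 2 * S" for n
    proof -
      have i: "integrable lborel (\<lambda>z. \<eta> \<gamma> z * (norm (F z))\<^sup>2)" if "\<gamma> \<in> X n" for \<gamma>
      proof (rule Bochner_Integration.integrable_bound)
        have \<gamma>: "\<gamma> \<in> \<Gamma>" using X that by auto
        note [measurable] = symbol_measurable[OF \<gamma>]
        show "integrable lborel (\<lambda>z. K * (norm (F z))\<^sup>2)" using F2 by simp
        show "(\<lambda>z. \<eta> \<gamma> z * (norm (F z))\<^sup>2) \<in> borel_measurable lborel" by measurable
        show "AE z in lborel. norm (\<eta> \<gamma> z * (norm (F z))\<^sup>2) \<le> norm (K * (norm (F z))\<^sup>2)"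
          using symbol_bounded[OF \<gamma>] K by (auto simp: abs_mult intro!: mult_right_mono)
      qed
      have "(LINT z|lborel. (\<Sum>\<gamma>\<in>X n. \<eta> \<gamma> z) * (norm (F z))\<^sup>2) = (\<Sum>\<gamma>\<in>X n. LINT z|lborel. \<eta> \<gamma> z * (norm (F z))\<^sup>2)"
        unfolding sum_distrib_right by (rule Bochner_Integration.integral_sum) (rule i)
      also have "\<dots> \<le> \<kappa> * (\<Sum>\<gamma>\<in>X n. LINT t|lborel. (norm (loc_op (\<eta> \<gamma>) gauss0 f t))\<^sup>2) + A / 2 * S"
        unfolding F_def S_def by (rule fin[OF f X])
      also have "\<dots> \<le> \<kappa> * \<tau> + A / 2 * S" using \<kappa> \<tau>[OF X] by (intro add_right_mono mult_left_mono) auto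
      finally show ?thesis .
    qed
    ultimately have "(LINT z|lborel. m z * (norm (F z))\<^sup>2) \<le> \<kappa> * \<tau> + A / 2 * S"
      by (intro LIMSEQ_le_const2) auto
    moreover have "A * S \<le> (LINT z|lborel. m z * (norm (F z))\<^sup>2)"
    proof -
      have "(LINT z|lborel. A * (norm (F z))\<^sup>2) \<le> (LINT z|lborel. m z * (norm (F z))\<^sup>2)"
        using F2 int_m total by (intro integral_mono mult_right_mono) (auto simp: m_def)
      then show ?thesis using F2 by simp
    qed
    ultimately show ?thesis unfolding S_def[symmetric] by (simp add: field_simps)
  qed
  show thesis by (rule that[OF \<kappa> main])
qed

end

section \<open>From well-spread families to the frame inequality\<close>

lemma spread_symbols_if_well_spread:
  assumes "well_spread \<Gamma> \<eta>"
  obtains s K N where "spread_symbols \<Gamma> \<eta> s K N"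
proof -
  obtain g where g: "polynomial_decay g" "\<And>\<gamma> \<xi>. \<gamma> \<in> \<Gamma> \<Longrightarrow> \<bar>\<eta> \<gamma> \<xi>\<bar> \<le> g (\<xi> - \<gamma>)"
    using assms unfolding well_spread_def by blast
  obtain C s where s: "s > 1" and C: "\<And>z. \<bar>g z\<bar> \<le> C * decay s z"
    using g(1) by (auto simp: polynomial_decay_def decay_def)
  obtain N :: nat where N: "\<And>z. finite (\<Gamma> \<inter> cball z 1) \<and> card (\<Gamma> \<inter> cball z 1) \<le> N"
    using assms by (auto simp: well_spread_def discrete_no_accumulation_def)
  \<comment> \<open>The constant obtained for the envelope may be 0; the added 1 makes K strictly
    positive.\<close>
  have "\<bar>\<eta> \<gamma> \<xi>\<bar> \<le> (\<bar>C\<bar> + 1) * decay s (\<xi> - \<gamma>)" if "\<gamma> \<in> \<Gamma>" for \<gamma> \<xi>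
  proof -
    have "\<bar>\<eta> \<gamma> \<xi>\<bar> \<le> C * decay s (\<xi> - \<gamma>)"
      using g(2)[OF that, of \<xi>] C[of "\<xi> - \<gamma>"] by linarith
    also have "\<dots> \<le> (\<bar>C\<bar> + 1) * decay s (\<xi> - \<gamma>)" by (intro mult_right_mono) auto
    finally show ?thesis .
  qed
  then have "spread_symbols \<Gamma> \<eta> s (\<bar>C\<bar> + 1) N"
    using s N assms by unfold_locales (auto simp: well_spread_def)
  then show thesis by (rule that)
qed

text \<open>An infinite sum in \<open>ennreal\<close> is the supremum of its finite partial sums, so
  both bounds of the theorem reduce to finite X.\<close>

lemma infsum_ennreal_le_iff:
  fixes b :: "'a \<Rightarrow> ennreal"
  shows "(\<Sum>\<^sub>\<infinity>x\<in>A. b x) \<le> c \<longleftrightarrow> (\<forall>X. finite X \<and> X \<subseteq> A \<longrightarrow> sum b X \<le> c)"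
  by (subst nonneg_infsum_complete) (auto simp: SUP_le_iff)

theorem proposition3p5:
  fixes I :: "'i set" and \<phi> :: "'i \<Rightarrow> real \<Rightarrow> complex"
    and s C C0 :: real
    and \<Gamma> :: "(real \<times> real) set" and \<eta> :: "real \<times> real \<Rightarrow> real \<times> real \<Rightarrow> real"
    and i :: "real \<times> real \<Rightarrow> 'i"
  assumes windows: "\<forall>j\<in>I. \<phi> j \<in> L2"
    and s: "s > 1"
    and conv_bound: "\<forall>j\<in>I. \<forall>z.
          conv (\<lambda>w. norm (stft gauss0 (\<phi> j) w)) (\<lambda>w. norm (stft gauss0 (\<phi> j) w)) z
            \<le> C * (1 + (norm z)\<^sup>2) powr (- s)"
    and close: "\<forall>j\<in>I. \<forall>z.
          norm (stft gauss0 gauss0 z - stft gauss0 (\<phi> j) z) < C0 * norm (stft gauss0 gauss0 z)"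
    and C0: "2 * C0 < (LINT z|lborel. norm (stft gauss0 gauss0 z))"
    and symbols: "well_spread \<Gamma> \<eta>"
    and partition: "equivalent_on UNIV (\<lambda>z. \<Sum>\<^sub>\<infinity>\<gamma>\<in>\<Gamma>. \<eta> \<gamma> z) (\<lambda>_. 1)"
    and choice: "\<forall>\<gamma>\<in>\<Gamma>. i \<gamma> \<in> I"
  shows "\<exists>A B :: real. 0 < A \<and> 0 < B \<and>
    (\<forall>f\<in>L2.
       ennreal A * L2_norm_sq f \<le> (\<Sum>\<^sub>\<infinity>\<gamma>\<in>\<Gamma>. L2_norm_sq (loc_op (\<eta> \<gamma>) (\<phi> (i \<gamma>)) f)) \<and>
       (\<Sum>\<^sub>\<infinity>\<gamma>\<in>\<Gamma>. L2_norm_sq (loc_op (\<eta> \<gamma>) (\<phi> (i \<gamma>)) f)) \<le> ennreal B * L2_norm_sq f)"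
proof -
  obtain s' K N where "spread_symbols \<Gamma> \<eta> s' K N"
    using spread_symbols_if_well_spread[OF symbols] by blast
  then interpret spread_symbols \<Gamma> \<eta> s' K N .
  obtain A where A: "A > 0" "\<And>z. A \<le> (\<Sum>\<^sub>\<infinity>\<gamma>\<in>\<Gamma>. \<eta> \<gamma> z)"
    using partition by (auto simp: equivalent_on_def)
  have discrete: "\<And>z. \<not> z islimpt \<Gamma>"
    using symbols by (auto simp: well_spread_def discrete_no_accumulation_def)
  \<comment> \<open>An empty sum would be 0, below A. A point of \<Gamma> provides a window, and its
    strict closeness bound forces C0 > 0.\<close>
  have "\<Gamma> \<noteq> {}" using A(1) A(2)[of 0] by auto
  then obtain j where j: "j \<in> I" using choice by auto
  have C0_less: "C0 < 1" using C0 by (simp add: stft_gauss0_gauss0_L1)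
  have C0_pos: "C0 > 0"
  proof -
    have "0 < C0 * norm (stft gauss0 gauss0 0)"
      using close j norm_ge_zero by (meson order_le_less_trans)
    then show ?thesis by (simp add: zero_less_mult_iff)
  qed
  have "\<exists>c. norm (1 - c) < C0 \<and> (AE t in lborel. \<phi> (i \<gamma>) t = c * gauss0 t)" if "\<gamma> \<in> \<Gamma>" for \<gamma>
    using window_rigidity[of "\<phi> (i \<gamma>)" C0] windows close choice that by metis
  then obtain c where c: "\<And>\<gamma>. \<gamma> \<in> \<Gamma> \<Longrightarrow> norm (1 - c \<gamma>) < C0"
      "\<And>\<gamma>. \<gamma> \<in> \<Gamma> \<Longrightarrow> AE t in lborel. \<phi> (i \<gamma>) t = c \<gamma> * gauss0 t"
    by metis
  \<comment> \<open>The operator scales by |c|^2 and its norm is squared, whence the fourth power.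
    The bounds w0 and w1 are uniform in \<gamma> because |c| lies between 1 - C0 and 1 + C0.\<close>
  define w where "w \<gamma> = norm (c \<gamma>) ^ 4" for \<gamma>
  define w0 where "w0 = (1 - C0) ^ 4"
  define w1 where "w1 = (1 + C0) ^ 4"
  have w0: "w0 > 0" and w1: "w1 > 0" using C0_less C0_pos by (auto simp: w0_def w1_def)
  have w: "w0 \<le> w \<gamma>" "w \<gamma> \<le> w1" if "\<gamma> \<in> \<Gamma>" for \<gamma>
  proof -
    have "norm (c \<gamma>) \<le> 1 + C0" "1 - C0 \<le> norm (c \<gamma>)"
      using c(1)[OF that] norm_triangle_ineq4[of 1 "1 - c \<gamma>"] norm_triangle_ineq[of "1 - c \<gamma>" "c \<gamma>"] by simp_all
    then show "w0 \<le> w \<gamma>" "w \<gamma> \<le> w1"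
      unfolding w_def w0_def w1_def using C0_less by (auto intro!: power_mono)
  qed
  define a where "a f \<gamma> = (LINT t|lborel. (norm (loc_op (\<eta> \<gamma>) gauss0 f t))\<^sup>2)" for f \<gamma>
  have a0: "a f \<gamma> \<ge> 0" for f \<gamma> by (simp add: a_def)
  have summand: "L2_norm_sq (loc_op (\<eta> \<gamma>) (\<phi> (i \<gamma>)) f) = ennreal (w \<gamma> * a f \<gamma>)" if "f \<in> L2" "\<gamma> \<in> \<Gamma>" for f \<gamma>
  proof -
    have "L2_norm_sq (loc_op (\<eta> \<gamma>) (\<phi> (i \<gamma>)) f) = ennreal (w \<gamma>) * L2_norm_sq (loc_op (\<eta> \<gamma>) gauss0 f)"
      unfolding w_def using windows choice that
      by (intro L2_norm_sq_loc_op_multiple_window c symbol_integrable) auto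
    then show ?thesis
      using a0 by (simp add: L2_norm_sq_eq[OF loc_op_L2[OF that]] a_def w_def ennreal_mult)
  qed
  have sums: "(\<Sum>\<gamma>\<in>X. L2_norm_sq (loc_op (\<eta> \<gamma>) (\<phi> (i \<gamma>)) f)) = ennreal (\<Sum>\<gamma>\<in>X. w \<gamma> * a f \<gamma>)"
    if "f \<in> L2" "X \<subseteq> \<Gamma>" for f X
  proof -
    have "(\<Sum>\<gamma>\<in>X. L2_norm_sq (loc_op (\<eta> \<gamma>) (\<phi> (i \<gamma>)) f)) = (\<Sum>\<gamma>\<in>X. ennreal (w \<gamma> * a f \<gamma>))"
      using that by (intro sum.cong refl summand) auto
    also have "\<dots> = ennreal (\<Sum>\<gamma>\<in>X. w \<gamma> * a f \<gamma>)"
      by (rule sum_ennreal) (simp add: w_def a0)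
    finally show ?thesis .
  qed
  obtain B where B: "B > 0" and upper: "\<And>f X. f \<in> L2 \<Longrightarrow> finite X \<Longrightarrow> X \<subseteq> \<Gamma> \<Longrightarrow>
      (\<Sum>\<gamma>\<in>X. a f \<gamma>) \<le> B * (LINT t|lborel. (norm (f t))\<^sup>2)"
    unfolding a_def using upper_bound by blast
  obtain \<kappa> where \<kappa>: "\<kappa> > 0" and lower: "\<And>f \<tau>. f \<in> L2 \<Longrightarrow>
      (\<And>X. finite X \<Longrightarrow> X \<subseteq> \<Gamma> \<Longrightarrow> (\<Sum>\<gamma>\<in>X. a f \<gamma>) \<le> \<tau>) \<Longrightarrow> A / 2 * (LINT t|lborel. (norm (f t))\<^sup>2) \<le> \<kappa> * \<tau>"
    unfolding a_def using lower_bound[OF A discrete] by blast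
  \<comment> \<open>When the weighted sums are at most \<tau>, those of \<open>a f\<close> are at
    most \<tau> / w0, and \<open>lower\<close> gives A / 2 * S \<le> \<kappa> * (\<tau> / w0);
    solving for \<tau> yields A'.\<close>
  define A' where "A' = A * w0 / (2 * \<kappa>)"
  define B' where "B' = w1 * B"
  have "A' > 0" "B' > 0" using A w0 w1 \<kappa> B by (simp_all add: A'_def B'_def)
  moreover have "ennreal A' * L2_norm_sq f \<le> (\<Sum>\<^sub>\<infinity>\<gamma>\<in>\<Gamma>. L2_norm_sq (loc_op (\<eta> \<gamma>) (\<phi> (i \<gamma>)) f)) \<and>
       (\<Sum>\<^sub>\<infinity>\<gamma>\<in>\<Gamma>. L2_norm_sq (loc_op (\<eta> \<gamma>) (\<phi> (i \<gamma>)) f)) \<le> ennreal B' * L2_norm_sq f" if f: "f \<in> L2" for f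
  proof
    define S where "S = (LINT t|lborel. (norm (f t))\<^sup>2)"
    have S0: "S \<ge> 0" by (simp add: S_def)
    have S: "L2_norm_sq f = ennreal S" unfolding S_def by (rule L2_norm_sq_eq[OF f])
    let ?T = "\<Sum>\<^sub>\<infinity>\<gamma>\<in>\<Gamma>. L2_norm_sq (loc_op (\<eta> \<gamma>) (\<phi> (i \<gamma>)) f)"
    show "?T \<le> ennreal B' * L2_norm_sq f"
      unfolding infsum_ennreal_le_iff
    proof (intro allI impI)
      fix X assume X: "finite X \<and> X \<subseteq> \<Gamma>"
      have "(\<Sum>\<gamma>\<in>X. w \<gamma> * a f \<gamma>) \<le> (\<Sum>\<gamma>\<in>X. w1 * a f \<gamma>)"
        using X by (intro sum_mono mult_right_mono w a0) auto
      also have "\<dots> \<le> w1 * (B * S)"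
        unfolding sum_distrib_left[symmetric] S_def using X w1 by (intro mult_left_mono upper f) auto
      finally have "ennreal (\<Sum>\<gamma>\<in>X. w \<gamma> * a f \<gamma>) \<le> ennreal (B' * S)"
        by (intro ennreal_leI) (simp add: B'_def mult.assoc)
      also have "\<dots> = ennreal B' * L2_norm_sq f"
        unfolding S using S0 \<open>B' > 0\<close> by (intro ennreal_mult) auto
      finally show "(\<Sum>\<gamma>\<in>X. L2_norm_sq (loc_op (\<eta> \<gamma>) (\<phi> (i \<gamma>)) f)) \<le> ennreal B' * L2_norm_sq f"
        using sums[OF f] X by simp
    qed
    show "ennreal A' * L2_norm_sq f \<le> ?T"
    \<comment> \<open>An infinite sum leaves nothing to show; a finite value bounds all partial sums
      and supplies the \<tau> of \<open>lower\<close> after division by w0.\<close>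
    proof (cases ?T)
      case (real \<tau>)
      have "(\<Sum>\<gamma>\<in>X. a f \<gamma>) \<le> \<tau> / w0" if X: "finite X" "X \<subseteq> \<Gamma>" for X
      proof -
        have "ennreal (\<Sum>\<gamma>\<in>X. w \<gamma> * a f \<gamma>) \<le> ennreal \<tau>"
          using infsum_ennreal_le_iff[of "\<lambda>\<gamma>. L2_norm_sq (loc_op (\<eta> \<gamma>) (\<phi> (i \<gamma>)) f)" \<Gamma> "ennreal \<tau>"] real(2) X
          unfolding sums[OF f X(2), symmetric] by simp
        then have "(\<Sum>\<gamma>\<in>X. w \<gamma> * a f \<gamma>) \<le> \<tau>" using real(1) by simp
        moreover have "w0 * (\<Sum>\<gamma>\<in>X. a f \<gamma>) \<le> (\<Sum>\<gamma>\<in>X. w \<gamma> * a f \<gamma>)"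
          unfolding sum_distrib_left using X by (intro sum_mono mult_right_mono w a0) auto
        ultimately show ?thesis using w0 by (simp add: field_simps)
      qed
      then have "A / 2 * S \<le> \<kappa> * (\<tau> / w0)" unfolding S_def by (intro lower f) auto
      then have "A' * S \<le> \<tau>" using w0 \<kappa> by (simp add: A'_def field_simps)
      then have "ennreal (A' * S) \<le> ennreal \<tau>" by (rule ennreal_leI)
      then show ?thesis unfolding real(2) S using \<open>A' > 0\<close> S0 by (simp add: ennreal_mult)
    qed simp
  qed
  ultimately show ?thesis by blast
qed

end
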